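(* Let $X$ be a compact Hausdorff space and let $h \colon X \to X$ be a minimal homeomorphism. Let $Y \subset X$ be a nonempty compact subset such that $h^n(Y) \cap Y = \varnothing$ for all $n \in \mathbb{Z} \setminus \{0\}$. Then $C^*(\mathbb{Z}, X, h)_Y$ is a large subalgebra of $C^*(\mathbb{Z}, X, h)$ of crossed product type.
   Context: $C^*(\mathbb{Z}, X, h)$ is the crossed product of $C(X)$ by the automorphism $f \mapsto f \circ h^{-1}$; it contains $C(X)$, and $u$ is its standard unitary, so $u f u^* = f \circ h^{-1}$ for $f \in C(X)$. For closed nonempty $Y \subset X$, $C_0(X \setminus Y) = \{ f \in C(X) \colon f|_Y = 0 \}$, and the $Y$-orbit breaking subalgebra $C^*(\mathbb{Z}, X, h)_Y$ is the C*-subalgebra of $C^*(\mathbb{Z}, X, h)$ generated by $C(X)$ and $C_0(X \setminus Y) u = \{ f u \colon f \in C_0(X \setminus Y) \}$. A homeomorphism is minimal if it has no nontrivial closed invariant subsets. Subalgebras are C*-subalgebras. For a C*-algebra $D$ and $a, b \in D_{+}$ (positive elements), $a \precsim_D b$ (Cuntz subequivalence) means there is a sequence $(v_n)$ in $D$ with $\lim_{n \to \infty} v_n b v_n^* = a$. Large subalgebra of crossed product type: let $A$ be an infinite dimensional simple unital C*-algebra. A subalgebra $B \subset A$ is a large subalgebra of crossed product type if there exist a subalgebra $C \subset B$ and a subset $G$ of the unitary group of $A$ such that: (1) (a) $C$ contains the identity of $A$; (b) $C$ and $G$ generate $A$ as a C*-algebra; (c) $u C u^* \subset C$ and $u^*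 C u \subset C$ for all $u \in G$. (2) For every integer $m \geq 1$, $a_1, \ldots, a_m \in A$, $\varepsilon > 0$, $x \in A_{+}$ with $\|x\| = 1$, and $y \in B_{+} \setminus \{0\}$, there are $c_1, \ldots, c_m \in A$ and $g \in C$ such that: (a) $0 \leq g \leq 1$; (b) $\|c_j - a_j\| < \varepsilon$ for all $j$; (c) $(1-g) c_j \in B$ for all $j$; (d) $g \precsim_B y$ and $g \precsim_A x$; (e) $\|(1-g) x (1-g)\| > 1 - \varepsilon$. *)

theory Defs
  imports "HOL-Analysis.Analysis"
begin

text \<open>
  The real scalar multiplication of the library classes is the restriction of the complex one.
  The zero algebra is excluded, since \<^class>\<open>real_normed_algebra_1\<close> has \<open>norm 1 = 1\<close>.
\<close>

class unital_cstar_algebra = real_normed_algebra_1 + banach +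
  fixes scaleC :: "complex \<Rightarrow> 'a \<Rightarrow> 'a" (infixr \<open>*\<^sub>C\<close> 75)
    and star :: "'a \<Rightarrow> 'a"
  assumes scaleC_add_right: "c *\<^sub>C (a + b) = c *\<^sub>C a + c *\<^sub>C b"
    and scaleC_add_left: "(c + d) *\<^sub>C a = c *\<^sub>C a + d *\<^sub>C a"
    and scaleC_scaleC: "c *\<^sub>C d *\<^sub>C a = (c * d) *\<^sub>C a"
    and scaleC_of_real: "complex_of_real r *\<^sub>C a = scaleR r a"
    and mult_scaleC_left: "(c *\<^sub>C a) * b = c *\<^sub>C (a * b)"
    and mult_scaleC_right: "a * (c *\<^sub>C b) = c *\<^sub>C (a * b)"
    and norm_scaleC: "norm (c *\<^sub>C a) = cmod c * norm a"
    and star_star: "star (star a) = a"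
    and star_add: "star (a + b) = star a + star b"
    and star_scaleC: "star (c *\<^sub>C a) = cnj c *\<^sub>C star a"
    and star_mult: "star (a * b) = star b * star a"
    and cstar_identity: "norm (star a * a) = (norm a)\<^sup>2"

definition unitary :: "'a::unital_cstar_algebra \<Rightarrow> bool"
  where "unitary u \<longleftrightarrow> star u * u = 1 \<and> u * star u = 1"

definition spectrum :: "'a::unital_cstar_algebra \<Rightarrow> complex set"
  where "spectrum a = {c. \<not> (\<exists>b. (a - c *\<^sub>C 1) * b = 1 \<and> b * (a - c *\<^sub>C 1) = 1)}"

text \<open>
  For a C*-subalgebra \<open>D\<close>, the positive elements of \<open>D\<close> are the elements of \<open>D\<close> that are positive
  in the ambient algebra (spectral permanence), so \<open>a \<in> D\<^sub>+\<close> is written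
  \<open>a \<in> D \<and> positive a\<close>.
\<close>

definition positive :: "'a::unital_cstar_algebra \<Rightarrow> bool"
  where "positive a \<longleftrightarrow> star a = a \<and> spectrum a \<subseteq> complex_of_real ` {0..}"

definition cstar_subalgebra :: "'a::unital_cstar_algebra set \<Rightarrow> bool"
  where "cstar_subalgebra S \<longleftrightarrow>
    0 \<in> S \<and> (\<forall>a\<in>S. \<forall>b\<in>S. a + b \<in> S) \<and> (\<forall>c. \<forall>a\<in>S. c *\<^sub>C a \<in> S) \<and>
    (\<forall>a\<in>S. \<forall>b\<in>S. a * b \<in> S) \<and> (\<forall>a\<in>S. star a \<in> S) \<and> closed S"

text \<open>
  The C*-subalgebra generated by \<open>S\<close> is \<open>cstar_subalgebra hull S\<close>; it need not contain \<open>1\<close>.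
\<close>

definition infinite_dimensional :: "'a::unital_cstar_algebra itself \<Rightarrow> bool"
  where "infinite_dimensional _ \<longleftrightarrow>
    \<not> (\<exists>F::'a set. finite F \<and> (\<forall>a. \<exists>c. a = (\<Sum>b\<in>F. c b *\<^sub>C b)))"

definition closed_ideal :: "'a::unital_cstar_algebra set \<Rightarrow> bool"
  where "closed_ideal I \<longleftrightarrow>
    closed I \<and> 0 \<in> I \<and> (\<forall>a\<in>I. \<forall>b\<in>I. a + b \<in> I) \<and> (\<forall>c. \<forall>a\<in>I. c *\<^sub>C a \<in> I) \<and>
    (\<forall>a\<in>I. \<forall>b. a * b \<in> I \<and> b * a \<in> I)"

definition simple_cstar_algebra :: "'a::unital_cstar_algebra itself \<Rightarrow> bool"
  where "simple_cstar_algebra _ \<longleftrightarrow> (\<forall>I::'a set. closed_ideal I \<longrightarrow> I = {0} \<or> I = UNIV)"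

definition cuntz_subeq :: "'a::unital_cstar_algebra set \<Rightarrow> 'a \<Rightarrow> 'a \<Rightarrow> bool"
  where "cuntz_subeq D a b \<longleftrightarrow>
    (\<exists>v::nat \<Rightarrow> 'a. (\<forall>n. v n \<in> D) \<and> (\<lambda>n. v n * b * star (v n)) \<longlonglongrightarrow> a)"

text \<open>The containing algebra \<open>A\<close> is the whole type \<open>'a\<close>.\<close>

definition large_subalgebra_crossed_product_type :: "'a::unital_cstar_algebra set \<Rightarrow> bool"
  where "large_subalgebra_crossed_product_type B \<longleftrightarrow>
    infinite_dimensional TYPE('a) \<and> simple_cstar_algebra TYPE('a) \<and> cstar_subalgebra B \<and>
    (\<exists>C G.
      cstar_subalgebra C \<and> C \<subseteq> B \<and> (\<forall>u\<in>G. unitary u) \<and>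
      1 \<in> C \<and>
      cstar_subalgebra hull (C \<union> G) = UNIV \<and>
      (\<forall>u\<in>G. \<forall>c\<in>C. u * c * star u \<in> C \<and> star u * c * u \<in> C) \<and>
      (\<forall>(m::nat) (a::nat \<Rightarrow> 'a) (\<epsilon>::real) x y.
        m \<ge> 1 \<and> \<epsilon> > 0 \<and> positive x \<and> norm x = 1 \<and> y \<in> B \<and> positive y \<and> y \<noteq> 0 \<longrightarrow>
        (\<exists>(c::nat \<Rightarrow> 'a) g.
          g \<in> C \<and>
          positive g \<and> positive (1 - g) \<and>
          (\<forall>j\<in>{1..m}. norm (c j - a j) < \<epsilon>) \<and>
          (\<forall>j\<in>{1..m}. (1 - g) * c j \<in> B) \<and>
          cuntz_subeq B g y \<and> cuntz_subeq UNIV g x \<and>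
          norm ((1 - g) * x * (1 - g)) > 1 - \<epsilon>)))"

text \<open>For a bijection \<open>h\<close>, the power with integer exponent.\<close>

definition int_funpow :: "('x \<Rightarrow> 'x) \<Rightarrow> int \<Rightarrow> 'x \<Rightarrow> 'x"
  where "int_funpow h n = (if n \<ge> 0 then h ^^ nat n else inv h ^^ nat (- n))"

definition minimal_homeomorphism :: "('x::topological_space \<Rightarrow> 'x) \<Rightarrow> bool"
  where "minimal_homeomorphism h \<longleftrightarrow>
    homeomorphism UNIV UNIV h (inv h) \<and>
    (\<forall>Z. closed Z \<and> h ` Z = Z \<longrightarrow> Z = {} \<or> Z = UNIV)"

definition cont_functions :: "('x::topological_space \<Rightarrow> complex) set"
  where "cont_functions = {f. continuous_on UNIV f}"

text \<open>
  The *-algebra \<open>C\<^sub>c(\<int>, C(X))\<close>: finitely supported functions \<open>\<int> \<rightarrow> C(X)\<close>, where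
  \<open>a\<close> stands for the formal sum of the \<open>a(n) u\<^sup>n\<close>. With \<open>\<alpha>\<^sub>k(f) = f \<circ> h\<^sup>-\<^sup>k\<close>, its operations are
  \<open>(a b)(n) = \<Sum>\<^sub>k a(k) \<alpha>\<^sub>k(b(n - k))\<close> and \<open>a\<^sup>*(n) = \<alpha>\<^sub>n(a(-n)\<^sup>*)\<close>.
\<close>

definition conv_algebra :: "(int \<Rightarrow> 'x::topological_space \<Rightarrow> complex) set"
  where "conv_algebra = {a. (\<forall>n. a n \<in> cont_functions) \<and> finite {n. a n \<noteq> (\<lambda>_. 0)}}"

definition conv_mult ::
  "('x \<Rightarrow> 'x) \<Rightarrow> (int \<Rightarrow> 'x \<Rightarrow> complex) \<Rightarrow> (int \<Rightarrow> 'x \<Rightarrow> complex) \<Rightarrow> int \<Rightarrow> 'x \<Rightarrow> complex"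
  where "conv_mult h a b n x =
    (\<Sum>k | a k \<noteq> (\<lambda>_. 0). a k x * b (n - k) (int_funpow h (- k) x))"

definition conv_star :: "('x \<Rightarrow> 'x) \<Rightarrow> (int \<Rightarrow> 'x \<Rightarrow> complex) \<Rightarrow> int \<Rightarrow> 'x \<Rightarrow> complex"
  where "conv_star h a n x = cnj (a (- n) (int_funpow h (- n) x))"

definition cstar_seminorm ::
  "('x::topological_space \<Rightarrow> 'x) \<Rightarrow> ((int \<Rightarrow> 'x \<Rightarrow> complex) \<Rightarrow> real) \<Rightarrow> bool"
  where "cstar_seminorm h p \<longleftrightarrow>
    (\<forall>a\<in>conv_algebra. \<forall>b\<in>conv_algebra. p (\<lambda>n x. a n x + b n x) \<le> p a + p b) \<and>
    (\<forall>c. \<forall>a\<in>conv_algebra. p (\<lambda>n x. c * a n x) = cmod c * p a) \<and>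
    (\<forall>a\<in>conv_algebra. \<forall>b\<in>conv_algebra. p (conv_mult h a b) \<le> p a * p b) \<and>
    (\<forall>a\<in>conv_algebra. p (conv_mult h (conv_star h a) a) = (p a)\<^sup>2)"

text \<open>
  The universal C*-norm. C*-seminorms are exactly the functions \<open>a \<mapsto> \<parallel>\<sigma>(a)\<parallel>\<close> for
  *-homomorphisms \<open>\<sigma>\<close> from the convolution algebra to C*-algebras, that is, for integrated forms of
  covariant representations; taking seminorms avoids a quantification over types of Hilbert
  spaces. For compact \<open>X\<close> and a homeomorphism \<open>h\<close> the supremum is over a nonempty set bounded by
  \<open>\<Sum>\<^sub>n \<parallel>a(n)\<parallel>\<close>, because a C*-seminorm is at most the supremum norm on \<open>C(X)\<close>, and at most \<open>1\<close>
  at the unitaries \<open>u\<^sup>n\<close>.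
\<close>

definition universal_norm ::
  "('x::topological_space \<Rightarrow> 'x) \<Rightarrow> (int \<Rightarrow> 'x \<Rightarrow> complex) \<Rightarrow> real"
  where "universal_norm h a = (SUP p\<in>{p. cstar_seminorm h p}. p a)"

definition unitary_power :: "'a::unital_cstar_algebra \<Rightarrow> int \<Rightarrow> 'a"
  where "unitary_power u n = (if n \<ge> 0 then u ^ nat n else star u ^ nat (- n))"

definition integrated_form ::
  "(('x \<Rightarrow> complex) \<Rightarrow> 'a::unital_cstar_algebra) \<Rightarrow> 'a \<Rightarrow> (int \<Rightarrow> 'x \<Rightarrow> complex) \<Rightarrow> 'a"
  where "integrated_form \<iota> u a = (\<Sum>n | a n \<noteq> (\<lambda>_. 0). \<iota> (a n) * unitary_power u n)"

text \<open>
  The C*-algebra \<open>'a\<close>, with \<open>\<iota>\<close> the inclusion of \<open>C(X)\<close> and \<open>u\<close> the standard unitary, is the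
  (full) crossed product \<open>C\<^sup>*(\<int>, X, h)\<close>: \<open>(\<iota>, u)\<close> is a unital covariant pair whose integrated form
  makes \<open>'a\<close> a completion of \<open>C\<^sub>c(\<int>, C(X))\<close> in the universal norm. This determines
  \<open>('a, \<iota>, u)\<close> up to isomorphism. Only the values of \<open>\<iota>\<close> on continuous functions matter.
\<close>

definition is_crossed_product ::
  "('x::topological_space \<Rightarrow> 'x) \<Rightarrow> (('x \<Rightarrow> complex) \<Rightarrow> 'a::unital_cstar_algebra) \<Rightarrow> 'a \<Rightarrow> bool"
  where "is_crossed_product h \<iota> u \<longleftrightarrow>
    (\<forall>f\<in>cont_functions. \<forall>g\<in>cont_functions. \<iota> (\<lambda>x. f x + g x) = \<iota> f + \<iota> g) \<and>
    (\<forall>c. \<forall>f\<in>cont_functions. \<iota> (\<lambda>x. c * f x) = c *\<^sub>C \<iota> f) \<and>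
    (\<forall>f\<in>cont_functions. \<forall>g\<in>cont_functions. \<iota> (\<lambda>x. f x * g x) = \<iota> f * \<iota> g) \<and>
    (\<forall>f\<in>cont_functions. \<iota> (\<lambda>x. cnj (f x)) = star (\<iota> f)) \<and>
    \<iota> (\<lambda>_. 1) = 1 \<and>
    unitary u \<and>
    (\<forall>f\<in>cont_functions. u * \<iota> f * star u = \<iota> (f \<circ> inv h)) \<and>
    (\<forall>a\<in>conv_algebra. norm (integrated_form \<iota> u a) = universal_norm h a) \<and>
    closure (integrated_form \<iota> u ` conv_algebra) = UNIV"

definition orbit_breaking_subalgebra ::
  "(('x::topological_space \<Rightarrow> complex) \<Rightarrow> 'a::unital_cstar_algebra) \<Rightarrow> 'a \<Rightarrow> 'x set \<Rightarrow> 'a set"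
  where "orbit_breaking_subalgebra \<iota> u Y = cstar_subalgebra hull
    (\<iota> ` cont_functions \<union> {\<iota> f * u | f. f \<in> cont_functions \<and> (\<forall>y\<in>Y. f y = 0)})"

end

theory Submission
  imports Defs
begin

text \<open>
  Take \<open>C = C(X)\<close> and \<open>G = {u}\<close>. Every element of the crossed product is approximated by finite sums
  \<open>\<Sum> u\<^sup>m w\<^sub>m\<close> with \<open>w\<^sub>m \<in> C(X)\<close>. The action is free, so a bump function \<open>e\<close> with small support
  compresses such a sum \<open>W\<close> to \<open>e W* W e = e\<^sup>2 \<Sum> |w\<^sub>m|\<^sup>2\<close>. The powers of a self-adjoint finite
  sum \<open>T\<close> have linearly many coefficients, hence for every \<open>\<kappa> < \<parallel>T\<parallel>\<^sup>2\<close> there are \<open>n\<close> and \<open>z\<close> such that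
  the vector \<open>T\<^sup>n \<delta>\<^sub>0\<close> in the orbit representation at \<open>z\<close> satisfies
  \<open>\<parallel>T\<^sup>n\<^sup>+\<^sup>1 \<delta>\<^sub>0\<parallel>\<^sup>2 > \<kappa> \<parallel>T\<^sup>n \<delta>\<^sub>0\<parallel>\<^sup>2\<close>. With \<open>T\<close> close to the square root of a positive element
  \<open>x\<close>, this yields a nonzero positive function that is Cuntz subequivalent to \<open>x\<close>, within any
  subalgebra that contains \<open>C(X)\<close> and has a dense set of finite sums. Simplicity follows, as does the
  estimate for \<open>(1 - g) x (1 - g)\<close>, because only finitely many points of an orbit that
  avoids \<open>Y\<close> matter. Finally, by minimality, the pieces of a neighbourhood of finitely many
  translates of \<open>Y\<close> can be moved inside \<open>B\<close> to disjoint sets on which a given positive function is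
  nonzero; so \<open>g\<close> can be chosen equal to \<open>1\<close> on these translates and small in the Cuntz sense.
\<close>

section \<open>Square roots and order in a C*-algebra\<close>

text \<open>The usual source of a function below \<open>x\<close> is the faithful conditional
  expectation onto C(X). Here coefficients exist only for finite sums, while \<open>x\<close> is
  merely close to one: compressing \<open>x\<close> by a bump alone compares the mass of a finite
  sum with an approximation error that may well exceed it. Passing from the base vector to its image
  under \<open>T ^ n\<close> removes this obstacle. For \<open>D = T ^ n * \<iota>r e\<close> the
  error costs at most \<open>\<kappa> / 2\<close> times \<open>star D * D\<close>, whereas
  \<open>star D * (T * T) * D\<close> is at least \<open>\<kappa>\<close> times
  \<open>star D * D\<close>, however small the latter is; so half of a positive function survives
  below \<open>star D * x * D\<close>. Orbit representations are only a guide: all computations use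
  coefficient functions inside the algebra. Positivity is given by the spectrum, but sums and
  conjugates of positive elements are needed, so it is first traded for a norm criterion, and power
  series take the place of the functional calculus.\<close>

lemma star_zero [simp]: "star (0::'a::unital_cstar_algebra) = 0"
  using star_add[of "0::'a" 0] by simp

lemma star_minus [simp]: "star (- a) = - star (a::'a::unital_cstar_algebra)"
  using star_add[of a "- a"] by (simp add: eq_neg_iff_add_eq_0 add.commute)

lemma star_diff [simp]: "star (a - b) = star a - star (b::'a::unital_cstar_algebra)"
  using star_add[of a "- b"] by simp

lemma star_one [simp]: "star (1::'a::unital_cstar_algebra) = 1"
  using star_mult[of "star (1::'a)" 1] by (simp add: star_star)

lemma scaleC_one [simp]: "1 *\<^sub>C a = (a::'a::unital_cstar_algebra)"
  using scaleC_of_real[of 1 a] by simp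

lemma scaleC_zero_left [simp]: "0 *\<^sub>C a = (0::'a::unital_cstar_algebra)"
  using scaleC_of_real[of 0 a] by simp

lemma scaleC_zero_right [simp]: "c *\<^sub>C 0 = (0::'a::unital_cstar_algebra)"
  using scaleC_add_right[of c "0::'a" 0] by simp

lemma scaleC_minus_left: "(- c) *\<^sub>C a = - (c *\<^sub>C (a::'a::unital_cstar_algebra))"
  using scaleC_add_left[of c "- c" a] by (simp add: eq_neg_iff_add_eq_0 add.commute)

lemma scaleC_minus_right: "c *\<^sub>C (- a) = - (c *\<^sub>C (a::'a::unital_cstar_algebra))"
  using scaleC_add_right[of c a "- a"] by (simp add: eq_neg_iff_add_eq_0 add.commute)

lemma scaleC_diff_right: "c *\<^sub>C (a - b) = c *\<^sub>C a - c *\<^sub>C (b::'a::unital_cstar_algebra)"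
  using scaleC_add_right[of c a "- b"] by (simp add: scaleC_minus_right)

lemma star_scaleR [simp]: "star (r *\<^sub>R a) = r *\<^sub>R star (a::'a::unital_cstar_algebra)"
  using star_scaleC[of "complex_of_real r" a] by (simp add: scaleC_of_real)

lemma star_power: "star (a ^ n) = star (a::'a::unital_cstar_algebra) ^ n"
  by (induction n) (simp_all add: star_mult power_commutes)

lemma norm_star [simp]: "norm (star a) = norm (a::'a::unital_cstar_algebra)"
proof -
  have le: "norm b \<le> norm (star b)" for b :: 'a
  proof (cases "b = 0")
    case False
    have "norm b * norm b \<le> norm (star b) * norm b"
      using cstar_identity[of b] norm_mult_ineq[of "star b" b] by (simp add: power2_eq_square)
    with False show ?thesis by simp
  qed simp
  show ?thesis using le[of a] le[of "star a"] by (simp add: star_star)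
qed

lemma bounded_linear_star: "bounded_linear (star :: 'a::unital_cstar_algebra \<Rightarrow> 'a)"
  by (rule bounded_linear_intro[where K=1]) (simp_all add: star_add)

lemmas tendsto_star [tendsto_intros] = bounded_linear.tendsto[OF bounded_linear_star]

lemma norm_square_sa: "star a = a \<Longrightarrow> norm (a * a) = (norm (a::'a::unital_cstar_algebra))\<^sup>2"
  using cstar_identity[of a] by simp

lemma cstar_identity': "norm (a * star a) = (norm (a::'a::unital_cstar_algebra))\<^sup>2"
  using cstar_identity[of "star a"] by (simp add: star_star)

text \<open>The C*-identity settles the exponents \<open>2 ^ k\<close>. For general
  \<open>n\<close>, multiply up to the next such power: a loss in \<open>norm (a ^ n)\<close> would
  show up there.\<close>

lemma norm_power_sa:
  fixes a :: "'a::unital_cstar_algebra"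
  assumes "star a = a"
  shows "norm (a ^ n) = norm a ^ n"
proof -
  have two: "norm (a ^ (2 ^ k)) = norm a ^ (2 ^ k)" for k
  proof (induction k)
    case (Suc k)
    have "norm (a ^ (2 ^ Suc k)) = norm (a ^ (2 ^ k) * a ^ (2 ^ k))"
      by (simp add: power_add[symmetric] mult_2)
    also have "\<dots> = (norm (a ^ (2 ^ k)))\<^sup>2" by (rule norm_square_sa) (simp add: star_power assms)
    finally show ?case using Suc by (simp add: power_mult[symmetric] mult.commute)
  qed simp
  obtain k where k: "n < 2 ^ k" using less_exp by blast
  show ?thesis
  proof (cases "a = 0")
    case True
    then show ?thesis by (cases n) auto
  next
    case False
    let ?m = "2 ^ k - n"
    have "norm a ^ n * norm a ^ ?m = norm (a ^ n * a ^ ?m)"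
      using two[of k] k by (simp add: power_add[symmetric])
    also have "\<dots> \<le> norm (a ^ n) * norm a ^ ?m"
      by (rule order_trans[OF norm_mult_ineq mult_left_mono[OF norm_power_ineq]]) simp
    finally have "norm a ^ n \<le> norm (a ^ n)" using False by simp
    with norm_power_ineq[of a n] show ?thesis by simp
  qed
qed

lemma cstar_subalgebraD:
  assumes "cstar_subalgebra (B::'a::unital_cstar_algebra set)"
  shows "0 \<in> B" "\<And>a b. a \<in> B \<Longrightarrow> b \<in> B \<Longrightarrow> a + b \<in> B" "\<And>c a. a \<in> B \<Longrightarrow> c *\<^sub>C a \<in> B"
    "\<And>a b. a \<in> B \<Longrightarrow> b \<in> B \<Longrightarrow> a * b \<in> B" "\<And>a. a \<in> B \<Longrightarrow> star a \<in> B" "closed B"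
  using assms unfolding cstar_subalgebra_def by auto

lemma cstar_subalgebra_diff:
  assumes "cstar_subalgebra B" "a \<in> B" "b \<in> (B::'a::unital_cstar_algebra set)"
  shows "a - b \<in> B"
  using cstar_subalgebraD(2)[OF assms(1,2) cstar_subalgebraD(3)[OF assms(1,3), of "-1"]]
  by (simp add: scaleC_minus_left)

lemma cstar_subalgebra_scaleR:
  assumes "cstar_subalgebra B" "a \<in> (B::'a::unital_cstar_algebra set)"
  shows "r *\<^sub>R a \<in> B"
  using cstar_subalgebraD(3)[OF assms, of "complex_of_real r"] by (simp add: scaleC_of_real)

lemma cstar_subalgebra_power:
  assumes "cstar_subalgebra B" "1 \<in> B" "a \<in> (B::'a::unital_cstar_algebra set)"
  shows "a ^ n \<in> B"
  using assms(2,3) by (induction n) (auto intro: cstar_subalgebraD[OF assms(1)])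

lemma cstar_subalgebra_sum:
  assumes "cstar_subalgebra B" "\<And>i. i \<in> F \<Longrightarrow> f i \<in> (B::'a::unital_cstar_algebra set)"
  shows "sum f F \<in> B"
  using assms(2) by (induction F rule: infinite_finite_induct) (auto intro: cstar_subalgebraD[OF assms(1)])

section \<open>The binomial series of (1 - t)^(1/2) and square roots\<close>

definition sqrt_coeff :: "nat \<Rightarrow> real"
  where "sqrt_coeff n = (-1) ^ n * ((1/2) gchoose n)"

lemma sqrt_coeff_nonpos: "n \<ge> 1 \<Longrightarrow> sqrt_coeff n \<le> 0"
proof -
  assume "n \<ge> 1"
  then obtain k where n: "n = Suc k" by (cases n) auto
  have "sqrt_coeff n = pochhammer (-1/2) n / fact n"
    by (simp add: sqrt_coeff_def gbinomial_pochhammer flip: power_mult_distrib)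
  also have "\<dots> = - (1/2) * pochhammer (1/2) k / fact n" by (simp add: n pochhammer_rec)
  also have "\<dots> \<le> 0" using pochhammer_nonneg[of "1/2::real" k] by (simp add: divide_nonpos_pos)
  finally show ?thesis .
qed

text \<open>Partial sums are the coefficients of (1 - t)^(1/2) / (1 - t) = (1 - t)^(-1/2), which are
  nonnegative.\<close>

lemma sum_sqrt_coeff_nonneg: "(\<Sum>k\<le>n. sqrt_coeff k) \<ge> 0"
proof -
  have "(\<Sum>k\<le>n. sqrt_coeff k) = (-1) ^ n * ((-1/2) gchoose n)"
    using gbinomial_sum_lower_neg[of "1/2::real" n] by (simp add: sqrt_coeff_def mult.commute)
  also have "\<dots> = pochhammer (1/2) n / fact n"
    by (simp add: gbinomial_pochhammer flip: power_mult_distrib)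
  also have "\<dots> \<ge> 0" using pochhammer_nonneg[of "1/2::real" n] by simp
  finally show ?thesis .
qed

lemma sqrt_coeff_0 [simp]: "sqrt_coeff 0 = 1"
  by (simp add: sqrt_coeff_def)

text \<open>All coefficients after the leading 1 are nonpositive and the partial sums stay
  nonnegative, so the tail can use up at most that 1. This gives absolute convergence on the
  boundary of the unit disc.\<close>

lemma sum_abs_sqrt_coeff_le: "(\<Sum>k<n. \<bar>sqrt_coeff (Suc k)\<bar>) \<le> 1"
proof -
  have "(\<Sum>k<n. \<bar>sqrt_coeff (Suc k)\<bar>) = - (\<Sum>k<n. sqrt_coeff (Suc k))"
    using sqrt_coeff_nonpos by (simp add: sum_negf[symmetric])
  also have "(\<Sum>k<n. sqrt_coeff (Suc k)) = (\<Sum>k\<le>n. sqrt_coeff k) - 1"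
    by (simp add: sum.atMost_shift)
  finally show ?thesis using sum_sqrt_coeff_nonneg[of n] by simp
qed

text \<open>The Cauchy square of the series is 1 - t; on coefficients this is Vandermonde's identity
  for 1/2 + 1/2 = 1.\<close>

lemma sqrt_coeff_convolution:
  "(\<Sum>i\<le>n. sqrt_coeff i * sqrt_coeff (n - i)) = (if n = 0 then 1 else if n = 1 then -1 else 0)"
proof -
  have "(\<Sum>i\<le>n. sqrt_coeff i * sqrt_coeff (n - i)) =
      (\<Sum>i\<le>n. (-1) ^ n * (((1/2) gchoose i) * ((1/2) gchoose (n - i))))"
  proof (rule sum.cong)
    fix i assume "i \<in> {..n}"
    then have "(-1::real) ^ i * (-1) ^ (n - i) = (-1) ^ n" by (simp flip: power_add)
    then show "sqrt_coeff i * sqrt_coeff (n - i) =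
        (-1) ^ n * (((1/2) gchoose i) * ((1/2) gchoose (n - i)))"
      by (simp add: sqrt_coeff_def algebra_simps)
  qed simp
  also have "\<dots> = (-1) ^ n * ((1::real) gchoose n)"
    using gbinomial_Vandermonde[of "1/2::real" "1/2" n]
    by (simp add: sum_distrib_left[symmetric] atMost_atLeast0)
  also have "(1::real) gchoose n = of_nat (1 choose n)"
    using binomial_gbinomial[of 1 n, where 'a=real] by simp
  also have "(-1) ^ n * of_nat (1 choose n) = (if n = 0 then 1 else if n = 1 then -1 else (0::real))"
    by auto
  finally show ?thesis .
qed

text \<open>The case \<open>norm m = 1\<close> is needed, so convergence rests on the summable
  coefficients and not on decay of \<open>m ^ n\<close>. As a limit of polynomials in
  \<open>m\<close>, the root commutes with whatever commutes with \<open>m\<close> and stays in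
  every unital C*-subalgebra containing \<open>m\<close>. The bound on \<open>1 - q\<close> later
  makes \<open>q\<close> itself positive.\<close>

lemma sqrt_series:
  fixes m :: "'a::unital_cstar_algebra"
  assumes sa: "star m = m" and m: "norm m \<le> 1"
  obtains q where "star q = q" "q * q = 1 - m" "norm (1 - q) \<le> 1"
    "\<And>y. y * m = m * y \<Longrightarrow> y * q = q * y"
    "\<And>B. cstar_subalgebra B \<Longrightarrow> 1 \<in> B \<Longrightarrow> m \<in> B \<Longrightarrow> q \<in> B"
proof -
  define t where "t n = sqrt_coeff n *\<^sub>R m ^ n" for n
  have nt: "norm (t n) \<le> \<bar>sqrt_coeff n\<bar>" for n
  proof -
    have "norm (m ^ n) \<le> 1"
      by (rule order_trans[OF norm_power_ineq power_le_one]) (use m in auto)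
    then show ?thesis by (simp add: t_def mult_left_le)
  qed
  have "summable (\<lambda>n. \<bar>sqrt_coeff (Suc n)\<bar>)"
    by (rule bounded_imp_summable[where B=1]) (use sum_abs_sqrt_coeff_le[of "Suc _"] in \<open>auto simp: lessThan_Suc_atMost\<close>)
  then have c: "summable (\<lambda>n. \<bar>sqrt_coeff n\<bar>)" using summable_Suc_iff[of "\<lambda>n. \<bar>sqrt_coeff n\<bar>"] by simp
  have nts: "summable (\<lambda>n. norm (t n))"
    by (rule summable_comparison_test'[OF c, of 0]) (simp add: nt)
  then have ts: "summable t" by (rule summable_norm_cancel)
  define q where "q = suminf t"
  have tq: "(\<lambda>n. \<Sum>i<n. t i) \<longlonglongrightarrow> q"
    unfolding q_def by (rule summable_LIMSEQ[OF ts])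
  have "star (\<Sum>i<n. t i) = (\<Sum>i<n. t i)" for n
    by (induction n) (simp_all add: star_add t_def star_power sa)
  then have "star q = q"
    using tendsto_star[OF tq] tq by (simp add: LIMSEQ_unique)
  moreover have "q * q = 1 - m"
  proof -
    have "(\<lambda>k. \<Sum>i\<le>k. t i * t (k - i)) sums (q * q)"
      unfolding q_def by (rule Cauchy_product_sums[OF nts nts])
    moreover have "(\<Sum>i\<le>k. t i * t (k - i)) = (if k = 0 then 1 else if k = 1 then - m else 0)" for k
    proof -
      have "(\<Sum>i\<le>k. t i * t (k - i)) = (\<Sum>i\<le>k. (sqrt_coeff i * sqrt_coeff (k - i)) *\<^sub>R m ^ k)"
        by (rule sum.cong) (auto simp: t_def power_add[symmetric])
      also have "\<dots> = (\<Sum>i\<le>k. sqrt_coeff i * sqrt_coeff (k - i)) *\<^sub>R m ^ k"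
        by (simp add: scaleR_left.sum)
      finally show ?thesis by (simp add: sqrt_coeff_convolution)
    qed
    moreover have "(\<lambda>k. if k = 0 then 1 else if k = 1 then - m else (0::'a)) sums
        (\<Sum>k\<in>{0,1::nat}. if k = 0 then 1 else if k = 1 then - m else 0)"
      by (rule sums_finite) auto
    ultimately show ?thesis using sums_unique2 by fastforce
  qed
  moreover have "norm (1 - q) \<le> 1"
  proof (rule LIMSEQ_le_const2)
    show "(\<lambda>n. norm (1 - (\<Sum>i<Suc n. t i))) \<longlonglongrightarrow> norm (1 - q)"
      by (intro tendsto_intros LIMSEQ_Suc[OF tq])
    have "norm (1 - (\<Sum>i<Suc n. t i)) \<le> 1" for n
    proof -
      have "(\<Sum>i<Suc n. t i) = 1 + (\<Sum>i<n. t (Suc i))"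
        by (subst sum.lessThan_Suc_shift) (simp add: t_def)
      then have "norm (1 - (\<Sum>i<Suc n. t i)) = norm (\<Sum>i<n. t (Suc i))" by simp
      also have "\<dots> \<le> (\<Sum>i<n. \<bar>sqrt_coeff (Suc i)\<bar>)"
        by (rule sum_norm_le) (rule nt)
      finally show ?thesis using sum_abs_sqrt_coeff_le[of n] by simp
    qed
    then show "\<exists>N. \<forall>n\<ge>N. norm (1 - (\<Sum>i<Suc n. t i)) \<le> 1" by blast
  qed
  moreover have "y * q = q * y" if y: "y * m = m * y" for y
  proof -
    have "y * m ^ n = m ^ n * y" for n
      by (induction n) (simp_all add: y mult.assoc[symmetric], simp add: mult.assoc)
    then have "y * (\<Sum>i<n. t i) = (\<Sum>i<n. t i) * y" for n
      by (simp add: sum_distrib_left sum_distrib_right t_def)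
    moreover have "(\<lambda>n. y * (\<Sum>i<n. t i)) \<longlonglongrightarrow> y * q" "(\<lambda>n. (\<Sum>i<n. t i) * y) \<longlonglongrightarrow> q * y"
      by (intro tendsto_intros tq)+
    ultimately show ?thesis using LIMSEQ_unique by auto
  qed
  moreover have "q \<in> B" if B: "cstar_subalgebra B" "1 \<in> B" "m \<in> B" for B
  proof -
    have "(\<Sum>i<n. t i) \<in> B" for n
      unfolding t_def
      by (intro cstar_subalgebra_sum cstar_subalgebra_scaleR cstar_subalgebra_power B)
    then show ?thesis
      using closed_sequentially[OF cstar_subalgebraD(6)[OF B(1)] _ tq] by blast
  qed
  ultimately show ?thesis by (rule that)
qed

text \<open>The reason is that \<open>b + \<i> q\<close> is unitary.\<close>

lemma norm_le_one_of_sum_squares: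
  fixes b q :: "'a::unital_cstar_algebra"
  assumes b: "star b = b" and q: "star q = q" and bq: "b * q = q * b" and one: "b * b + q * q = 1"
  shows "norm b \<le> 1"
proof -
  define v where "v = b + \<i> *\<^sub>C q"
  have sv: "star v = b - \<i> *\<^sub>C q"
    by (simp add: v_def star_add star_scaleC b q scaleC_minus_left)
  have "star v * v = b * b + q * q"
    unfolding sv by (simp add: v_def algebra_simps mult_scaleC_left mult_scaleC_right scaleC_scaleC
      bq scaleC_minus_left scaleC_diff_right scaleC_add_right)
  then have "norm v = 1" using cstar_identity[of v] one power2_eq_iff_nonneg[of "norm v" 1] by simp
  moreover have "v + star v = 2 *\<^sub>R b" unfolding sv unfolding v_def by (simp add: scaleR_2)
  then have "2 * norm b \<le> norm v + norm (star v)"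
    by (metis norm_triangle_ineq norm_scaleR abs_numeral)
  ultimately show ?thesis by simp
qed

text \<open>
  This norm criterion is the positivity of \<open>a\<close>; it makes sums of positive elements
  positive without any spectral theory.
\<close>

definition norm_positive :: "'a::unital_cstar_algebra \<Rightarrow> bool"
  where "norm_positive a \<longleftrightarrow> star a = a \<and> (\<exists>t\<ge>0. norm (t *\<^sub>R 1 - a) \<le> t)"

lemma norm_positive_sa: "norm_positive a \<Longrightarrow> star a = a"
  by (simp add: norm_positive_def)

text \<open>For t > 0 the criterion says \<open>a = t *\<^sub>R (1 - m)\<close> with
  \<open>norm m \<le> 1\<close>, so the series applies; \<open>t = 0\<close> forces
  \<open>a = 0\<close>.\<close>

lemma norm_positive_sqrt:
  fixes a :: "'a::unital_cstar_algebra"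
  assumes "norm_positive a"
  obtains s where "star s = s" "s * s = a" "norm_positive s"
    "\<And>y. y * a = a * y \<Longrightarrow> y * s = s * y"
    "\<And>B. cstar_subalgebra B \<Longrightarrow> 1 \<in> B \<Longrightarrow> a \<in> B \<Longrightarrow> s \<in> B"
proof -
  from assms obtain t where sa: "star a = a" and t: "t \<ge> 0" "norm (t *\<^sub>R 1 - a) \<le> t"
    unfolding norm_positive_def by blast
  show ?thesis
  proof (cases "t = 0")
    case True
    with t have a: "a = 0" by simp
    show ?thesis
      by (rule that[of 0]) (auto simp: a norm_positive_def intro: exI[of _ 0])
  next
    case False
    with t have tp: "t > 0" by simp
    define m where "m = 1 - (1 / t) *\<^sub>R a"
    have sm: "star m = m" by (simp add: m_def sa)
    have "t *\<^sub>R m = t *\<^sub>R 1 - a" using tp by (simp add: m_def algebra_simps)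
    then have "t * norm m \<le> t" using t by (metis norm_scaleR abs_of_nonneg)
    then have nm: "norm m \<le> 1" using tp by simp
    from sqrt_series[OF sm nm] obtain q where q: "star q = q" "q * q = 1 - m" "norm (1 - q) \<le> 1"
      "\<And>y. y * m = m * y \<Longrightarrow> y * q = q * y"
      "\<And>B. cstar_subalgebra B \<Longrightarrow> 1 \<in> B \<Longrightarrow> m \<in> B \<Longrightarrow> q \<in> B" by blast
    show ?thesis
    proof (rule that[of "sqrt t *\<^sub>R q"])
      show "(sqrt t *\<^sub>R q) * (sqrt t *\<^sub>R q) = a" using tp by (simp add: q m_def)
      have "sqrt t *\<^sub>R 1 - sqrt t *\<^sub>R q = sqrt t *\<^sub>R (1 - q)" by (simp add: algebra_simps)
      then have "norm (sqrt t *\<^sub>R 1 - sqrt t *\<^sub>R q) \<le> sqrt t" using q(3) tp by (simp add: mult_left_le)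
      then show "norm_positive (sqrt t *\<^sub>R q)"
        unfolding norm_positive_def using q(1) tp by (auto intro!: exI[of _ "sqrt t"])
      show "y * (sqrt t *\<^sub>R q) = sqrt t *\<^sub>R q * y" if "y * a = a * y" for y
        using that q(4)[of y] by (simp add: m_def algebra_simps)
      show "sqrt t *\<^sub>R q \<in> B" if "cstar_subalgebra B" "1 \<in> B" "a \<in> B" for B
        by (intro cstar_subalgebra_scaleR q(5) that)
          (simp add: m_def cstar_subalgebra_diff cstar_subalgebra_scaleR that)
    qed (simp add: q)
  qed
qed

text \<open>After rescaling to a contraction \<open>c\<close>, the series yields a root
  \<open>q\<close> of \<open>1 - c * c\<close>. Since the squares of \<open>q\<close> and
  \<open>c\<close> add up to 1, \<open>q\<close> is a contraction too, and so is
  \<open>1 - c * c = q * q\<close>.\<close>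

lemma norm_positive_square:
  fixes b :: "'a::unital_cstar_algebra"
  assumes b: "star b = b"
  shows "norm_positive (b * b)"
proof -
  \<comment> \<open>The summand 1 keeps \<open>t\<close> positive when \<open>b = 0\<close>.\<close>
  define t where "t = (norm b)\<^sup>2 + 1"
  have tp: "t > 0" by (simp add: t_def add_nonneg_pos)
  define c where "c = (1 / sqrt t) *\<^sub>R b"
  have c: "star c = c" by (simp add: c_def b)
  have bc: "b * b = t *\<^sub>R (c * c)" using tp by (simp add: c_def)
  have "norm b \<le> sqrt t" by (rule real_le_rsqrt) (simp add: t_def)
  then have "norm c \<le> 1" using tp by (simp add: c_def divide_le_eq)
  then have "norm (c * c) \<le> 1" by (simp add: norm_square_sa c power_le_one)
  then obtain q where q: "star q = q" "q * q = 1 - c * c"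
      "\<And>y. y * (c * c) = (c * c) * y \<Longrightarrow> y * q = q * y"
    using sqrt_series[of "c * c"] by (metis c star_mult)
  have "norm q \<le> 1"
    by (rule norm_le_one_of_sum_squares[of q c]) (use q c q(3)[of c] in \<open>auto simp: mult.assoc\<close>)
  then have "norm (1 - c * c) \<le> 1" by (simp add: norm_square_sa q(1) power_le_one flip: q(2))
  moreover have "t *\<^sub>R 1 - b * b = t *\<^sub>R (1 - c * c)" by (simp add: bc algebra_simps)
  ultimately have "norm (t *\<^sub>R 1 - b * b) \<le> t" using tp by (simp add: mult_left_le)
  then show ?thesis unfolding norm_positive_def using tp
    by (auto simp: star_mult b intro!: exI[of _ t])
qed

lemma norm_positive_add:
  fixes a b :: "'a::unital_cstar_algebra"
  assumes "norm_positive a" "norm_positive b"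
  shows "norm_positive (a + b)"
proof -
  from assms obtain s t where st: "s \<ge> 0" "norm (s *\<^sub>R 1 - a) \<le> s" "t \<ge> 0" "norm (t *\<^sub>R 1 - b) \<le> t"
    unfolding norm_positive_def by blast
  have "(s + t) *\<^sub>R 1 - (a + b) = (s *\<^sub>R 1 - a) + (t *\<^sub>R 1 - b)" by (simp add: algebra_simps)
  then have "norm ((s + t) *\<^sub>R 1 - (a + b)) \<le> s + t"
    using st by (metis norm_triangle_le add_mono)
  then show ?thesis using st assms unfolding norm_positive_def
    by (auto simp: star_add intro!: exI[of _ "s + t"])
qed

lemma norm_positive_scaleR:
  fixes a :: "'a::unital_cstar_algebra"
  assumes "norm_positive a" "r \<ge> 0"
  shows "norm_positive (r *\<^sub>R a)"
proof -
  from assms obtain s where s: "s \<ge> 0" "norm (s *\<^sub>R 1 - a) \<le> s" "star a = a"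
    unfolding norm_positive_def by blast
  have "(r * s) *\<^sub>R 1 - r *\<^sub>R a = r *\<^sub>R (s *\<^sub>R 1 - a)" by (simp add: algebra_simps)
  then have "norm ((r * s) *\<^sub>R 1 - r *\<^sub>R a) \<le> r * s" using s assms by (simp add: mult_left_mono)
  then show ?thesis using s assms unfolding norm_positive_def by (auto intro!: exI[of _ "r * s"])
qed

lemma norm_positive_of_norm_diff:
  "star a = (a::'a::unital_cstar_algebra) \<Longrightarrow> norm (t *\<^sub>R 1 - a) \<le> t \<Longrightarrow> norm_positive a"
  unfolding norm_positive_def using norm_ge_zero[of "t *\<^sub>R 1 - a"]
  by (intro conjI exI[of _ t]) linarith+

lemma norm_positive_norm_minus:
  "star a = (a::'a::unital_cstar_algebra) \<Longrightarrow> norm_positive (norm a *\<^sub>R 1 - a)"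
  by (rule norm_positive_of_norm_diff[of _ "norm a"]) auto

lemma norm_positive_of_real [simp]: "r \<ge> 0 \<Longrightarrow> norm_positive (r *\<^sub>R (1::'a::unital_cstar_algebra))"
  by (rule norm_positive_of_norm_diff[of _ r]) auto

text \<open>The roots of \<open>p / t\<close> and of \<open>1 - p / t\<close> commute and their
  squares add up to 1, so the first one is a contraction.\<close>

lemma norm_le_of_bounded:
  fixes p :: "'a::unital_cstar_algebra"
  assumes p: "norm_positive p" and tp: "norm_positive (t *\<^sub>R 1 - p)" and t: "t > 0"
  shows "norm p \<le> t"
proof -
  define p1 where "p1 = (1 / t) *\<^sub>R p"
  have p1: "norm_positive p1" unfolding p1_def using p t by (intro norm_positive_scaleR) auto
  have "1 - p1 = (1 / t) *\<^sub>R (t *\<^sub>R 1 - p)" using t by (simp add: p1_def algebra_simps)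
  then have p2: "norm_positive (1 - p1)" using tp t by (simp add: norm_positive_scaleR)
  obtain r where r: "star r = r" "r * r = p1"
    by (rule norm_positive_sqrt[OF p1])
  obtain q where q: "star q = q" "q * q = 1 - p1" and comm: "\<And>y. y * (1 - p1) = (1 - p1) * y \<Longrightarrow> y * q = q * y"
    by (rule norm_positive_sqrt[OF p2]) (rule that; assumption)
  have "r * p1 = p1 * r" by (simp add: mult.assoc flip: r(2))
  then have "r * q = q * r" by (intro comm) (simp add: algebra_simps)
  then have "norm r \<le> 1" using r q by (intro norm_le_one_of_sum_squares[of r q]) auto
  then have "norm p1 \<le> 1" by (simp add: norm_square_sa r(1) power_le_one flip: r(2))
  then show ?thesis using t by (simp add: p1_def divide_le_eq)
qed

lemma norm_mono_positive:
  fixes p q :: "'a::unital_cstar_algebra"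
  assumes p: "norm_positive p" and qp: "norm_positive (q - p)"
  shows "norm p \<le> norm q"
proof -
  have q: "star q = q"
    using norm_positive_sa[OF norm_positive_add[OF p qp]] by simp
  have "norm_positive ((norm q *\<^sub>R 1 - q) + (q - p))"
    by (intro norm_positive_add norm_positive_norm_minus q qp)
  then have n: "norm_positive (norm q *\<^sub>R 1 - p)" by simp
  \<comment> \<open>The slack \<open>e\<close> supplies the strictly positive bound that is required
    even when \<open>norm q = 0\<close>.\<close>
  have "norm p \<le> norm q + e" if "e > 0" for e
  proof (rule norm_le_of_bounded[OF p])
    have "norm_positive ((norm q *\<^sub>R 1 - p) + e *\<^sub>R 1)"
      using that by (intro norm_positive_add n) auto
    then show "norm_positive ((norm q + e) *\<^sub>R 1 - p)" by (simp add: algebra_simps)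
  qed (use that in \<open>simp add: add_nonneg_pos\<close>)
  then show ?thesis by (rule field_le_epsilon)
qed

section \<open>Inverses, and the norm criterion from the spectrum\<close>

lemma neumann_inverse:
  fixes m :: "'a::unital_cstar_algebra"
  assumes m: "norm m < 1"
  obtains c where "c * (1 - m) = 1" "(1 - m) * c = 1"
    "\<And>B. cstar_subalgebra B \<Longrightarrow> 1 \<in> B \<Longrightarrow> m \<in> B \<Longrightarrow> c \<in> B"
proof -
  have "summable (\<lambda>n. norm (m ^ n))"
    by (rule summable_comparison_test'[OF summable_geometric[of "norm m"], of 0])
      (use m in \<open>auto simp: norm_power_ineq\<close>)
  then have s: "summable (\<lambda>n. m ^ n)" by (rule summable_norm_cancel)
  define c where "c = (\<Sum>n. m ^ n)"
  have lim: "(\<lambda>n. \<Sum>i<n. m ^ i) \<longlonglongrightarrow> c"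
    unfolding c_def by (rule summable_LIMSEQ[OF s])
  have z: "(\<lambda>n. 1 - m ^ n) \<longlonglongrightarrow> 1 - 0"
    by (intro tendsto_intros summable_LIMSEQ_zero s)
  have l: "(\<Sum>i<n. m ^ i) * (1 - m) = 1 - m ^ n" for n
    using sum_lessThan_telescope'[of "\<lambda>i. m ^ i" n]
    by (subst sum_distrib_right) (simp add: right_diff_distrib power_Suc2 del: power_Suc)
  have r: "(1 - m) * (\<Sum>i<n. m ^ i) = 1 - m ^ n" for n
    using sum_lessThan_telescope'[of "\<lambda>i. m ^ i" n]
    by (subst sum_distrib_left) (simp add: left_diff_distrib)
  have "c * (1 - m) = 1"
    using LIMSEQ_unique[OF tendsto_mult[OF lim tendsto_const[of "1 - m"]]] z by (simp add: l)
  moreover have "(1 - m) * c = 1"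
    using LIMSEQ_unique[OF tendsto_mult[OF tendsto_const[of "1 - m"] lim]] z by (simp add: r)
  moreover have "c \<in> B" if B: "cstar_subalgebra B" "1 \<in> B" "m \<in> B" for B
  proof -
    have "(\<Sum>i<n. m ^ i) \<in> B" for n
      by (intro cstar_subalgebra_sum cstar_subalgebra_power B)
    then show ?thesis using closed_sequentially[OF cstar_subalgebraD(6)[OF B(1)] _ lim] by blast
  qed
  ultimately show ?thesis by (rule that)
qed

text \<open>\<open>a + e\<close> is \<open>t + e\<close> times \<open>1 - m\<close>, where
  \<open>norm m\<close> is at most \<open>t / (t + e)\<close>, which is below 1.\<close>

lemma norm_positive_shift_inverse:
  fixes a :: "'a::unital_cstar_algebra"
  assumes a: "norm_positive a" and e: "e > 0"
  obtains c where "c * (a + e *\<^sub>R 1) = 1" "(a + e *\<^sub>R 1) * c = 1" "star c = c"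
    "\<And>y. y * a = a * y \<Longrightarrow> y * c = c * y"
    "\<And>B. cstar_subalgebra B \<Longrightarrow> 1 \<in> B \<Longrightarrow> a \<in> B \<Longrightarrow> c \<in> B"
proof -
  from a obtain t where sa: "star a = a" and t: "t \<ge> 0" "norm (t *\<^sub>R 1 - a) \<le> t"
    unfolding norm_positive_def by blast
  define d where "d = a + e *\<^sub>R 1"
  define m where "m = (1 / (t + e)) *\<^sub>R (t *\<^sub>R 1 - a)"
  have te: "t + e > 0" using t e by simp
  have "norm m \<le> t / (t + e)" using t te by (simp add: m_def divide_right_mono)
  also have "\<dots> < 1" using te e by simp
  finally have nm: "norm m < 1" .
  have "(t + e) *\<^sub>R m = t *\<^sub>R 1 - a" using te by (simp add: m_def)
  then have d: "d = (t + e) *\<^sub>R (1 - m)" by (simp add: d_def algebra_simps)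
  obtain c0 where c0: "c0 * (1 - m) = 1" "(1 - m) * c0 = 1"
    and c0B: "\<And>B. cstar_subalgebra B \<Longrightarrow> 1 \<in> B \<Longrightarrow> m \<in> B \<Longrightarrow> c0 \<in> B"
    by (rule neumann_inverse[OF nm]) (rule that; assumption)
  define c where "c = (1 / (t + e)) *\<^sub>R c0"
  have cd: "c * d = 1" and dc: "d * c = 1" using te by (simp_all add: c_def d c0)
  have comm: "y * c = c * y" if "y * a = a * y" for y
  proof -
    have yd: "y * d = d * y" using that by (simp add: d_def algebra_simps)
    have "y * c = c * (d * y) * c" by (simp add: cd flip: mult.assoc)
    also have "\<dots> = c * y * (d * c)" by (simp add: mult.assoc flip: yd)
    finally show ?thesis by (simp add: dc)
  qed
  have sd: "star d = d" by (simp add: d_def star_add sa)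
  have "star c * d = 1" using dc sd star_mult[of d c] by simp
  then have "star c = c" using dc by (metis mult.assoc mult.left_neutral mult.right_neutral)
  moreover have "c \<in> B" if "cstar_subalgebra B" "1 \<in> B" "a \<in> B" for B
    unfolding c_def by (intro cstar_subalgebra_scaleR c0B that)
      (simp add: m_def cstar_subalgebra_scaleR cstar_subalgebra_diff that)
  ultimately show ?thesis using that[of c] cd dc comm by (simp add: d_def)
qed

lemma commute_mult:
  fixes x y z :: "'a::semigroup_mult"
  assumes "x * y = y * x" "x * z = z * x"
  shows "x * (y * z) = (y * z) * x"
  by (metis assms mult.assoc)

lemma square_mult_commute:
  fixes x y :: "'a::semigroup_mult"
  assumes "x * y = y * x"
  shows "(x * y) * (x * y) = (x * x) * (y * y)"
  by (metis assms mult.assoc)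

lemma commute_power:
  fixes x y :: "'a::monoid_mult"
  assumes "x * y = y * x"
  shows "x * y ^ n = y ^ n * x"
  by (induction n) (simp_all add: mult.assoc, metis assms mult.assoc)

text \<open>For 0 \<le> c \<le> 1 one has n c^n (1 - c) \<le> 1 - c^n, because 1 - c^n is (1 - c)
  times a sum of n powers that are each at least c^n. In the induction the difference of both sides
  grows by (n + 1) c^n (1 - c)^2.\<close>

lemma norm_positive_power_decay:
  fixes c :: "'a::unital_cstar_algebra"
  assumes c: "norm_positive c" and c1: "norm_positive (1 - c)"
  shows "real n * norm (c ^ n * (1 - c)) \<le> 1"
proof -
  obtain r where r: "star r = r" "r * r = c"
    by (rule norm_positive_sqrt[OF c])
  obtain q where q: "star q = q" "q * q = 1 - c" and qc: "\<And>y. y * (1 - c) = (1 - c) * y \<Longrightarrow> y * q = q * y"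
    by (rule norm_positive_sqrt[OF c1]) (rule that; assumption)
  have rc: "r * c = c * r" by (simp add: mult.assoc flip: r(2))
  have rq: "r * q = q * r" by (rule qc) (simp add: algebra_simps rc)
  have rn: "r ^ n * r ^ n = c ^ n" for n
  proof (induction n)
    case (Suc n)
    have "r ^ Suc n * r ^ Suc n = (r * r) * (r ^ n * r ^ n)"
      using square_mult_commute[of r "r ^ n"] by (simp add: power_commutes)
    then show ?case by (simp add: Suc r)
  qed simp
  have cn: "norm_positive (c ^ n)" for n
    using norm_positive_square[of "r ^ n"] by (simp add: star_power r(1) rn)
  have sq: "norm_positive (c ^ n * (y * y))" if "star y = y" "r * y = y * r" for n y
  proof -
    have ry: "y * r ^ n = r ^ n * y" using that(2) by (simp add: commute_power)
    have "norm_positive ((r ^ n * y) * (r ^ n * y))"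
      by (rule norm_positive_square) (simp add: star_mult star_power r(1) that(1) ry)
    moreover have "(r ^ n * y) * (r ^ n * y) = c ^ n * (y * y)"
      by (simp add: square_mult_commute[OF ry[symmetric]] rn)
    ultimately show ?thesis by simp
  qed
  have X: "norm_positive (c ^ n * (1 - c))" for n
    using sq[of q n] q rq by simp
  have sc: "star c = c" by (rule norm_positive_sa[OF c])
  have D: "norm_positive (c ^ n * ((1 - c) * (1 - c)))" for n
    by (rule sq) (simp_all add: sc algebra_simps rc)
  have "norm_positive (1 - c ^ n - real n *\<^sub>R (c ^ n * (1 - c)))" for n
  proof (induction n)
    case (Suc n)
    have "1 - c ^ Suc n - real (Suc n) *\<^sub>R (c ^ Suc n * (1 - c)) =
        (1 - c ^ n - real n *\<^sub>R (c ^ n * (1 - c))) + real (Suc n) *\<^sub>R (c ^ n * ((1 - c) * (1 - c)))"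
      by (simp add: algebra_simps power_Suc2 del: power_Suc)
    then show ?case using norm_positive_add[OF Suc norm_positive_scaleR[OF D[of n], of "real (Suc n)"]]
      by (simp only: of_nat_0_le_iff)
  qed (simp add: norm_positive_of_norm_diff[of 0 0])
  from norm_positive_add[OF this[of n] cn[of n]]
  have "norm_positive (1 *\<^sub>R 1 - real n *\<^sub>R (c ^ n * (1 - c)))" by simp
  from norm_le_of_bounded[OF _ this] X[of n]
  have "norm (real n *\<^sub>R (c ^ n * (1 - c))) \<le> 1" by (simp add: norm_positive_scaleR)
  then show ?thesis by simp
qed

text \<open>This replaces the spectral radius formula. Normalise \<open>b * b\<close> to
  \<open>c\<close> of norm 1: all powers \<open>c ^ n\<close> have norm 1, but
  \<open>c ^ n * (1 - c)\<close> decays like 1/n, so an inverse of \<open>1 - c\<close> would have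
  norm at least every \<open>n\<close>.\<close>

lemma norm_square_diff_not_invertible:
  fixes b y :: "'a::unital_cstar_algebra"
  assumes b: "star b = b" and b0: "b \<noteq> 0"
  shows "((norm b)\<^sup>2 *\<^sub>R 1 - b * b) * y \<noteq> 1"
proof
  assume y: "((norm b)\<^sup>2 *\<^sub>R 1 - b * b) * y = 1"
  define N where "N = (norm b)\<^sup>2"
  have N: "N > 0" using b0 by (simp add: N_def)
  define c where "c = (1 / N) *\<^sub>R (b * b)"
  have c: "norm_positive c"
    unfolding c_def using N by (intro norm_positive_scaleR norm_positive_square b) auto
  have nc: "norm c = 1" using N by (simp add: c_def norm_square_sa b flip: N_def)
  have c1: "norm_positive (1 - c)"
    using norm_positive_norm_minus[OF norm_positive_sa[OF c]] nc by simp
  have Nc: "N *\<^sub>R 1 - b * b = N *\<^sub>R (1 - c)" using N by (simp add: c_def algebra_simps)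
  have cy: "(1 - c) * (N *\<^sub>R y) = 1" using y by (simp add: Nc flip: N_def)
  define M where "M = norm (N *\<^sub>R y)"
  have "real n \<le> M" for n
  proof -
    have "norm (c ^ n) = norm (c ^ n * (1 - c) * (N *\<^sub>R y))"
      by (simp only: mult.assoc cy) simp
    then have "1 \<le> norm (c ^ n * (1 - c)) * M"
      unfolding M_def using norm_mult_ineq[of "c ^ n * (1 - c)" "N *\<^sub>R y"]
      by (simp only: norm_power_sa[OF norm_positive_sa[OF c]] nc) simp
    then have "real n * 1 \<le> real n * (norm (c ^ n * (1 - c)) * M)" by (rule mult_left_mono) simp
    also have "\<dots> = (real n * norm (c ^ n * (1 - c))) * M" by simp
    also have "\<dots> \<le> 1 * M"
      by (rule mult_right_mono[OF norm_positive_power_decay[OF c c1]]) (simp add: M_def)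
    finally show ?thesis by simp
  qed
  then show False using reals_Archimedean2[of M] by (meson not_less)
qed

lemma positive_imp_shift_invertible:
  fixes a :: "'a::unital_cstar_algebra"
  assumes "positive a" "e > 0"
  shows "\<exists>b. (a + e *\<^sub>R 1) * b = 1"
proof -
  have "complex_of_real (- e) \<notin> complex_of_real ` {0..}" using assms(2) by auto
  then have "complex_of_real (- e) \<notin> spectrum a" using assms(1) unfolding positive_def by blast
  then show ?thesis unfolding spectrum_def by (auto simp: scaleC_of_real simp flip: of_real_minus)
qed

text \<open>Let \<open>b = norm a - a\<close> and suppose \<open>norm b > norm a\<close>. Then
  \<open>norm b - b\<close> is a positive shift of \<open>a\<close>, invertible by the spectral
  assumption, and \<open>norm b + b\<close> is a positive shift of the element
  \<open>norm a - a\<close>, which meets the norm criterion. Their product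
  \<open>(norm b)\<^sup>2 - b * b\<close> would be invertible.\<close>

lemma norm_positive_if_positive:
  fixes a :: "'a::unital_cstar_algebra"
  assumes a: "positive a"
  shows "norm_positive a"
proof -
  have sa: "star a = a" using a by (simp add: positive_def)
  define t where "t = norm a"
  define b where "b = t *\<^sub>R 1 - a"
  have sb: "star b = b" by (simp add: b_def sa)
  have "norm b \<le> t"
  proof (rule ccontr)
    assume "\<not> norm b \<le> t"
    then have N: "norm b - t > 0" and "b \<noteq> 0" by (auto simp: t_def)
    from positive_imp_shift_invertible[OF a N] obtain y where
      y: "(a + (norm b - t) *\<^sub>R 1) * y = 1" by blast
    have e1: "norm b *\<^sub>R 1 - b = a + (norm b - t) *\<^sub>R 1" by (simp add: b_def algebra_simps)
    have "norm_positive (t *\<^sub>R 1 - a)" unfolding t_def by (rule norm_positive_norm_minus[OF sa])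
    from norm_positive_shift_inverse[OF this, of "norm b"] obtain z where
      z: "(t *\<^sub>R 1 - a + norm b *\<^sub>R 1) * z = 1" using \<open>b \<noteq> 0\<close> by (metis zero_less_norm_iff)
    have e2: "norm b *\<^sub>R 1 + b = t *\<^sub>R 1 - a + norm b *\<^sub>R 1" by (simp add: b_def)
    have "(norm b)\<^sup>2 *\<^sub>R 1 - b * b = (norm b *\<^sub>R 1 - b) * (norm b *\<^sub>R 1 + b)"
      by (simp add: algebra_simps power2_eq_square)
    then have "((norm b)\<^sup>2 *\<^sub>R 1 - b * b) * (z * y) =
        (norm b *\<^sub>R 1 - b) * ((norm b *\<^sub>R 1 + b) * z) * y" by (simp add: mult.assoc)
    also have "\<dots> = 1" using y z by (simp add: e1 e2)
    finally show False using norm_square_diff_not_invertible[OF sb \<open>b \<noteq> 0\<close>] by blast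
  qed
  then show ?thesis using sa by (intro norm_positive_of_norm_diff[of _ t]) (simp_all add: b_def)
qed

text \<open>
  The intertwining relation \<open>(1 + w w*) w = w (1 - a)\<close> bounds \<open>w\<close> by \<open>(1 + b)\<^sup>-\<^sup>1 w\<close>
  for \<open>b = w w*\<close>, whereas \<open>b (1 + b)\<^sup>-\<^sup>2 \<le> 1/4\<close>.
\<close>

lemma norm_positive_opposite_squares_zero:
  fixes w :: "'a::unital_cstar_algebra"
  assumes a: "norm_positive (- (star w * w))" and b: "norm_positive (w * star w)"
  shows "w = 0"
proof (rule ccontr)
  assume w0: "w \<noteq> 0"
  \<comment> \<open>With unit norm, \<open>a1\<close> is positive of norm 1, so
    \<open>1 - a1\<close> is a contraction.\<close>
  define w1 where "w1 = (1 / norm w) *\<^sub>R w"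
  have n1: "norm w1 = 1" using w0 by (simp add: w1_def)
  define a1 where "a1 = - (star w1 * w1)"
  define b1 where "b1 = w1 * star w1"
  have na: "norm a1 = 1" by (simp add: a1_def cstar_identity n1)
  have "a1 = (1 / norm w)\<^sup>2 *\<^sub>R (- (star w * w))" by (simp add: a1_def w1_def power2_eq_square)
  then have a1: "norm_positive a1" using a norm_positive_scaleR zero_le_power2 by metis
  have "b1 = (1 / norm w)\<^sup>2 *\<^sub>R (w * star w)" by (simp add: b1_def w1_def power2_eq_square)
  then have b1: "norm_positive b1" using b norm_positive_scaleR zero_le_power2 by metis
  have sa1: "star a1 = a1" and sb1: "star b1 = b1" using a1 b1 by (auto intro: norm_positive_sa)
  obtain c where c: "c * (b1 + 1 *\<^sub>R 1) = 1" "(b1 + 1 *\<^sub>R 1) * c = 1" "star c = c"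
    and cc: "\<And>y. y * b1 = b1 * y \<Longrightarrow> y * c = c * y"
    by (rule norm_positive_shift_inverse[OF b1 zero_less_one]) (rule that; assumption)
  have c': "c * (b1 + 1) = 1" "(b1 + 1) * c = 1" using c by simp_all
  obtain r where r: "star r = r" "r * r = b1" and rr: "\<And>y. y * b1 = b1 * y \<Longrightarrow> y * r = r * y"
    by (rule norm_positive_sqrt[OF b1]) (rule that; assumption)
  have cb: "c * b1 = b1 * c" using cc[of b1] by simp
  have rc: "r * c = c * r" using rr[OF cb] by simp
  \<comment> \<open>\<open>p\<close> and \<open>q\<close> stand for 2 b^(1/2) / (1 + b) and (1 - b)
    / (1 + b), whose squares add up to 1; \<open>norm p \<le> 1\<close> is the bound by 1/4.\<close>
  define p where "p = 2 *\<^sub>R (r * c)"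
  define q where "q = (1 - b1) * c"
  have sp: "star p = p" by (simp add: p_def star_mult r c rc)
  have sq: "star q = q" using cb by (simp add: q_def star_mult sb1 c algebra_simps)
  have pq: "p * q = q * p"
  proof -
    have "r * b1 = b1 * r" by (simp add: mult.assoc flip: r(2))
    then have "r * (1 - b1) = (1 - b1) * r" by (simp add: algebra_simps)
    then have "q * r = r * q" unfolding q_def using rc by (rule commute_mult[symmetric])
    moreover have "c * (1 - b1) = (1 - b1) * c" by (simp add: algebra_simps cb)
    then have "q * c = c * q" unfolding q_def by (rule commute_mult[symmetric]) simp
    ultimately have "q * (r * c) = (r * c) * q" by (rule commute_mult)
    then show ?thesis by (simp add: p_def)
  qed
  have pp: "p * p = 4 *\<^sub>R (b1 * (c * c))"
    by (simp add: p_def square_mult_commute[OF rc] r)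
  have qq: "q * q = (1 - b1) * (1 - b1) * (c * c)"
  proof -
    have "c * (1 - b1) = (1 - b1) * c" by (simp add: algebra_simps cb)
    from square_mult_commute[OF this[symmetric]] show ?thesis by (simp add: q_def)
  qed
  have "(1 + 1 + 1 + 1) *\<^sub>R b1 = b1 + b1 + b1 + b1"
    by (simp only: scaleR_left_distrib scaleR_one)
  then have "4 *\<^sub>R b1 + (1 - b1) * (1 - b1) = (b1 + 1) * (b1 + 1)"
    by (simp add: algebra_simps)
  moreover have "p * p + q * q = (4 *\<^sub>R b1 + (1 - b1) * (1 - b1)) * (c * c)"
    unfolding pp qq by (simp only: distrib_right mult_scaleR_left)
  ultimately have "p * p + q * q = (b1 + 1) * ((b1 + 1) * c) * c" by (simp only: mult.assoc)
  then have "p * p + q * q = 1" by (simp add: c')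
  then have "norm p \<le> 1" using norm_le_one_of_sum_squares[OF sp sq pq] by simp
  then have "norm (p * p) \<le> 1" by (simp add: norm_square_sa sp power_le_one)
  then have quarter: "norm (b1 * (c * c)) \<le> 1 / 4" by (simp add: pp)
  have "w1 * (1 - a1) = (b1 + 1) * w1" by (simp add: a1_def b1_def algebra_simps)
  then have "c * (w1 * (1 - a1)) = w1" by (metis c'(1) mult.assoc mult_1)
  then have "norm w1 \<le> norm (c * w1) * norm (1 - a1)" by (metis mult.assoc norm_mult_ineq)
  moreover have "norm (1 - a1) \<le> 1"
  proof -
    have "norm_positive (1 *\<^sub>R 1 - a1)" using norm_positive_norm_minus[OF sa1] na by simp
    moreover have "norm_positive (1 *\<^sub>R 1 - (1 - a1))" using a1 by simp
    ultimately show ?thesis using norm_le_of_bounded[of "1 - a1" 1] by simp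
  qed
  ultimately have "1 \<le> norm (c * w1)" using n1 mult_left_le[of "norm (1 - a1)" "norm (c * w1)"] by simp
  moreover have "(norm (c * w1))\<^sup>2 = norm (b1 * (c * c))"
  proof -
    have "(norm (c * w1))\<^sup>2 = norm ((c * w1) * star (c * w1))" by (simp add: cstar_identity')
    also have "(c * w1) * star (c * w1) = c * b1 * c" by (simp add: star_mult c b1_def mult.assoc)
    finally show ?thesis by (simp add: cb mult.assoc)
  qed
  ultimately show False using quarter power_mono[of 1 "norm (c * w1)" 2] by simp
qed

text \<open>Let \<open>A\<close> be the absolute value of \<open>a\<close>, so that
  \<open>k = A - a\<close> is twice the negative part, and cut \<open>z\<close> down to
  \<open>w = z * k\<close>. Then \<open>star w * w = - (A * (k * k))\<close> is negative, while the
  sum of \<open>w * star w\<close> and \<open>star w * w\<close> is always positive, being half a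
  sum of two squares of self-adjoint elements. So \<open>w * star w\<close> is positive, and the
  preceding lemma gives \<open>w = 0\<close>, whence \<open>k = 0\<close>.\<close>

theorem norm_positive_star_mult_self:
  fixes z :: "'a::unital_cstar_algebra"
  shows "norm_positive (star z * z)"
proof -
  define a where "a = star z * z"
  have sa: "star a = a" by (simp add: a_def star_mult star_star)
  obtain A where A: "star A = A" "A * A = a * a" "norm_positive A"
    and Ac: "\<And>y. y * (a * a) = a * a * y \<Longrightarrow> y * A = A * y"
    by (rule norm_positive_sqrt[OF norm_positive_square[OF sa]]) (rule that; assumption)
  have aA: "a * A = A * a" by (rule Ac) (simp add: mult.assoc)
  obtain s where s: "star s = s" "s * s = A" and sc: "\<And>y. y * A = A * y \<Longrightarrow> y * s = s * y"
    by (rule norm_positive_sqrt[OF A(3)]) (rule that; assumption)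
  define k where "k = A - a"
  have sk: "star k = k" by (simp add: k_def A sa)
  have kA: "k * A = A * k" by (simp add: k_def algebra_simps aA)
  have ks: "k * s = s * k" by (rule sc[OF kA])
  have ka: "k * a = - (k * A)" by (simp add: k_def algebra_simps aA A(2))
  define w where "w = z * k"
  have "star w * w = k * a * k" by (simp add: w_def a_def star_mult sk mult.assoc)
  also have "\<dots> = - (A * (k * k))" by (simp add: ka kA mult.assoc)
  also have "A * (k * k) = (s * k) * (s * k)"
    by (simp only: square_mult_commute[OF ks[symmetric]] s(2))
  finally have ww: "- (star w * w) = (s * k) * (s * k)" by simp
  have n1: "norm_positive (- (star w * w))"
    unfolding ww by (rule norm_positive_square) (simp add: star_mult s sk ks)
  define p where "p = w + star w"
  define q where "q = \<i> *\<^sub>C (w - star w)"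
  have sp: "star p = p" by (simp add: p_def star_add star_star add.commute)
  have sq: "star q = q" by (simp add: q_def star_scaleC star_star scaleC_diff_right scaleC_minus_left)
  have "p * p + q * q = 2 *\<^sub>R (w * star w) + 2 *\<^sub>R (star w * w)"
    by (simp add: p_def q_def mult_scaleC_left mult_scaleC_right scaleC_scaleC scaleC_minus_left
      scaleC_diff_right algebra_simps scaleR_2)
  then have "2 *\<^sub>R (w * star w) = (p * p + q * q) + 2 *\<^sub>R (- (star w * w))" by simp
  also have "norm_positive \<dots>"
    by (intro norm_positive_add norm_positive_square norm_positive_scaleR n1 sp sq) simp
  finally have n2: "norm_positive (w * star w)"
    using norm_positive_scaleR[of "2 *\<^sub>R (w * star w)" "1 / 2"] by simp
  have "w = 0" by (rule norm_positive_opposite_squares_zero[OF n1 n2])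
  then have "(s * k) * (s * k) = 0" using ww by simp
  then have "s * k = 0" using norm_square_sa[of "s * k"] by (simp add: star_mult s sk ks)
  then have Ak: "A * k = 0" by (metis s(2) mult.assoc mult_zero_right)
  then have "k * a = 0" using ka kA by simp
  then have "k * k = 0" using Ak kA by (simp add: k_def algebra_simps)
  then have "k = 0" using norm_square_sa[OF sk] by simp
  then show ?thesis using A(3) by (simp add: k_def a_def)
qed

text \<open>The approximants are \<open>v = \<psi> (b + \<eta>)\<^sup>-\<^sup>1\<^sup>/\<^sup>2\<close> with \<open>\<eta> \<rightarrow> 0\<close>.\<close>

lemma cuntz_subeq_if_dominated:
  fixes b \<psi> :: "'a::unital_cstar_algebra"
  assumes B: "cstar_subalgebra B" "1 \<in> B" "b \<in> B" "\<psi> \<in> B"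
    and b: "norm_positive b" and dom: "norm_positive (\<kappa> *\<^sub>R b - star \<psi> * \<psi>)" and \<kappa>: "\<kappa> \<ge> 0"
  shows "cuntz_subeq B (\<psi> * star \<psi>) b"
proof -
  have approx: "\<exists>v\<in>B. norm (v * b * star v - \<psi> * star \<psi>) \<le> e * \<kappa>" if e: "e > 0" for e
  proof -
    obtain c where c: "c * (b + e *\<^sub>R 1) = 1" "(b + e *\<^sub>R 1) * c = 1" "star c = c"
      and cc: "\<And>y. y * b = b * y \<Longrightarrow> y * c = c * y"
      and cB: "\<And>B. cstar_subalgebra B \<Longrightarrow> 1 \<in> B \<Longrightarrow> b \<in> B \<Longrightarrow> c \<in> B"
      by (rule norm_positive_shift_inverse[OF b e]) (rule that; assumption)
    have "norm_positive (b + e *\<^sub>R 1)" using e by (intro norm_positive_add b) auto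
    then obtain s where s: "star s = s" "s * s = b + e *\<^sub>R 1"
      and sc: "\<And>y. y * (b + e *\<^sub>R 1) = (b + e *\<^sub>R 1) * y \<Longrightarrow> y * s = s * y"
      and sB: "\<And>B. cstar_subalgebra B \<Longrightarrow> 1 \<in> B \<Longrightarrow> b + e *\<^sub>R 1 \<in> B \<Longrightarrow> s \<in> B"
      by (rule norm_positive_sqrt) (rule that; assumption)
    have bs: "b * s = s * b" by (rule sc) (simp add: algebra_simps)
    have sc': "s * c = c * s" by (rule cc) (simp add: bs)
    have cb: "c * b = b * c" using cc[of b] by simp
    \<comment> \<open>\<open>k\<close> is (b + e)^(-1/2).\<close>
    define k where "k = s * c"
    have sk: "star k = k" by (simp add: k_def star_mult s c sc')
    have kb: "k * b = b * k" 
      using commute_mult[OF bs cb[symmetric]] by (simp add: k_def)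
    have kk: "k * k = c"
    proof -
      have "k * k = (s * s) * c * c" 
        unfolding k_def square_mult_commute[OF sc'] by (simp only: mult.assoc)
      then show ?thesis by (simp add: s c)
    qed
    have kbk: "k * b * k = 1 - e *\<^sub>R c"
    proof -
      have "k * b * k = b * (k * k)" by (simp add: kb mult.assoc)
      also have "\<dots> = (b + e *\<^sub>R 1) * c - e *\<^sub>R c" by (simp add: kk algebra_simps)
      finally show ?thesis by (simp add: c)
    qed
    have "norm_positive (star (sqrt e *\<^sub>R k) * (sqrt e *\<^sub>R k))" by (rule norm_positive_star_mult_self)
    then have ec: "norm_positive (e *\<^sub>R c)" using e by (simp add: sk kk)
    obtain r where r: "star r = r" "r * r = b" by (rule norm_positive_sqrt[OF b])
    have "norm_positive (star (r * k) * (r * k))" by (rule norm_positive_star_mult_self)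
    then have "norm_positive (k * b * k)" by (simp add: star_mult r sk mult.assoc flip: r(2))
    then have nkbk: "norm (k * b * k) \<le> 1"
      by (rule norm_le_of_bounded) (use ec in \<open>simp_all add: kbk\<close>)
    \<comment> \<open>Conjugating the domination by \<open>k\<close> bounds
      \<open>\<psi> * k\<close> independently of \<open>e\<close>; this makes the error
      \<open>e\<close> times \<open>(\<psi> * k) * star (\<psi> * k)\<close> tend to 0.\<close>
    obtain d where d: "star d = d" "d * d = \<kappa> *\<^sub>R b - star \<psi> * \<psi>" by (rule norm_positive_sqrt[OF dom])
    have "norm_positive (star (d * k) * (d * k))" by (rule norm_positive_star_mult_self)
    also have "star (d * k) * (d * k) = k * (d * d) * k" by (simp add: star_mult d(1) sk mult.assoc)
    also have "\<dots> = \<kappa> *\<^sub>R (k * b * k) - star (\<psi> * k) * (\<psi> * k)"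
      by (simp add: d(2) star_mult sk algebra_simps)
    finally have "norm (star (\<psi> * k) * (\<psi> * k)) \<le> norm (\<kappa> *\<^sub>R (k * b * k))"
      using norm_mono_positive[OF norm_positive_star_mult_self] by blast
    also have "\<dots> \<le> \<kappa>" using nkbk \<kappa> by (simp add: mult_left_le)
    finally have n: "norm ((\<psi> * k) * star (\<psi> * k)) \<le> \<kappa>" by (simp add: cstar_identity cstar_identity')
    have "(\<psi> * k) * b * star (\<psi> * k) = \<psi> * (k * b * k) * star \<psi>" by (simp add: star_mult sk mult.assoc)
    also have "\<dots> = \<psi> * star \<psi> - e *\<^sub>R ((\<psi> * k) * star (\<psi> * k))"
      unfolding kbk kk[symmetric] by (simp add: star_mult sk algebra_simps)
    finally have "norm ((\<psi> * k) * b * star (\<psi> * k) - \<psi> * star \<psi>) = e * norm ((\<psi> * k) * star (\<psi> * k))"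
      using e by simp
    also have "\<dots> \<le> e * \<kappa>" using n e by simp
    finally show ?thesis
    proof (intro bexI)
      have "s \<in> B" by (intro sB B cstar_subalgebraD(2)[OF B(1)] cstar_subalgebra_scaleR)
      then show "\<psi> * k \<in> B" unfolding k_def by (intro cstar_subalgebraD(4)[OF B(1)] B cB)
    qed
  qed
  then have "\<forall>n. \<exists>v\<in>B. norm (v * b * star v - \<psi> * star \<psi>) \<le> inverse (real (Suc n)) * \<kappa>" by simp
  then obtain v where v: "\<And>n. v n \<in> B"
    "\<And>n. norm (v n * b * star (v n) - \<psi> * star \<psi>) \<le> inverse (real (Suc n)) * \<kappa>"
    by metis
  have "(\<lambda>n. inverse (real (Suc n)) * \<kappa>) \<longlonglongrightarrow> 0 * \<kappa>"
    by (intro tendsto_intros LIMSEQ_inverse_real_of_nat)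
  then have "(\<lambda>n. v n * b * star (v n) - \<psi> * star \<psi>) \<longlonglongrightarrow> 0"
    using Lim_null_comparison[of "\<lambda>n. v n * b * star (v n) - \<psi> * star \<psi>" "\<lambda>n. inverse (real (Suc n)) * \<kappa>" sequentially] v(2) by simp
  then have "(\<lambda>n. v n * b * star (v n)) \<longlonglongrightarrow> \<psi> * star \<psi>" by (simp add: LIM_zero_iff)
  then show ?thesis unfolding cuntz_subeq_def using v(1) by blast
qed

section \<open>Covariant pairs over a minimal homeomorphism\<close>

locale minimal_crossed_product =
  fixes h :: "'x::t2_space \<Rightarrow> 'x"
    and Y :: "'x set"
    and \<iota> :: "('x \<Rightarrow> complex) \<Rightarrow> 'a::unital_cstar_algebra"
    and u :: 'a
  assumes compact_space: "compact (UNIV :: 'x set)"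
    and minimal: "minimal_homeomorphism h"
    and compact_Y: "compact Y"
    and Y_nonempty: "Y \<noteq> {}"
    and Y_translates: "\<And>n::int. n \<noteq> 0 \<Longrightarrow> int_funpow h n ` Y \<inter> Y = {}"
    and crossed: "is_crossed_product h \<iota> u"
begin

section \<open>Orbits, freeness and separation\<close>

abbreviation "H \<equiv> int_funpow h"
abbreviation "U \<equiv> unitary_power u"
abbreviation "cont f \<equiv> continuous_on (UNIV::'x set) (f :: 'x \<Rightarrow> complex)"

lemma homeo: "homeomorphism UNIV UNIV h (inv h)"
  and minimal_closed: "closed Z \<Longrightarrow> h ` Z = Z \<Longrightarrow> Z = {} \<or> Z = UNIV"
  using minimal unfolding minimal_homeomorphism_def by auto

lemma h_inv [simp]: "h (inv h x) = x" and inv_h [simp]: "inv h (h x) = x"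
  using homeo by (auto simp: homeomorphism_def)

lemma H_0 [simp]: "H 0 x = x"
  by (simp add: int_funpow_def)

lemma H_succ: "H (n + 1) x = h (H n x)"
proof (cases "n \<ge> 0")
  case True
  then have "nat (n + 1) = Suc (nat n)" by simp
  with True show ?thesis by (simp add: int_funpow_def)
next
  case False
  then have "nat (- n) = Suc (nat (- (n + 1)))" by simp
  with False show ?thesis by (cases "n = -1") (auto simp: int_funpow_def)
qed

lemma H_pred: "H (n - 1) x = inv h (H n x)"
  using H_succ[of "n - 1" x] by simp

lemma H_1 [simp]: "H 1 x = h x" and H_m1 [simp]: "H (-1) x = inv h x"
  using H_succ[of 0 x] H_pred[of 0 x] by simp_all

lemma H_add: "H (m + n) x = H m (H n x)"
proof (induction m rule: int_induct[of _ 0])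
  case (step1 i)
  have "H (i + 1 + n) x = h (H (i + n) x)" using H_succ[of "i + n" x] by (simp add: add_ac)
  then show ?case using step1 by (simp add: H_succ)
next
  case (step2 i)
  have "H (i - 1 + n) x = inv h (H (i + n) x)" using H_pred[of "i + n" x] by (simp add: algebra_simps)
  then show ?case using step2 by (simp add: H_pred)
qed simp

lemma H_minus [simp]: "H (- n) (H n x) = x" "H n (H (- n) x) = x"
  using H_add[of "- n" n x] H_add[of n "- n" x] by simp_all

lemma H_continuous: "continuous_on S (H n)"
proof -
  have "continuous_on UNIV (H n)"
  proof (induction n rule: int_induct[of _ 0])
    case base
    have "H 0 = id" by (auto simp: fun_eq_iff)
    then show ?case by simp
  next
    case (step1 i)
    have "H (i + 1) = h \<circ> H i" by (auto simp: fun_eq_iff H_succ)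
    moreover have "continuous_on UNIV h" using homeo by (simp add: homeomorphism_def)
    ultimately show ?case using step1 by (metis continuous_on_compose continuous_on_subset subset_UNIV)
  next
    case (step2 i)
    have "H (i - 1) = inv h \<circ> H i" by (auto simp: fun_eq_iff H_pred)
    moreover have "continuous_on UNIV (inv h)" using homeo by (simp add: homeomorphism_def)
    ultimately show ?case using step2 by (metis continuous_on_compose continuous_on_subset subset_UNIV)
  qed
  then show ?thesis by (rule continuous_on_subset) simp
qed

lemma continuous_on_H [continuous_intros]:
  "continuous_on UNIV f \<Longrightarrow> continuous_on S (\<lambda>x. f (H n x))" for f :: "'x \<Rightarrow> 'b::topological_space"
  by (rule continuous_on_compose2[of UNIV f S "H n"]) (auto intro: H_continuous)

lemma open_H_vimage: "open V \<Longrightarrow> open (H n -` V)"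
  by (rule open_vimage[OF _ H_continuous])

lemma closed_H_vimage: "closed V \<Longrightarrow> closed (H n -` V)"
  using H_continuous by (rule closed_vimage[rotated])

lemma mem_H_image: "x \<in> H n ` S \<longleftrightarrow> H (- n) x \<in> S"
  by (metis H_minus image_iff)

lemma closed_Y: "closed Y"
  using compact_Y by (rule compact_imp_closed)

lemma H_Y_disjoint: "H (- m) x \<in> Y \<Longrightarrow> H (- n) x \<in> Y \<Longrightarrow> m = n"
proof (rule ccontr)
  assume x: "H (- m) x \<in> Y" "H (- n) x \<in> Y" and "m \<noteq> n"
  have "H (n - m) (H (- n) x) = H (- m) x" by (simp flip: H_add)
  then have "H (- m) x \<in> H (n - m) ` Y" using x by (metis imageI)
  with x Y_translates[of "n - m"] \<open>m \<noteq> n\<close> show False by auto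
qed

text \<open>The fixed points of \<open>H n\<close> form a closed invariant set. If it were nonempty
  it would be the whole space, yet \<open>H n\<close> moves every point of \<open>Y\<close> out of
  \<open>Y\<close>.\<close>

lemma H_free: "n \<noteq> 0 \<Longrightarrow> H n x \<noteq> x"
proof
  assume n: "n \<noteq> 0" and x: "H n x = x"
  define Z where "Z = {x. H n x = x}"
  have "closed Z" unfolding Z_def
    by (rule closed_Collect_eq[OF H_continuous continuous_on_id])
  moreover have comm: "h (H n y) = H n (h y)" "inv h (H n y) = H n (inv h y)" for y
    using H_add[of 1 n y] H_add[of n 1 y] H_add[of "-1" n y] H_add[of n "-1" y]
    by (simp_all add: algebra_simps)
  have "h ` Z = Z"
  proof
    show "h ` Z \<subseteq> Z" by (auto simp: Z_def simp flip: comm)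
    show "Z \<subseteq> h ` Z"
    proof
      fix y assume "y \<in> Z"
      then have "inv h y \<in> Z" by (simp add: Z_def flip: comm)
      then show "y \<in> h ` Z" by (metis h_inv imageI)
    qed
  qed
  ultimately have "Z = UNIV" using minimal_closed[of Z] x by (auto simp: Z_def)
  moreover obtain y where y: "y \<in> Y" using Y_nonempty by blast
  ultimately have "H n y = y" by (auto simp: Z_def)
  then show False using H_Y_disjoint[of "- n" y 0] y n by simp
qed

text \<open>Applied at \<open>H k x\<close>, this gives visits to \<open>V\<close> in every time window of length \<open>L\<close>.\<close>

lemma uniform_return:
  assumes V: "open V" "V \<noteq> {}"
  obtains L :: nat where "L > 0" "\<And>x. \<exists>i<L. H (int i) x \<in> V"
proof -
  define Z where "Z = (\<Inter>n. - (H n -` V))"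
  have "closed Z" unfolding Z_def using open_H_vimage[OF V(1)] by auto
  moreover have "h ` Z = Z"
  proof
    have *: "h y \<in> Z \<longleftrightarrow> y \<in> Z" for y
    proof -
      have "H n (h y) = H (n + 1) y" for n using H_add[of n 1 y] by simp
      then show ?thesis by (auto simp: Z_def) (metis diff_add_cancel)
    qed
    show "h ` Z \<subseteq> Z" using * by auto
    show "Z \<subseteq> h ` Z"
    proof
      fix y assume "y \<in> Z"
      then have "inv h y \<in> Z" using *[of "inv h y"] by simp
      then show "y \<in> h ` Z" by (metis h_inv imageI)
    qed
  qed
  moreover have "Z \<noteq> UNIV"
  proof -
    obtain v where "v \<in> V" using V by blast
    then have "v \<notin> Z" by (auto simp: Z_def intro!: exI[of _ 0])
    then show ?thesis by blast
  qed
  ultimately have "Z = {}" using minimal_closed by blast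
  then have cover: "UNIV \<subseteq> (\<Union>n\<in>UNIV. H n -` V)" unfolding Z_def by blast
  obtain F where F: "finite F" "UNIV \<subseteq> (\<Union>n\<in>F. H n -` V)"
    by (rule compactE_image[OF compact_space _ cover]) (rule open_H_vimage[OF V(1)])
  obtain M where M: "\<And>n. n \<in> F \<Longrightarrow> \<bar>n\<bar> \<le> int M"
  proof -
    have "\<bar>n\<bar> \<le> int (nat (\<Sum>n\<in>F. \<bar>n\<bar>))" if "n \<in> F" for n
      using member_le_sum[of n F abs] that F(1) by (simp add: sum_nonneg)
    then show ?thesis using that by blast
  qed
  show ?thesis
  \<comment> \<open>Starting at \<open>H (int M) x\<close> turns the times from -M to M into 0 to
    2M.\<close>
  proof (rule that[of "2 * M + 1"])
    fix x
    obtain n where n: "n \<in> F" "H n (H (int M) x) \<in> V" using F(2) by blast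
    then have "\<bar>n\<bar> \<le> int M" using M by blast
    then show "\<exists>i<2 * M + 1. H (int i) x \<in> V"
      using n(2) by (intro exI[of _ "nat (n + int M)"]) (auto simp: H_add)
  qed simp
qed

lemma urysohn:
  assumes "closed S" "closed T" "S \<inter> T = {}"
  obtains f :: "'x \<Rightarrow> real" where "continuous_on UNIV f" "\<And>x. 0 \<le> f x" "\<And>x. f x \<le> 1"
    "\<And>x. x \<in> S \<Longrightarrow> f x = 0" "\<And>x. x \<in> T \<Longrightarrow> f x = 1"
proof -
  have hd: "Hausdorff_space (euclidean :: 'x topology)"
    unfolding Hausdorff_space_def disjnt_def using hausdorff by fastforce
  have "normal_space (euclidean :: 'x topology)"
    by (rule compact_Hausdorff_or_regular_imp_normal_space)
      (use compact_space hd in \<open>auto simp: compact_space_def\<close>)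
  then obtain f where "continuous_map (euclidean :: 'x topology) (top_of_set {0..1::real}) f"
    "f ` S \<subseteq> {0}" "f ` T \<subseteq> {1}"
    using Urysohn_lemma[of "euclidean :: 'x topology" S T 0 1] assms by (auto simp: disjnt_def)
  then show ?thesis
    by (intro that[of f]) (auto simp: continuous_map_in_subtopology image_subset_iff)
qed

section \<open>The embedding of C(X)\<close>

lemma \<iota>_add: "cont f \<Longrightarrow> cont g \<Longrightarrow> \<iota> (\<lambda>x. f x + g x) = \<iota> f + \<iota> g"
  and \<iota>_scaleC: "cont f \<Longrightarrow> \<iota> (\<lambda>x. c * f x) = c *\<^sub>C \<iota> f"
  and \<iota>_mult: "cont f \<Longrightarrow> cont g \<Longrightarrow> \<iota> (\<lambda>x. f x * g x) = \<iota> f * \<iota> g"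
  and \<iota>_star: "cont f \<Longrightarrow> \<iota> (\<lambda>x. cnj (f x)) = star (\<iota> f)"
  and \<iota>_one: "\<iota> (\<lambda>_. 1) = 1"
  and unitary_u: "unitary u"
  and covariance: "cont f \<Longrightarrow> u * \<iota> f * star u = \<iota> (f \<circ> inv h)"
  and dense_sums: "closure (integrated_form \<iota> u ` conv_algebra) = UNIV"
  using crossed unfolding is_crossed_product_def cont_functions_def by auto

lemma \<iota>_zero [simp]: "\<iota> (\<lambda>_. 0) = 0"
  using \<iota>_scaleC[of "\<lambda>_. 0" 0] by simp

lemma \<iota>_minus: "cont f \<Longrightarrow> \<iota> (\<lambda>x. - f x) = - \<iota> f"
  using \<iota>_scaleC[of f "-1"] by (simp add: scaleC_minus_left)

lemma \<iota>_diff: "cont f \<Longrightarrow> cont g \<Longrightarrow> \<iota> (\<lambda>x. f x - g x) = \<iota> f - \<iota> g"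
  using \<iota>_add[of f "\<lambda>x. - g x"] by (simp add: \<iota>_minus continuous_on_minus)

lemma \<iota>_sum: "(\<And>i. i \<in> F \<Longrightarrow> cont (f i)) \<Longrightarrow> \<iota> (\<lambda>x. \<Sum>i\<in>F. f i x) = (\<Sum>i\<in>F. \<iota> (f i))"
  by (induction F rule: infinite_finite_induct) (simp_all add: \<iota>_add continuous_on_sum)

lemma \<iota>_power: "cont f \<Longrightarrow> \<iota> (\<lambda>x. f x ^ n) = \<iota> f ^ n"
  by (induction n) (simp_all add: \<iota>_one \<iota>_mult continuous_on_power)

abbreviation \<iota>r :: "('x \<Rightarrow> real) \<Rightarrow> 'a" where "\<iota>r f \<equiv> \<iota> (\<lambda>x. complex_of_real (f x))"

lemma cont_of_real [continuous_intros]: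
  "continuous_on S f \<Longrightarrow> continuous_on S (\<lambda>x. complex_of_real (f x))" for f :: "'x \<Rightarrow> real"
  by (rule continuous_on_of_real)

lemma \<iota>r_sa [simp]: "continuous_on UNIV f \<Longrightarrow> star (\<iota>r f) = \<iota>r f"
  using \<iota>_star[of "\<lambda>x. complex_of_real (f x)"] by (simp add: cont_of_real)

lemma \<iota>r_mult: "continuous_on UNIV f \<Longrightarrow> continuous_on UNIV g \<Longrightarrow> \<iota>r (\<lambda>x. f x * g x) = \<iota>r f * \<iota>r g"
  using \<iota>_mult[of "\<lambda>x. complex_of_real (f x)" "\<lambda>x. complex_of_real (g x)"] by (simp add: cont_of_real)

lemma \<iota>r_diff: "continuous_on UNIV f \<Longrightarrow> continuous_on UNIV g \<Longrightarrow> \<iota>r (\<lambda>x. f x - g x) = \<iota>r f - \<iota>r g"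
  using \<iota>_diff[of "\<lambda>x. complex_of_real (f x)" "\<lambda>x. complex_of_real (g x)"] by (simp add: cont_of_real)

lemma \<iota>r_add: "continuous_on UNIV f \<Longrightarrow> continuous_on UNIV g \<Longrightarrow> \<iota>r (\<lambda>x. f x + g x) = \<iota>r f + \<iota>r g"
  using \<iota>_add[of "\<lambda>x. complex_of_real (f x)" "\<lambda>x. complex_of_real (g x)"] by (simp add: cont_of_real)

lemma \<iota>r_scaleR: "continuous_on UNIV f \<Longrightarrow> \<iota>r (\<lambda>x. r * f x) = r *\<^sub>R \<iota>r f"
  using \<iota>_scaleC[of "\<lambda>x. complex_of_real (f x)" "complex_of_real r"]
  by (simp add: cont_of_real scaleC_of_real)

lemma \<iota>r_square_sqrt:
  "continuous_on UNIV f \<Longrightarrow> (\<And>x. f x \<ge> 0) \<Longrightarrow> \<iota>r (\<lambda>x. sqrt (f x)) * \<iota>r (\<lambda>x. sqrt (f x)) = \<iota>r f"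
  using \<iota>r_mult[of "\<lambda>x. sqrt (f x)" "\<lambda>x. sqrt (f x)"] by (simp add: continuous_on_real_sqrt)

lemma norm_positive_\<iota>r:
  assumes "continuous_on UNIV f" "\<And>x. f x \<ge> 0"
  shows "norm_positive (\<iota>r f)"
  using norm_positive_square[of "\<iota>r (\<lambda>x. sqrt (f x))"] \<iota>r_square_sqrt[OF assms] assms(1)
  by (simp add: continuous_on_real_sqrt)

lemma positive_\<iota>r:
  assumes f: "continuous_on UNIV f" "\<And>x. f x \<ge> 0"
  shows "positive (\<iota>r f)"
proof -
  have "c \<in> complex_of_real ` {0..}" if c: "c \<in> spectrum (\<iota>r f)" for c
  proof (rule ccontr)
    assume nc: "c \<notin> complex_of_real ` {0..}"
    have n0: "complex_of_real (f x) - c \<noteq> 0" for x using nc f(2)[of x] by auto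
    let ?d = "\<lambda>x. complex_of_real (f x) - c"
    have cd: "cont ?d" by (intro continuous_intros f)
    have ci: "cont (\<lambda>x. inverse (?d x))" by (intro continuous_on_inverse cd) (use n0 in auto)
    have "\<iota>r f - c *\<^sub>C 1 = \<iota> ?d"
      using \<iota>_diff[of "\<lambda>x. complex_of_real (f x)" "\<lambda>_. c"] \<iota>_scaleC[of "\<lambda>_. 1" c] f
      by (simp add: \<iota>_one cont_of_real)
    moreover have "\<iota> ?d * \<iota> (\<lambda>x. inverse (?d x)) = 1" "\<iota> (\<lambda>x. inverse (?d x)) * \<iota> ?d = 1"
      using \<iota>_mult[OF cd ci] \<iota>_mult[OF ci cd] n0 by (simp_all add: \<iota>_one)
    ultimately show False using c unfolding spectrum_def by auto
  qed
  then show ?thesis using f unfolding positive_def by auto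
qed

text \<open>For real \<open>g\<close> with values in [-1, 1], the images of \<open>g\<close> and of
  the root of 1 - g^2 are commuting with squares adding up to 1. Complex \<open>f\<close> reduces to
  its squared modulus by the C*-identity; dividing by \<open>c + e\<close> covers the case
  \<open>c = 0\<close>.\<close>

lemma \<iota>_contractive:
  assumes f: "cont f" and c: "\<And>x. cmod (f x) \<le> c"
  shows "norm (\<iota> f) \<le> c"
proof -
  have real: "norm (\<iota>r g) \<le> 1" if g: "continuous_on UNIV g" "\<And>x. \<bar>g x\<bar> \<le> 1" for g
  proof (rule norm_le_one_of_sum_squares)
    let ?q = "\<lambda>x. sqrt (1 - (g x)\<^sup>2)"
    have q: "continuous_on UNIV ?q" by (intro continuous_intros g)
    show "star (\<iota>r g) = \<iota>r g" "star (\<iota>r ?q) = \<iota>r ?q" using g q by simp_all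
    show "\<iota>r g * \<iota>r ?q = \<iota>r ?q * \<iota>r g" using g q by (simp add: mult.commute flip: \<iota>r_mult)
    have "(g x)\<^sup>2 \<le> 1" for x using g(2)[of x] by (simp add: abs_square_le_1)
    then have "g x * g x + ?q x * ?q x = 1" for x by (simp flip: power2_eq_square)
    then show "\<iota>r g * \<iota>r g + \<iota>r ?q * \<iota>r ?q = 1"
      using \<iota>r_add[of "\<lambda>x. g x * g x" "\<lambda>x. ?q x * ?q x"] g q
      by (simp add: \<iota>_one continuous_on_mult del: real_sqrt_mult_self flip: \<iota>r_mult)
  qed
  have "norm (\<iota> f) \<le> c + e" if e: "e > 0" for e
  proof -
    have c0: "c \<ge> 0" using c norm_ge_zero order_trans by blast
    define k where "k = c + e"
    have k: "k > 0" using c0 e by (simp add: k_def)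
    let ?g = "\<lambda>x. (cmod (f x) / k)\<^sup>2"
    have "cmod (f x) / k \<le> 1" for x using c[of x] k e by (simp add: k_def)
    then have n: "norm (\<iota>r ?g) \<le> 1" using k
      by (intro real continuous_intros f) (auto simp: power_le_one)
    have "complex_of_real (?g x) = complex_of_real ((1/k)\<^sup>2) * (cnj (f x) * f x)" for x
      using complex_norm_square[of "f x"] by (simp add: power_divide mult.commute)
    then have "\<iota>r ?g = (1/k)\<^sup>2 *\<^sub>R (star (\<iota> f) * \<iota> f)"
      using f by (simp only:) (simp add: \<iota>_scaleC \<iota>_mult \<iota>_star continuous_on_mult continuous_on_cnj
        scaleC_of_real del: of_real_power)
    then have "(norm (\<iota> f) / k)\<^sup>2 \<le> 1" using n by (simp add: cstar_identity power_divide)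
    then have "norm (\<iota> f) / k \<le> 1" using k by (simp add: abs_square_le_1)
    then show ?thesis using k by (simp add: k_def)
  qed
  then show ?thesis by (rule field_le_epsilon)
qed

section \<open>Integer powers of the unitary\<close>

lemma U_0 [simp]: "U 0 = 1"
  by (simp add: unitary_power_def)

lemma uu [simp]: "star u * u = 1" "u * star u = 1" "star u * (u * a) = a" "u * (star u * a) = a"
  using unitary_u by (simp_all add: unitary_def flip: mult.assoc)

lemma U_succ: "U (n + 1) = u * U n"
proof (cases "n \<ge> 0")
  case True
  then have "nat (n + 1) = Suc (nat n)" by simp
  with True show ?thesis by (simp add: unitary_power_def)
next
  case False
  then have "nat (- n) = Suc (nat (- (n + 1)))" by simp
  with False show ?thesis by (cases "n = -1") (auto simp: unitary_power_def)
qed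

lemma U_pred: "U (n - 1) = star u * U n"
  using U_succ[of "n - 1"] by simp

lemma U_1 [simp]: "U 1 = u" and U_m1 [simp]: "U (-1) = star u"
  using U_succ[of 0] U_pred[of 0] by simp_all

lemma U_add: "U (m + n) = U m * U n"
proof (induction m rule: int_induct[of _ 0])
  case (step1 i)
  have "U (i + 1 + n) = u * U (i + n)" using U_succ[of "i + n"] by (simp add: add_ac)
  then show ?case using step1 by (simp add: U_succ mult.assoc)
next
  case (step2 i)
  have "U (i - 1 + n) = star u * U (i + n)" using U_pred[of "i + n"] by (simp add: algebra_simps)
  then show ?case using step2 by (simp add: U_pred mult.assoc)
qed simp

lemma U_minus [simp]: "U (- n) * U n = 1" "U n * U (- n) = 1"
  using U_add[of "- n" n] U_add[of n "- n"] by simp_all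

lemma star_U [simp]: "star (U n) = U (- n)"
proof -
  have "star (u ^ k) = star u ^ k" "star (star u ^ k) = u ^ k" for k
    by (simp_all add: star_power star_star)
  then show ?thesis by (auto simp: unitary_power_def)
qed

lemma norm_U [simp]: "norm (U n) = 1"
  using cstar_identity[of "U n"] power2_eq_iff_nonneg[of "norm (U n)" 1] by simp

lemma U_\<iota>: "cont f \<Longrightarrow> U n * \<iota> f = \<iota> (\<lambda>x. f (H (- n) x)) * U n"
proof (induction n arbitrary: f rule: int_induct[of _ 0])
  case (step1 i)
  have c: "cont (\<lambda>x. f (H (- i) x))" by (intro continuous_intros step1)
  have "U (i + 1) * \<iota> f = (u * \<iota> (\<lambda>x. f (H (- i) x)) * star u) * (u * U i)"
    using step1 by (simp add: U_succ mult.assoc)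
  also have "u * \<iota> (\<lambda>x. f (H (- i) x)) * star u = \<iota> (\<lambda>x. f (H (- (i + 1)) x))"
    unfolding covariance[OF c] using H_add[of "- i" "-1"] by (simp add: o_def)
  finally show ?case by (simp add: U_succ)
next
  case (step2 i)
  have c: "cont (\<lambda>x. f (H (- (i - 1)) x))" by (intro continuous_intros step2)
  have "(\<lambda>x. f (H (- (i - 1)) x)) \<circ> inv h = (\<lambda>x. f (H (- i) x))"
    using H_add[of "- (i - 1)" "-1"] by (simp add: o_def)
  with covariance[OF c] have "u * \<iota> (\<lambda>x. f (H (- (i - 1)) x)) * star u * u = \<iota> (\<lambda>x. f (H (- i) x)) * u" by simp
  then have e1: "u * \<iota> (\<lambda>x. f (H (- (i - 1)) x)) = \<iota> (\<lambda>x. f (H (- i) x)) * u" by (simp add: mult.assoc)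
  have "star u * \<iota> (\<lambda>x. f (H (- i) x)) = star u * (\<iota> (\<lambda>x. f (H (- i) x)) * u) * star u"
    by (simp add: mult.assoc)
  also have "\<dots> = \<iota> (\<lambda>x. f (H (- (i - 1)) x)) * star u" unfolding e1[symmetric] by simp
  finally have e2: "star u * \<iota> (\<lambda>x. f (H (- i) x)) = \<iota> (\<lambda>x. f (H (- (i - 1)) x)) * star u" .
  have "U (i - 1) * \<iota> f = (star u * \<iota> (\<lambda>x. f (H (- i) x))) * U i"
    using step2 by (simp add: U_pred mult.assoc)
  then show ?case unfolding e2 by (simp add: U_pred mult.assoc)
qed simp

lemma \<iota>_U: "cont f \<Longrightarrow> \<iota> f * U n = U n * \<iota> (\<lambda>x. f (H n x))"
  using U_\<iota>[of "\<lambda>x. f (H n x)" n] by (simp add: continuous_on_H)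

lemma U_\<iota>_U: "cont f \<Longrightarrow> U n * \<iota> f * U (- n) = \<iota> (\<lambda>x. f (H (- n) x))"
  using U_\<iota>[of f n] by (simp add: mult.assoc)

section \<open>Invariant ideals and faithfulness of the embedding\<close>

lemma cnj_mult_norm: "cnj z * z = complex_of_real ((cmod z)\<^sup>2)"
  using complex_norm_square[of z] by (simp add: mult.commute)

text \<open>By minimality finitely many translates of the set where \<open>f\<close> is nonzero
  cover the space, so the sum of the squared moduli of these translates of \<open>f\<close> is an
  invertible member of \<open>K\<close>. It is applied to the kernel of \<open>\<iota>\<close> and
  to the functions whose image lies in a given closed ideal.\<close>

lemma invariant_ideal_contains_one:
  assumes K_cont: "\<And>f. f \<in> K \<Longrightarrow> cont f"
    and K_add: "\<And>f g. f \<in> K \<Longrightarrow> g \<in> K \<Longrightarrow> (\<lambda>x. f x + g x) \<in> K"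
    and K_mult: "\<And>f g. f \<in> K \<Longrightarrow> cont g \<Longrightarrow> (\<lambda>x. g x * f x) \<in> K"
    and K_H: "\<And>f n. f \<in> K \<Longrightarrow> (\<lambda>x. f (H n x)) \<in> K"
    and f: "f \<in> K" "f z \<noteq> 0"
  shows "(\<lambda>_. 1) \<in> K"
proof -
  let ?V = "{x. f x \<noteq> 0}"
  have cf: "cont f" by (rule K_cont[OF f(1)])
  have "open ?V" by (rule open_Collect_neq[OF cf continuous_on_const])
  moreover have "?V \<noteq> {}" using f(2) by blast
  ultimately obtain L where L: "\<And>x. \<exists>i<L. H (int i) x \<in> ?V" using uniform_return by blast
  define q where "q = (\<lambda>x. \<Sum>i<L. cnj (f (H (int i) x)) * f (H (int i) x))"
  have zero: "(\<lambda>_. 0) \<in> K" using K_mult[OF f(1), of "\<lambda>_. 0"] by simp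
  have qK: "q \<in> K"
  proof -
    have "(\<lambda>x. \<Sum>i<n. cnj (f (H (int i) x)) * f (H (int i) x)) \<in> K" for n
    proof (induction n)
      case (Suc n)
      have "(\<lambda>x. cnj (f (H (int n) x)) * f (H (int n) x)) \<in> K"
        by (intro K_mult K_H f continuous_intros cf)
      from K_add[OF Suc this] show ?case by simp
    qed (simp add: zero)
    then show ?thesis by (simp add: q_def)
  qed
  have q0: "q x \<noteq> 0" for x
  proof -
    obtain i where i: "i < L" "f (H (int i) x) \<noteq> 0" using L[of x] by blast
    have "q x = complex_of_real (\<Sum>i<L. (cmod (f (H (int i) x)))\<^sup>2)" by (simp add: q_def cnj_mult_norm)
    moreover have "(\<Sum>i<L. (cmod (f (H (int i) x)))\<^sup>2) > 0"
      by (rule sum_pos2[of _ i]) (use i in auto)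
    ultimately show ?thesis by (metis less_irrefl of_real_eq_0_iff)
  qed
  have "(\<lambda>x. inverse (q x) * q x) \<in> K"
    by (intro K_mult qK continuous_on_inverse K_cont) (use q0 in auto)
  then show ?thesis by (simp add: q0)
qed

text \<open>The kernel is an invariant ideal; were it nonzero it would contain the constant 1, which
  is mapped to the unit.\<close>

lemma \<iota>_eq_0_iff: "cont f \<Longrightarrow> \<iota> f = 0 \<longleftrightarrow> f = (\<lambda>_. 0)"
proof
  assume f: "cont f" "\<iota> f = 0"
  show "f = (\<lambda>_. 0)"
  proof (rule ccontr)
    assume "f \<noteq> (\<lambda>_. 0)"
    then obtain z where z: "f z \<noteq> 0" by blast
    have "(\<lambda>_. 1) \<in> {f. cont f \<and> \<iota> f = 0}"
    proof (rule invariant_ideal_contains_one[where f=f and z=z])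
      show "(\<lambda>x. g (H n x)) \<in> {f. cont f \<and> \<iota> f = 0}" if "g \<in> {f. cont f \<and> \<iota> f = 0}" for g n
        using that U_\<iota>_U[of g "- n"] by (simp add: continuous_on_H)
    qed (use f z in \<open>auto simp: \<iota>_add \<iota>_mult intro: continuous_on_add continuous_on_mult\<close>)
    then show False by (simp add: \<iota>_one)
  qed
qed simp

text \<open>
  If \<open>\<parallel>\<iota> f\<parallel> < r < |f z|\<close>, a bump function \<open>\<psi>\<close> at \<open>z\<close> factors as \<open>\<psi> w\<^sup>n f\<^sup>n\<close> with
  \<open>|w| \<le> 1/r\<close>, which forces \<open>\<iota> \<psi> = 0\<close>.
\<close>

lemma \<iota>_norm_ge:
  assumes f: "cont f"
  shows "cmod (f z) \<le> norm (\<iota> f)"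
proof (rule ccontr)
  assume "\<not> cmod (f z) \<le> norm (\<iota> f)"
  then obtain r where r: "norm (\<iota> f) < r" "r < cmod (f z)" using dense not_le by blast
  have r0: "r > 0" using r(1) norm_ge_zero[of "\<iota> f"] by linarith
  have cl: "closed {x. cmod (f x) \<le> r}" by (intro closed_Collect_le continuous_intros f)
  obtain \<psi> :: "'x \<Rightarrow> real" where \<psi>: "continuous_on UNIV \<psi>" "\<And>x. 0 \<le> \<psi> x" "\<And>x. \<psi> x \<le> 1"
    "\<And>x. x \<in> {x. cmod (f x) \<le> r} \<Longrightarrow> \<psi> x = 0" "\<And>x. x \<in> {z} \<Longrightarrow> \<psi> x = 1"
    by (rule urysohn[OF cl closed_singleton, of z]) (use r in auto)
  \<comment> \<open>\<open>w\<close> is 1 / f where the modulus of \<open>f\<close> exceeds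
    \<open>r\<close>, continued with a denominator bounded away from 0.\<close>
  define w where "w x = cnj (f x) / complex_of_real ((max r (cmod (f x)))\<^sup>2)" for x
  have m0: "max r (cmod (f x)) > 0" for x using r0 by simp
  have cw: "cont w" unfolding w_def
    by (intro continuous_intros f) (use m0 in \<open>auto simp: less_le\<close>)
  have wf: "\<psi> x \<noteq> 0 \<Longrightarrow> w x * f x = 1" for x
  proof -
    assume "\<psi> x \<noteq> 0"
    then have "cmod (f x) > r" using \<psi>(4)[of x] by force
    then have m: "max r (cmod (f x)) = cmod (f x)" and n0: "cmod (f x) \<noteq> 0" using r0 by auto
    have "w x * f x = complex_of_real ((cmod (f x))\<^sup>2) / complex_of_real ((cmod (f x))\<^sup>2)"
      unfolding w_def m by (simp only: times_divide_eq_left cnj_mult_norm)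
    then show ?thesis using n0 by simp
  qed
  have nw: "cmod (w x) \<le> 1 / r" for x
  proof -
    have "cmod (w x) = cmod (f x) / (max r (cmod (f x)))\<^sup>2"
      by (simp add: w_def norm_divide norm_power)
    also have "\<dots> \<le> max r (cmod (f x)) / (max r (cmod (f x)))\<^sup>2" by (rule divide_right_mono) auto
    also have "\<dots> = 1 / max r (cmod (f x))" using m0[of x] by (simp add: power2_eq_square)
    also have "\<dots> \<le> 1 / r" using r0 by (intro divide_left_mono) auto
    finally show ?thesis .
  qed
  have "norm (\<iota>r \<psi>) \<le> (norm (\<iota> f) / r) ^ n" for n
  proof -
    have "complex_of_real (\<psi> x) = complex_of_real (\<psi> x) * w x ^ n * f x ^ n" for x
      using wf[of x] by (cases "\<psi> x = 0") (simp_all add: power_mult_distrib[symmetric] mult.assoc)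
    then have "\<iota>r \<psi> = \<iota> (\<lambda>x. (complex_of_real (\<psi> x) * w x ^ n) * f x ^ n)"
      by (intro arg_cong[where f=\<iota>] ext)
    also have "\<dots> = \<iota> (\<lambda>x. complex_of_real (\<psi> x) * w x ^ n) * \<iota> f ^ n"
      using f cw \<psi>(1) by (simp add: \<iota>_mult \<iota>_power continuous_on_mult continuous_on_power cont_of_real)
    finally have "norm (\<iota>r \<psi>) \<le> norm (\<iota> (\<lambda>x. complex_of_real (\<psi> x) * w x ^ n)) * norm (\<iota> f ^ n)"
      by (metis norm_mult_ineq)
    also have "\<dots> \<le> (1 / r) ^ n * norm (\<iota> f) ^ n"
    proof (rule mult_mono[OF _ norm_power_ineq])
      have "cmod (complex_of_real (\<psi> x) * w x ^ n) \<le> 1 * (1 / r) ^ n" for x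
        unfolding norm_mult norm_power using \<psi>(2,3)[of x] nw[of x] r0
        by (intro mult_mono power_mono) auto
      then show "norm (\<iota> (\<lambda>x. complex_of_real (\<psi> x) * w x ^ n)) \<le> (1 / r) ^ n"
        using cw \<psi>(1) by (intro \<iota>_contractive) (auto intro!: continuous_intros)
    qed (use r0 in auto)
    finally show ?thesis by (simp add: power_divide)
  qed
  moreover have "(\<lambda>n. (norm (\<iota> f) / r) ^ n) \<longlonglongrightarrow> 0"
    by (rule LIMSEQ_power_zero) (use r(1) r0 in simp)
  ultimately have "norm (\<iota>r \<psi>) \<le> 0"
    by (meson LIMSEQ_le_const)
  then have "(\<lambda>x. complex_of_real (\<psi> x)) = (\<lambda>_. 0)"
    using \<iota>_eq_0_iff[of "\<lambda>x. complex_of_real (\<psi> x)"] \<psi>(1) by (simp add: cont_of_real)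
  then show False using \<psi>(5)[of z] by (metis of_real_eq_0_iff singletonI zero_neq_one)
qed

text \<open>\<open>\<iota>\<close> is isometric for the supremum norm, so a convergent sequence of
  images comes from a uniformly Cauchy sequence of functions.\<close>

lemma closed_range_\<iota>: "closed (\<iota> ` Collect cont)"
  unfolding closed_sequential_limits
proof (intro allI impI)
  fix a l assume "(\<forall>n. a n \<in> \<iota> ` Collect cont) \<and> a \<longlonglongrightarrow> l"
  then have al: "\<And>n. a n \<in> \<iota> ` Collect cont" "a \<longlonglongrightarrow> l" by auto
  then have "\<forall>n. \<exists>f. cont f \<and> a n = \<iota> f" by blast
  then obtain f where f: "\<And>n. cont (f n)" "\<And>n. a n = \<iota> (f n)" by metis
  have le: "dist (f m x) (f n x) \<le> dist (a m) (a n)" for m n x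
    using \<iota>_norm_ge[of "\<lambda>x. f m x - f n x" x] f by (simp add: dist_norm \<iota>_diff continuous_on_diff)
  have "uniformly_Cauchy_on UNIV f"
    unfolding uniformly_Cauchy_on_def
    using LIMSEQ_imp_Cauchy[OF al(2)] le unfolding Cauchy_def by (meson le_less_trans)
  then obtain g where g: "uniform_limit UNIV f g sequentially"
    using Cauchy_uniformly_convergent uniformly_convergent_on_def by blast
  have cg: "cont g" by (rule uniform_limit_theorem[OF _ g]) (simp_all add: f)
  have "a \<longlonglongrightarrow> \<iota> g"
  proof (rule metric_LIMSEQ_I)
    fix e :: real assume e: "e > 0"
    from uniform_limitD[OF g, of "e / 2"] e obtain N where
      N: "\<And>n x. n \<ge> N \<Longrightarrow> dist (f n x) (g x) < e / 2"
      unfolding eventually_sequentially by auto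
    have "dist (a n) (\<iota> g) < e" if "n \<ge> N" for n
    proof -
      have "norm (\<iota> (\<lambda>x. f n x - g x)) \<le> e / 2"
        using N[OF that] f cg by (intro \<iota>_contractive continuous_on_diff) (auto simp: dist_norm intro: less_imp_le)
      then show ?thesis using e f cg by (simp add: dist_norm \<iota>_diff)
    qed
    then show "\<exists>N. \<forall>n\<ge>N. dist (a n) (\<iota> g) < e" by blast
  qed
  then have "l = \<iota> g" using al(2) LIMSEQ_unique by blast
  then show "l \<in> \<iota> ` Collect cont" using cg by blast
qed

lemma cstar_subalgebra_range_\<iota>: "cstar_subalgebra (\<iota> ` Collect cont)"
  unfolding cstar_subalgebra_def
proof (intro conjI ballI allI)
  show "0 \<in> \<iota> ` Collect cont" by (rule image_eqI[of _ _ "\<lambda>_. 0"]) auto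
  fix a assume "a \<in> \<iota> ` Collect cont"
  then obtain f where f: "cont f" "a = \<iota> f" by blast
  show "c *\<^sub>C a \<in> \<iota> ` Collect cont" for c
    by (rule image_eqI[of _ _ "\<lambda>x. c * f x"]) (use f in \<open>auto simp: \<iota>_scaleC intro: continuous_on_mult\<close>)
  show "star a \<in> \<iota> ` Collect cont"
    by (rule image_eqI[of _ _ "\<lambda>x. cnj (f x)"]) (use f in \<open>auto simp: \<iota>_star intro: continuous_on_cnj\<close>)
  fix b assume "b \<in> \<iota> ` Collect cont"
  then obtain g where g: "cont g" "b = \<iota> g" by blast
  show "a + b \<in> \<iota> ` Collect cont"
    by (rule image_eqI[of _ _ "\<lambda>x. f x + g x"]) (use f g in \<open>auto simp: \<iota>_add intro: continuous_on_add\<close>)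
  show "a * b \<in> \<iota> ` Collect cont"
    by (rule image_eqI[of _ _ "\<lambda>x. f x * g x"]) (use f g in \<open>auto simp: \<iota>_mult intro: continuous_on_mult\<close>)
qed (rule closed_range_\<iota>)

text \<open>For each nonzero \<open>n\<close> the disjoint closed sets \<open>Z\<close> and
  \<open>H n\<close> followed by its image of \<open>Z\<close> are separated by a function, giving a
  neighbourhood of \<open>Z\<close> disjoint from its translate. Only finitely many \<open>n\<close>
  can be handled at once: by minimality no nonempty open set is disjoint from all its
  translates.\<close>

lemma bump_disjoint_translates:
  assumes Z: "closed Z" "Z \<subseteq> V" "open V" and free: "\<And>n x. n \<noteq> 0 \<Longrightarrow> x \<in> Z \<Longrightarrow> H n x \<notin> Z"
  obtains e :: "'x \<Rightarrow> real" where "continuous_on UNIV e" "\<And>x. 0 \<le> e x" "\<And>x. e x \<le> 1"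
    "\<And>x. x \<notin> V \<Longrightarrow> e x = 0" "\<And>x. x \<in> Z \<Longrightarrow> e x = 1"
    "\<And>n x. n \<noteq> 0 \<Longrightarrow> \<bar>n\<bar> \<le> int K \<Longrightarrow> e x = 0 \<or> e (H n x) = 0"
proof -
  have "\<exists>N. open N \<and> Z \<subseteq> N \<and> (\<forall>x\<in>N. H n x \<notin> N)" if n: "n \<noteq> 0" for n
  proof -
    have "closed (H (- n) -` Z)" using Z(1) by (rule closed_H_vimage)
    then obtain f :: "'x \<Rightarrow> real" where f: "continuous_on UNIV f"
      "\<And>x. x \<in> H (- n) -` Z \<Longrightarrow> f x = 0" "\<And>x. x \<in> Z \<Longrightarrow> f x = 1"
      using urysohn[OF _ Z(1), of "H (- n) -` Z"] free[of "- n"] n by (metis (no_types, lifting) disjoint_iff neg_0_equal_iff_equal vimageE)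
    define N where "N = {x. f x > 1/2} \<inter> {x. f (H n x) < 1/2}"
    have "open N" unfolding N_def
      by (intro open_Int open_Collect_less continuous_intros f)
    moreover have "Z \<subseteq> N" using f(2,3) by (auto simp: N_def)
    moreover have "\<forall>x\<in>N. H n x \<notin> N" by (auto simp: N_def)
    ultimately show ?thesis by blast
  qed
  then obtain N where N: "\<And>n. n \<noteq> 0 \<Longrightarrow> open (N n) \<and> Z \<subseteq> N n \<and> (\<forall>x\<in>N n. H n x \<notin> N n)" by metis
  define W where "W = V \<inter> (\<Inter>n\<in>{- int K..int K} - {0}. N n)"
  have "open W" unfolding W_def using Z(3) N by (intro open_Int open_INT) auto
  then have cW: "closed (- W)" by (simp add: closed_Compl)
  have ZW: "Z \<subseteq> W" using Z(2) N by (auto simp: W_def)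
  obtain e :: "'x \<Rightarrow> real" where e: "continuous_on UNIV e" "\<And>x. 0 \<le> e x" "\<And>x. e x \<le> 1"
    "\<And>x. x \<in> - W \<Longrightarrow> e x = 0" "\<And>x. x \<in> Z \<Longrightarrow> e x = 1"
    by (rule urysohn[OF cW Z(1)]) (use ZW in auto)
  show ?thesis
  proof (rule that[of e])
    fix n x assume n: "n \<noteq> 0" "\<bar>n\<bar> \<le> int K"
    have "n \<in> {- int K..int K} - {0}" using n by auto
    then have WN: "W \<subseteq> N n" unfolding W_def by blast
    have "\<not> (x \<in> W \<and> H n x \<in> W)" using WN N[OF n(1)] by blast
    then show "e x = 0 \<or> e (H n x) = 0" using e(4) by auto
  qed (use e W_def in auto)
qed

end

section \<open>Finite sums\<close>

context minimal_crossed_product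
begin

text \<open>
  Coefficients stand to the right of the powers of \<open>u\<close>: in the orbit representation at \<open>z\<close>, the
  element \<open>W\<close> maps the base vector of \<open>\<ell>\<^sup>2(\<int>)\<close> to the vector \<open>m \<mapsto> w m z\<close>, whose squared norm is
  \<open>mass K w z\<close>.
\<close>

definition is_sum :: "nat \<Rightarrow> (int \<Rightarrow> 'x \<Rightarrow> complex) \<Rightarrow> 'a \<Rightarrow> bool"
  where "is_sum K w W \<longleftrightarrow> (\<forall>m. cont (w m)) \<and> (\<forall>m. \<bar>m\<bar> > int K \<longrightarrow> w m = (\<lambda>_. 0)) \<and>
    W = (\<Sum>m\<in>{- int K..int K}. U m * \<iota> (w m))"

definition mass :: "nat \<Rightarrow> (int \<Rightarrow> 'x \<Rightarrow> complex) \<Rightarrow> 'x \<Rightarrow> real"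
  where "mass K w z = (\<Sum>m\<in>{- int K..int K}. (cmod (w m z))\<^sup>2)"

lemma is_sumD:
  assumes "is_sum K w W"
  shows "cont (w m)" "\<bar>m\<bar> > int K \<Longrightarrow> w m = (\<lambda>_. 0)" "W = (\<Sum>m\<in>{- int K..int K}. U m * \<iota> (w m))"
  using assms unfolding is_sum_def by auto

lemma is_sum_superset:
  assumes "is_sum K w W" "finite F" "{- int K..int K} \<subseteq> F"
  shows "W = (\<Sum>m\<in>F. U m * \<iota> (w m))"
  unfolding is_sumD(3)[OF assms(1)]
  by (rule sum.mono_neutral_left[OF assms(2,3)])
    (use is_sumD(2)[OF assms(1)] in \<open>force simp: abs_le_iff not_le\<close>)

lemma mass_nonneg: "mass K w z \<ge> 0"
  unfolding mass_def by (intro sum_nonneg) auto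

lemma mass_continuous: "(\<And>m. cont (w m)) \<Longrightarrow> continuous_on UNIV (mass K w)"
  unfolding mass_def by (intro continuous_intros) auto

lemma is_sum_mono: "is_sum K w W \<Longrightarrow> K \<le> L \<Longrightarrow> is_sum L w W"
  using is_sum_superset[of K w W "{- int L..int L}"] unfolding is_sum_def by auto

lemma is_sum_add:
  assumes "is_sum K w W" "is_sum K v V"
  shows "is_sum K (\<lambda>m x. w m x + v m x) (W + V)"
  using assms unfolding is_sum_def
  by (auto simp: \<iota>_add algebra_simps sum.distrib intro: continuous_on_add)

lemma scaleC_sum_right: "c *\<^sub>C sum f F = (\<Sum>i\<in>F. c *\<^sub>C (f i :: 'a))"
  by (induction F rule: infinite_finite_induct) (simp_all add: scaleC_add_right)

lemma is_sum_scaleC: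
  assumes "is_sum K w W"
  shows "is_sum K (\<lambda>m x. c * w m x) (c *\<^sub>C W)"
  using assms unfolding is_sum_def
  by (auto simp: \<iota>_scaleC mult_scaleC_right scaleC_sum_right intro: continuous_on_mult)

lemma is_sum_\<iota>: "cont f \<Longrightarrow> is_sum 0 (\<lambda>m. if m = 0 then f else (\<lambda>_. 0)) (\<iota> f)"
  by (auto simp: is_sum_def)

text \<open>The shift \<open>H b x\<close> arises from moving a coefficient of the left factor past
  \<open>U b\<close>. At a point \<open>x\<close> the formula is a matrix acting on the vector of
  values \<open>q b x\<close>, so it sees the right factor only through these values.\<close>

definition prod_coeff ::
  "nat \<Rightarrow> (int \<Rightarrow> 'x \<Rightarrow> complex) \<Rightarrow> (int \<Rightarrow> 'x \<Rightarrow> complex) \<Rightarrow> int \<Rightarrow> 'x \<Rightarrow> complex"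
  where "prod_coeff L p q m x = (\<Sum>b\<in>{- int L..int L}. p (m - b) (H b x) * q b x)"

lemma is_sum_mult:
  assumes P: "is_sum K p P" and Q: "is_sum L q Q"
  shows "is_sum (K + L) (prod_coeff L p q) (P * Q)"
proof -
  let ?t = "\<lambda>b m x. p (m - b) (H b x) * q b x"
  have ct: "cont (?t b m)" for b m
    using is_sumD(1)[OF P, of "m - b"] is_sumD(1)[OF Q] by (intro continuous_intros)
  have z: "prod_coeff L p q m = (\<lambda>_. 0)" if m: "\<bar>m\<bar> > int (K + L)" for m
  proof -
    have "p (m - b) = (\<lambda>_. 0)" if "b \<in> {- int L..int L}" for b
      by (rule is_sumD(2)[OF P]) (use m that in auto)
    then show ?thesis by (simp add: prod_coeff_def fun_eq_iff)
  qed
  have summand: "P * (U b * \<iota> (q b)) = (\<Sum>m\<in>{- int (K + L)..int (K + L)}. U m * \<iota> (?t b m))"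
    if b: "b \<in> {- int L..int L}" for b
  proof -
    have "U a * \<iota> (p a) * (U b * \<iota> (q b)) = U (a + b) * \<iota> (?t b (a + b))" for a
    proof -
      have "U a * \<iota> (p a) * (U b * \<iota> (q b)) = U a * (\<iota> (p a) * U b) * \<iota> (q b)" by (simp add: mult.assoc)
      also have "\<dots> = U (a + b) * (\<iota> (\<lambda>x. p a (H b x)) * \<iota> (q b))"
        by (simp add: \<iota>_U[OF is_sumD(1)[OF P]] U_add mult.assoc)
      also have "\<iota> (\<lambda>x. p a (H b x)) * \<iota> (q b) = \<iota> (?t b (a + b))"
        using \<iota>_mult[of "\<lambda>x. p a (H b x)" "q b"] is_sumD(1)[OF P] is_sumD(1)[OF Q]
        by (simp add: continuous_on_H)
      finally show ?thesis .
    qed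
    then have "P * (U b * \<iota> (q b)) = (\<Sum>a\<in>{- int K..int K}. U (a + b) * \<iota> (?t b (a + b)))"
      unfolding is_sumD(3)[OF P] by (simp only: sum_distrib_right)
    also have "\<dots> = (\<Sum>m\<in>{- int K + b..int K + b}. U m * \<iota> (?t b m))"
      by (rule sum.reindex_bij_witness[of _ "\<lambda>m. m - b" "\<lambda>a. a + b"]) auto
    also have "\<dots> = (\<Sum>m\<in>{- int (K + L)..int (K + L)}. U m * \<iota> (?t b m))"
    proof (rule sum.mono_neutral_left)
      show "\<forall>m\<in>{- int (K + L)..int (K + L)} - {- int K + b..int K + b}. U m * \<iota> (?t b m) = 0"
      proof
        fix m assume "m \<in> {- int (K + L)..int (K + L)} - {- int K + b..int K + b}"
        then have "p (m - b) = (\<lambda>_. 0)" by (intro is_sumD(2)[OF P]) auto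
        then show "U m * \<iota> (?t b m) = 0" by simp
      qed
    qed (use b in auto)
    finally show ?thesis .
  qed
  have "P * Q = (\<Sum>b\<in>{- int L..int L}. P * (U b * \<iota> (q b)))"
    by (subst is_sumD(3)[OF Q]) (rule sum_distrib_left)
  also have "\<dots> = (\<Sum>b\<in>{- int L..int L}. \<Sum>m\<in>{- int (K + L)..int (K + L)}. U m * \<iota> (?t b m))"
    by (rule sum.cong[OF refl summand])
  also have "\<dots> = (\<Sum>m\<in>{- int (K + L)..int (K + L)}. \<Sum>b\<in>{- int L..int L}. U m * \<iota> (?t b m))"
    by (rule sum.swap)
  also have "\<dots> = (\<Sum>m\<in>{- int (K + L)..int (K + L)}. U m * \<iota> (prod_coeff L p q m))"
    unfolding prod_coeff_def by (subst \<iota>_sum) (simp_all add: ct sum_distrib_left)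
  finally show ?thesis
    unfolding is_sum_def using z ct by (auto simp: prod_coeff_def intro!: continuous_on_sum)
qed

lemma star_sum: "star (sum f F) = (\<Sum>i\<in>F. star (f i :: 'a))"
  by (induction F rule: infinite_finite_induct) (simp_all add: star_add)

lemma is_sum_star:
  assumes W: "is_sum K w W"
  shows "is_sum K (\<lambda>m x. cnj (w (- m) (H m x))) (star W)"
proof -
  have c: "cont (\<lambda>x. cnj (w m x))" for m using is_sumD(1)[OF W] by (rule continuous_on_cnj)
  have "star W = (\<Sum>m\<in>{- int K..int K}. \<iota> (\<lambda>x. cnj (w m x)) * U (- m))"
    by (subst is_sumD(3)[OF W]) (simp add: star_sum star_mult \<iota>_star is_sumD(1)[OF W])
  also have "\<dots> = (\<Sum>m\<in>{- int K..int K}. U (- m) * \<iota> (\<lambda>x. cnj (w m (H (- m) x))))"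
    by (simp add: \<iota>_U[OF c])
  also have "\<dots> = (\<Sum>m\<in>{- int K..int K}. U m * \<iota> (\<lambda>x. cnj (w (- m) (H m x))))"
    by (rule sum.reindex_bij_witness[of _ uminus uminus]) auto
  finally show ?thesis
    unfolding is_sum_def using is_sumD(2)[OF W] is_sumD(1)[OF W]
    by (auto intro!: continuous_on_cnj continuous_on_H)
qed

text \<open>A mixed term with indices \<open>l\<close> and \<open>m\<close> carries the factor
  \<open>e x * e (H (m - l) x)\<close>, which vanishes for distinct indices as their distance is at
  most 2K. This is the substitute for a conditional expectation.\<close>

lemma is_sum_compress:
  assumes W: "is_sum K w W" and e: "continuous_on UNIV e"
    and sep: "\<And>n x. n \<noteq> 0 \<Longrightarrow> \<bar>n\<bar> \<le> int (2 * K) \<Longrightarrow> e x = 0 \<or> e (H n x) = 0"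
  shows "star (W * \<iota>r e) * (W * \<iota>r e) = \<iota>r (\<lambda>x. (e x)\<^sup>2 * mass K w x)"
proof -
  let ?I = "{- int K..int K}"
  let ?w = "\<lambda>m x. w m x * complex_of_real (e x)"
  note cw = is_sumD(1)[OF W]
  have ce: "cont (\<lambda>x. complex_of_real (e x))" using e by (rule cont_of_real)
  have cwe: "cont (?w m)" for m by (intro continuous_on_mult cw ce)
  have cc: "cont (\<lambda>x. cnj (?w m x))" for m using cwe by (rule continuous_on_cnj)
  have We: "W * \<iota>r e = (\<Sum>m\<in>?I. U m * \<iota> (?w m))"
    by (subst is_sumD(3)[OF W]) (simp add: sum_distrib_right mult.assoc \<iota>_mult[OF cw ce])
  have sWe: "star (W * \<iota>r e) = (\<Sum>l\<in>?I. \<iota> (\<lambda>x. cnj (?w l x)) * U (- l))"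
    unfolding We star_sum star_mult star_U \<iota>_star[OF cwe] ..
  have prod: "(\<iota> (\<lambda>x. cnj (?w l x)) * U (- l)) * (U m * \<iota> (?w m)) =
      (if l = m then \<iota> (\<lambda>x. cnj (?w m x) * ?w m x) else 0)" if lm: "l \<in> ?I" "m \<in> ?I" for l m
  proof -
    have "(\<iota> (\<lambda>x. cnj (?w l x)) * U (- l)) * (U m * \<iota> (?w m)) =
        (\<iota> (\<lambda>x. cnj (?w l x)) * U (m - l)) * \<iota> (?w m)"
      using U_add[of "- l" m] by (simp add: mult.assoc)
    also have "\<dots> = U (m - l) * \<iota> (\<lambda>x. cnj (?w l (H (m - l) x)) * ?w m x)"
      using \<iota>_mult[OF continuous_on_H[OF cc[of l], of UNIV "m - l"] cwe[of m]]
      unfolding \<iota>_U[OF cc[of l]] by (simp only: mult.assoc)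
    also have "\<dots> = (if l = m then \<iota> (\<lambda>x. cnj (?w m x) * ?w m x) else 0)"
    proof (cases "l = m")
      case False
      then have "m - l \<noteq> 0" "\<bar>m - l\<bar> \<le> int (2 * K)" using lm by auto
      from sep[OF this] have "(\<lambda>x. cnj (?w l (H (m - l) x)) * ?w m x) = (\<lambda>_. 0)"
        by (auto simp: fun_eq_iff)
      then show ?thesis using False by (simp only: \<iota>_zero) simp
    qed simp
    finally show ?thesis .
  qed
  have "star (W * \<iota>r e) * (W * \<iota>r e) = (\<Sum>l\<in>?I. \<Sum>m\<in>?I. if l = m then \<iota> (\<lambda>x. cnj (?w m x) * ?w m x) else 0)"
    unfolding sWe by (subst We, subst sum_product) (intro sum.cong refl prod)
  also have "\<dots> = (\<Sum>m\<in>?I. \<iota> (\<lambda>x. cnj (?w m x) * ?w m x))" by (simp add: sum.delta)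
  also have "\<dots> = \<iota> (\<lambda>x. \<Sum>m\<in>?I. cnj (?w m x) * ?w m x)"
    by (rule \<iota>_sum[symmetric]) (intro continuous_on_mult cc cwe)
  also have "(\<lambda>x. \<Sum>m\<in>?I. cnj (?w m x) * ?w m x) = (\<lambda>x. complex_of_real ((e x)\<^sup>2 * mass K w x))"
    unfolding cnj_mult_norm norm_mult mass_def
    by (simp add: power_mult_distrib sum_distrib_left mult.commute)
  finally show ?thesis .
qed

text \<open>The triangle inequality over the 2K + 1 terms is wasteful, but a loss linear in
  \<open>K\<close> disappears once high powers are compared.\<close>

lemma is_sum_norm_le:
  assumes W: "is_sum K w W" and c: "c \<ge> 0" "\<And>z. mass K w z \<le> c\<^sup>2"
  shows "norm W \<le> (2 * real K + 1) * c"
proof -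
  have "norm (\<iota> (w m)) \<le> c" if m: "m \<in> {- int K..int K}" for m
  proof (rule \<iota>_contractive[OF is_sumD(1)[OF W]])
    fix z
    have "(cmod (w m z))\<^sup>2 \<le> mass K w z" unfolding mass_def by (rule member_le_sum) (use m in auto)
    with c(2)[of z] have "(cmod (w m z))\<^sup>2 \<le> c\<^sup>2" by simp
    then show "cmod (w m z) \<le> c" using c(1) by (rule power2_le_imp_le)
  qed
  then have "norm (U m * \<iota> (w m)) \<le> c" if "m \<in> {- int K..int K}" for m
    using that norm_mult_ineq[of "U m" "\<iota> (w m)"] by fastforce
  then have "norm W \<le> (\<Sum>m\<in>{- int K..int K}. c)"
    unfolding is_sumD(3)[OF W] by (rule sum_norm_le)
  then show ?thesis by simp
qed

text \<open>
  Otherwise the masses of the powers \<open>T\<^sup>n\<close> would be at most \<open>\<kappa>\<^sup>n\<close>, hence \<open>\<parallel>T\<parallel>\<^sup>n\<close> would grow at most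
  like \<open>n \<kappa>\<^sup>n\<^sup>/\<^sup>2\<close>. This step replaces the amenability of \<open>\<int>\<close>.
\<close>

lemma mass_growth:
  assumes T: "is_sum K p T" "star T = T" and \<kappa>: "0 \<le> \<kappa>" "\<kappa> < (norm T)\<^sup>2"
  obtains n w z where "is_sum (K * n) w (T ^ n)"
    "\<kappa> * mass (K * n) w z < mass (K + K * n) (prod_coeff (K * n) p w) z"
proof (rule ccontr)
  assume "\<not> thesis"
  then have le: "\<And>n w z. is_sum (K * n) w (T ^ n) \<Longrightarrow>
      mass (K + K * n) (prod_coeff (K * n) p w) z \<le> \<kappa> * mass (K * n) w z"
    using that not_le by blast
  have "\<exists>w. is_sum (K * n) w (T ^ n) \<and> (\<forall>z. mass (K * n) w z \<le> \<kappa> ^ n)" for n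
  proof (induction n)
    case 0
    show ?case
      using is_sum_\<iota>[of "\<lambda>_. 1"] by (auto simp: \<iota>_one mass_def intro!: exI)
  next
    case (Suc n)
    then obtain w where w: "is_sum (K * n) w (T ^ n)" "\<And>z. mass (K * n) w z \<le> \<kappa> ^ n" by blast
    have "mass (K + K * n) (prod_coeff (K * n) p w) z \<le> \<kappa> * \<kappa> ^ n" for z
      using le[OF w(1), of z] mult_left_mono[OF w(2)[of z] \<kappa>(1)] by linarith
    then show ?case using is_sum_mult[OF T(1) w(1)] by auto
  qed
  then have bound: "norm T ^ n \<le> (2 * real (K * n) + 1) * sqrt \<kappa> ^ n" for n
  proof -
    assume "\<And>n. \<exists>w. is_sum (K * n) w (T ^ n) \<and> (\<forall>z. mass (K * n) w z \<le> \<kappa> ^ n)"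
    then obtain w where w: "is_sum (K * n) w (T ^ n)" "\<And>z. mass (K * n) w z \<le> \<kappa> ^ n" by blast
    have "(sqrt \<kappa> ^ n)\<^sup>2 = \<kappa> ^ n" using \<kappa>(1) by (simp add: power2_eq_square flip: power_mult_distrib)
    then have "norm (T ^ n) \<le> (2 * real (K * n) + 1) * sqrt \<kappa> ^ n"
      using is_sum_norm_le[OF w(1), of "sqrt \<kappa> ^ n"] w(2) \<kappa>(1) by simp
    then show ?thesis by (simp add: norm_power_sa[OF T(2)])
  qed
  have nT: "norm T > 0" using \<kappa> by (metis zero_less_norm_iff norm_zero power2_eq_square mult_zero_left not_less)
  define r where "r = sqrt \<kappa> / norm T"
  have "sqrt \<kappa> < norm T" using \<kappa> nT by (simp add: real_less_lsqrt)
  then have r: "0 \<le> r" "r < 1" using nT \<kappa> by (simp_all add: r_def)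
  have "1 \<le> (2 * real K) * (real n * r ^ n) + r ^ n" for n
  proof -
    have "1 = norm T ^ n / norm T ^ n" using nT by simp
    also have "\<dots> \<le> (2 * real (K * n) + 1) * sqrt \<kappa> ^ n / norm T ^ n"
      by (rule divide_right_mono[OF bound]) simp
    also have "\<dots> = (2 * real K) * (real n * r ^ n) + r ^ n" by (simp add: r_def power_divide add_divide_distrib algebra_simps)
    finally show ?thesis .
  qed
  moreover have "(\<lambda>n. (2 * real K) * (real n * r ^ n) + r ^ n) \<longlonglongrightarrow> (2 * real K) * 0 + 0"
    using r by (intro tendsto_intros powser_times_n_limit_0 LIMSEQ_power_zero) auto
  ultimately have "1 \<le> (2 * real K) * 0 + (0::real)" by (meson LIMSEQ_le_const)
  then show False by simp
qed

text \<open>The approximating sums must lie in \<open>B\<close> itself, because their powers become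
  conjugating elements for Cuntz subequivalence in \<open>B\<close>.\<close>

definition approximable :: "'a set \<Rightarrow> bool"
  where "approximable B \<longleftrightarrow> (\<forall>b\<in>B. \<forall>e>0. \<exists>T\<in>B. \<exists>K w. is_sum K w T \<and> norm (T - b) < e)"

lemma approximable_sa:
  assumes B: "cstar_subalgebra B" "approximable B" and b: "b \<in> B" "star b = b" and e: "e > 0"
  obtains T K p where "T \<in> B" "star T = T" "is_sum K p T" "norm (T - b) < e"
proof -
  from B(2) b(1) e obtain T K w where T: "T \<in> B" "is_sum K w T" "norm (T - b) < e"
    unfolding approximable_def by blast
  let ?c = "complex_of_real (1/2)"
  let ?T = "?c *\<^sub>C (T + star T)"
  have "(1/2) *\<^sub>R ((T - b) + star (T - b)) = (1/2) *\<^sub>R (T + star T) - (1/2) *\<^sub>R (2 *\<^sub>R b)"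
    by (simp only: star_diff b(2) scaleR_2 scaleR_diff_right[symmetric]) (simp add: algebra_simps)
  then have "?T - b = (1/2) *\<^sub>R ((T - b) + star (T - b))"
    unfolding scaleC_of_real by simp
  then have "norm (?T - b) \<le> (1/2) * (norm (T - b) + norm (star (T - b)))"
    by (metis norm_triangle_ineq norm_scaleR abs_of_nonneg mult_left_mono zero_le_divide_1_iff zero_le_numeral)
  then have "norm (?T - b) < e" using T(3) by (simp only: norm_star) simp
  moreover have "star ?T = ?T" by (simp add: star_scaleC star_add star_star add.commute)
  moreover have "?T \<in> B" by (intro cstar_subalgebraD[OF B(1)] T(1))
  ultimately show ?thesis
    using that is_sum_scaleC[OF is_sum_add[OF T(2) is_sum_star[OF T(2)]]] by blast
qed

section \<open>Functions below positive elements\<close>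

lemma cuntz_subeq_conj:
  assumes "cuntz_subeq B a (star d * x * d)" "cstar_subalgebra B" "d \<in> B"
  shows "cuntz_subeq B a x"
proof -
  from assms(1) obtain v where v: "\<And>n. v n \<in> B" "(\<lambda>n. v n * (star d * x * d) * star (v n)) \<longlonglongrightarrow> a"
    unfolding cuntz_subeq_def by blast
  have "v n * star d \<in> B" for n by (intro cstar_subalgebraD(4,5)[OF assms(2)] v assms(3))
  moreover have "(\<lambda>n. (v n * star d) * x * star (v n * star d)) \<longlonglongrightarrow> a"
    using v(2) by (simp add: star_mult star_star mult.assoc)
  ultimately show ?thesis unfolding cuntz_subeq_def by (intro exI[of _ "\<lambda>n. v n * star d"]) blast
qed

lemma cuntz_subeq_conj_left:
  assumes "cuntz_subeq B a x" "cstar_subalgebra B" "d \<in> B"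
  shows "cuntz_subeq B (d * a * star d) x"
proof -
  from assms(1) obtain v where v: "\<And>n. v n \<in> B" "(\<lambda>n. v n * x * star (v n)) \<longlonglongrightarrow> a"
    unfolding cuntz_subeq_def by blast
  have "(\<lambda>n. d * (v n * x * star (v n)) * star d) \<longlonglongrightarrow> d * a * star d"
    by (intro tendsto_intros v)
  then have "(\<lambda>n. (d * v n) * x * star (d * v n)) \<longlonglongrightarrow> d * a * star d"
    by (simp add: star_mult mult.assoc)
  moreover have "d * v n \<in> B" for n by (intro cstar_subalgebraD(4)[OF assms(2)] v assms(3))
  ultimately show ?thesis unfolding cuntz_subeq_def by (intro exI[of _ "\<lambda>n. d * v n"]) blast
qed

lemma bump_at:
  assumes "open V" "z \<in> V"
  obtains e :: "'x \<Rightarrow> real" where "continuous_on UNIV e" "\<And>x. x \<notin> V \<Longrightarrow> e x = 0" "e z = 1"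
    "\<And>n x. n \<noteq> 0 \<Longrightarrow> \<bar>n\<bar> \<le> int K \<Longrightarrow> e x = 0 \<or> e (H n x) = 0"
proof -
  obtain e :: "'x \<Rightarrow> real" where "continuous_on UNIV e" "\<And>x. 0 \<le> e x" "\<And>x. e x \<le> 1"
    "\<And>x. x \<notin> V \<Longrightarrow> e x = 0" "\<And>x. x \<in> {z} \<Longrightarrow> e x = 1"
    "\<And>n x. n \<noteq> 0 \<Longrightarrow> \<bar>n\<bar> \<le> int K \<Longrightarrow> e x = 0 \<or> e (H n x) = 0"
    by (rule bump_disjoint_translates[of "{z}" V K]) (use assms H_free in auto)
  then show ?thesis by (intro that[of e]) auto
qed

text \<open>The function is \<open>\<phi>\<close>, which represents
  \<open>star D * (T * T) * D\<close>. The bump \<open>e\<close> is supported where the growth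
  inequality persists, so \<phi> \<ge> \<kappa> \<theta> with \<theta> representing
  \<open>star D * D\<close>; together with the error bound on \<open>T * T - x\<close> this gives
  \<phi> \<le> 2 \<open>star D * x * D\<close>.\<close>

lemma function_cuntz_below:
  assumes B: "cstar_subalgebra B" "\<And>f. cont f \<Longrightarrow> \<iota> f \<in> B" "approximable B"
    and x: "x \<in> B" "norm_positive x" "x \<noteq> 0"
  obtains f z where "continuous_on UNIV f" "\<And>y. f y \<ge> 0" "f z > 0" "cuntz_subeq B (\<iota>r f) x"
proof -
  have B1: "1 \<in> B" using B(2)[of "\<lambda>_. 1"] by (simp add: \<iota>_one)
  obtain s where s: "star s = s" "s * s = x"
    and sB: "\<And>B. cstar_subalgebra B \<Longrightarrow> 1 \<in> B \<Longrightarrow> x \<in> B \<Longrightarrow> s \<in> B"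
    by (rule norm_positive_sqrt[OF x(2)]) (rule that; assumption)
  define t where "t = norm s"
  have t: "t > 0" using s(2) x(3) by (auto simp: t_def)
  \<comment> \<open>The fraction 1/16 is small enough for (15/16)^2 > 1/2, so that \<kappa> stays
    below the squared norm of \<open>T\<close>, and for 17/256 + 1/16 \<le> 1/4, which is the bound
    \<kappa>/2 on the error \<open>k\<close>.\<close>
  have "t / 16 > 0" using t by simp
  then obtain T K p where T: "T \<in> B" "star T = T" "is_sum K p T" "norm (T - s) < t / 16"
    using approximable_sa[OF B(1,3) sB[OF B(1) B1 x(1)] s(1)] by blast
  define \<kappa> where "\<kappa> = t\<^sup>2 / 2"
  have \<kappa>: "\<kappa> > 0" using t by (simp add: \<kappa>_def)
  have nT: "15 / 16 * t \<le> norm T" "norm T \<le> 17 / 16 * t"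
    using T(4) norm_triangle_ineq2[of s T] norm_triangle_ineq2[of T s]
    by (simp_all add: t_def norm_minus_commute)
  have "(15 / 16 * t)\<^sup>2 \<le> (norm T)\<^sup>2" using nT(1) t by (intro power_mono) auto
  moreover have "\<kappa> < (15 / 16 * t)\<^sup>2" using t by (simp add: \<kappa>_def power_mult_distrib power_divide)
  ultimately have \<kappa>T: "\<kappa> < (norm T)\<^sup>2" by simp
  define k where "k = T * T - x"
  have nk: "norm k \<le> \<kappa> / 2"
  proof -
    have "k = T * (T - s) + (T - s) * s" by (simp add: k_def s(2)[symmetric] algebra_simps)
    then have "norm k \<le> norm T * norm (T - s) + norm (T - s) * norm s"
      by (metis norm_triangle_le add_mono norm_mult_ineq)
    also have "\<dots> \<le> (17 / 16 * t) * (t / 16) + (t / 16) * t"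
      using nT T(4) t by (intro add_mono mult_mono) (auto simp: t_def)
    also have "\<dots> \<le> \<kappa> / 2" by (simp add: \<kappa>_def power2_eq_square)
    finally show ?thesis .
  qed
  obtain n v z where v: "is_sum (K * n) v (T ^ n)"
    and z: "\<kappa> * mass (K * n) v z < mass (K + K * n) (prod_coeff (K * n) p v) z"
    using mass_growth[OF T(3,2) _ \<kappa>T] \<kappa> by auto
  let ?w = "prod_coeff (K * n) p v"
  let ?L = "K + K * n"
  have w: "is_sum ?L ?w (T * T ^ n)" by (rule is_sum_mult[OF T(3) v])
  have cm: "continuous_on UNIV (mass (K * n) v)" "continuous_on UNIV (mass ?L ?w)"
    by (intro mass_continuous is_sumD(1)[OF v] is_sumD(1)[OF w])+
  let ?V = "{x. \<kappa> * mass (K * n) v x < mass ?L ?w x}"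
  have V: "open ?V" by (intro open_Collect_less continuous_intros cm)
  have zV: "z \<in> ?V" using z by simp
  obtain e :: "'x \<Rightarrow> real" where e: "continuous_on UNIV e" "\<And>x. x \<notin> ?V \<Longrightarrow> e x = 0" "e z = 1"
    and sep: "\<And>j x. j \<noteq> 0 \<Longrightarrow> \<bar>j\<bar> \<le> int (2 * ?L) \<Longrightarrow> e x = 0 \<or> e (H j x) = 0"
    by (rule bump_at[OF V zV, of "2 * ?L"]) (rule that; assumption)
  define D where "D = T ^ n * \<iota>r e"
  define \<phi> where "\<phi> x = (e x)\<^sup>2 * mass ?L ?w x" for x
  define \<theta> where "\<theta> x = (e x)\<^sup>2 * mass (K * n) v x" for x
  have c\<phi>: "continuous_on UNIV \<phi>" and c\<theta>: "continuous_on UNIV \<theta>"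
    unfolding \<phi>_def \<theta>_def by (intro continuous_intros e cm)+
  have \<phi>0: "\<phi> x \<ge> 0" for x by (simp add: \<phi>_def mass_nonneg)
  have DD: "star D * D = \<iota>r \<theta>"
    unfolding D_def \<theta>_def by (rule is_sum_compress[OF v e(1)]) (rule sep, auto)
  have TD: "star D * (T * T) * D = \<iota>r \<phi>"
    using is_sum_compress[OF w e(1) sep]
    unfolding \<phi>_def D_def by (simp add: star_mult T(2) mult.assoc)
  have eB: "\<iota>r e \<in> B" using e(1) by (intro B(2) cont_of_real)
  have DB: "D \<in> B" unfolding D_def
    by (intro cstar_subalgebraD(4)[OF B(1)] cstar_subalgebra_power B(1) B1 T(1) eB)
  have sx: "star x = x" by (rule norm_positive_sa[OF x(2)])
  have sk: "star k = k" by (simp add: k_def star_mult T(2) sx)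
  have "norm_positive ((norm k *\<^sub>R 1 - k) + (\<kappa> / 2 - norm k) *\<^sub>R 1)"
    by (intro norm_positive_add norm_positive_norm_minus sk norm_positive_of_real) (use nk in simp)
  then have "norm_positive ((\<kappa> / 2) *\<^sub>R 1 - k)" by (simp add: algebra_simps)
  then obtain q where q: "star q = q" "q * q = (\<kappa> / 2) *\<^sub>R 1 - k" by (rule norm_positive_sqrt)
  \<comment> \<open>The first summand equals \<kappa> \<theta> - 2 \<phi> + 2
    \<open>star D * x * D\<close>; adding the nonnegative function \<phi> - \<kappa> \<theta>
    cancels \<theta>.\<close>
  have "norm_positive (2 *\<^sub>R (star (q * D) * (q * D)) + \<iota>r (\<lambda>x. \<phi> x - \<kappa> * \<theta> x))"
  proof (intro norm_positive_add norm_positive_scaleR norm_positive_star_mult_self norm_positive_\<iota>r)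
    show "continuous_on UNIV (\<lambda>x. \<phi> x - \<kappa> * \<theta> x)" by (intro continuous_intros c\<phi> c\<theta>)
    fix x
    show "0 \<le> \<phi> x - \<kappa> * \<theta> x"
    proof (cases "x \<in> ?V")
      case True
      then have "(e x)\<^sup>2 * (\<kappa> * mass (K * n) v x) \<le> (e x)\<^sup>2 * mass ?L ?w x"
        by (intro mult_left_mono) auto
      then show ?thesis by (simp add: \<phi>_def \<theta>_def algebra_simps)
    qed (simp add: \<phi>_def \<theta>_def e(2))
  qed simp
  also have "2 *\<^sub>R (star (q * D) * (q * D)) + \<iota>r (\<lambda>x. \<phi> x - \<kappa> * \<theta> x) =
      2 *\<^sub>R (star D * x * D) - \<iota>r \<phi>"
  proof -
    have "star (q * D) * (q * D) = star D * (q * q) * D" by (simp add: star_mult q(1) mult.assoc)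
    also have "\<dots> = (\<kappa> / 2) *\<^sub>R (star D * D) - star D * (T * T) * D + star D * x * D"
      unfolding q(2) by (simp add: k_def algebra_simps)
    finally have "2 *\<^sub>R (star (q * D) * (q * D)) = \<kappa> *\<^sub>R \<iota>r \<theta> - 2 *\<^sub>R \<iota>r \<phi> + 2 *\<^sub>R (star D * x * D)"
      unfolding DD TD by (simp only: scaleR_add_right scaleR_diff_right scaleR_scaleR) simp
    moreover have "\<iota>r (\<lambda>x. \<phi> x - \<kappa> * \<theta> x) = \<iota>r \<phi> - \<kappa> *\<^sub>R \<iota>r \<theta>"
      using c\<phi> c\<theta> by (subst \<iota>r_diff) (auto intro!: continuous_intros simp only: \<iota>r_scaleR)
    ultimately show ?thesis by (simp add: scaleR_2)
  qed
  finally have pos: "norm_positive (2 *\<^sub>R (star D * x * D) - \<iota>r \<phi>)" .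
  let ?\<psi> = "\<iota>r (\<lambda>x. sqrt (\<phi> x))"
  have c\<psi>: "continuous_on UNIV (\<lambda>x. sqrt (\<phi> x))" by (intro continuous_intros c\<phi>)
  have \<psi>\<psi>: "?\<psi> * ?\<psi> = \<iota>r \<phi>" by (rule \<iota>r_square_sqrt[OF c\<phi> \<phi>0])
  have "cuntz_subeq B (?\<psi> * star ?\<psi>) (star D * x * D)"
  proof (rule cuntz_subeq_if_dominated[where \<kappa>=2])
    show "star D * x * D \<in> B" by (intro cstar_subalgebraD(4,5)[OF B(1)] DB x(1))
    show "?\<psi> \<in> B" using c\<psi> by (intro B(2) cont_of_real)
    have "star D * x * D = star (s * D) * (s * D)" by (simp add: star_mult s mult.assoc flip: s(2))
    then show "norm_positive (star D * x * D)" by (simp add: norm_positive_star_mult_self)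
    show "norm_positive (2 *\<^sub>R (star D * x * D) - star ?\<psi> * ?\<psi>)" using pos c\<psi> \<psi>\<psi> by simp
  qed (use B(1) B1 in auto)
  then have "cuntz_subeq B (\<iota>r \<phi>) x"
    using cuntz_subeq_conj[OF _ B(1) DB] c\<psi> \<psi>\<psi> by simp
  moreover have "\<phi> z > 0"
  proof -
    have "0 \<le> \<kappa> * mass (K * n) v z" using \<kappa> by (simp add: mass_nonneg)
    then show ?thesis using z e(3) by (simp add: \<phi>_def)
  qed
  ultimately show ?thesis using that[of \<phi> z] c\<phi> \<phi>0 by blast
qed

text \<open>An orbit meets \<open>Y\<close> at most once. If this happens within the window, follow
  the orbit beyond it and wait for the next visit to \<open>V\<close>.\<close>

lemma avoid_translates:
  assumes V: "open V" "z \<in> V"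
  obtains z' where "z' \<in> V" "\<And>j. \<bar>j\<bar> \<le> int J \<Longrightarrow> H j z' \<notin> Y"
proof (cases "\<exists>j. \<bar>j\<bar> \<le> int J \<and> H j z \<in> Y")
  case False
  then show ?thesis using V that by blast
next
  case True
  then obtain j where j: "\<bar>j\<bar> \<le> int J" "H j z \<in> Y" by blast
  obtain L where L: "\<And>x. \<exists>i<L. H (int i) x \<in> V" using uniform_return[of V] V by blast
  \<comment> \<open>After a shift by at least 2J + 1, the window of radius J lies entirely after
    time J, hence after \<open>j\<close>.\<close>
  let ?s = "2 * int J + 1"
  obtain i where i: "H (int i) (H ?s z) \<in> V" using L by blast
  let ?z = "H (int i + ?s) z"
  show ?thesis
  proof (rule that[of ?z])
    show "?z \<in> V" using i by (simp only: H_add)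
    fix l :: int assume l: "\<bar>l\<bar> \<le> int J"
    show "H l ?z \<notin> Y"
    proof
      assume "H l ?z \<in> Y"
      then have "H (- (- (l + (int i + ?s)))) z \<in> Y" by (simp only: H_add minus_minus)
      moreover have "H (- (- j)) z \<in> Y" using j by simp
      ultimately have "l + (int i + ?s) = j" using H_Y_disjoint by fastforce
      then show False using j l by linarith
    qed
  qed
qed

text \<open>The vector that \<open>T\<close> stretches by almost its norm lives on the finite orbit
  segment \<open>P\<close>. If \<open>g\<close> vanishes on \<open>P\<close>, then
  \<open>1 - g\<close> fixes this vector, so \<open>T * (1 - \<iota>r g)\<close> still has norm
  close to 1. As \<open>P\<close> is chosen before \<open>g\<close>, the function is free to equal 1
  on the translates of \<open>Y\<close>.\<close>

lemma norm_cut: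
  assumes A: "approximable UNIV" and x: "norm_positive x" "norm x = 1" and \<epsilon>: "\<epsilon> > 0"
  obtains P where "finite P" "\<And>n. \<bar>n\<bar> \<le> int N \<Longrightarrow> P \<inter> H n ` Y = {}"
    "\<And>g. continuous_on UNIV g \<Longrightarrow> (\<And>y. 0 \<le> g y) \<Longrightarrow> (\<And>y. g y \<le> 1) \<Longrightarrow>
      (\<And>y. y \<in> P \<Longrightarrow> g y = 0) \<Longrightarrow> 1 - \<epsilon> < norm ((1 - \<iota>r g) * x * (1 - \<iota>r g))"
proof -
  have UNIV: "cstar_subalgebra (UNIV :: 'a set)" by (simp add: cstar_subalgebra_def)
  obtain s where s: "star s = s" "s * s = x"
    by (rule norm_positive_sqrt[OF x(1)])
  have ns: "norm s = 1"
    using norm_square_sa[OF s(1)] x(2) s(2) power2_eq_iff_nonneg[of "norm s" 1] by simp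
  \<comment> \<open>One \<rho> is lost from \<open>norm T\<close> and one from replacing
    \<open>T\<close> by \<open>s\<close>; squaring gives at least 1 - 4 \<rho> \<ge> 1 -
    \<epsilon>/2. The bound 1/4 keeps the squared quantities nonnegative.\<close>
  define \<rho> where "\<rho> = min (\<epsilon> / 8) (1 / 4)"
  have \<rho>: "\<rho> > 0" "\<rho> \<le> \<epsilon> / 8" "\<rho> \<le> 1 / 4" using \<epsilon> by (auto simp: \<rho>_def)
  obtain T K p where T: "star T = T" "is_sum K p T" "norm (T - s) < \<rho>"
    using approximable_sa[OF UNIV A _ s(1) \<rho>(1)] by blast
  have nT: "1 - \<rho> < norm T" using T(3) norm_triangle_ineq2[of s T] ns by (simp add: norm_minus_commute)
  define \<kappa> where "\<kappa> = (1 - \<rho>)\<^sup>2"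
  have \<kappa>: "\<kappa> \<ge> 0" "\<kappa> < (norm T)\<^sup>2" using nT \<rho> by (auto simp: \<kappa>_def intro: power_strict_mono)
  obtain n v z where v: "is_sum (K * n) v (T ^ n)"
    and z: "\<kappa> * mass (K * n) v z < mass (K + K * n) (prod_coeff (K * n) p v) z"
    using mass_growth[OF T(2,1) \<kappa>] by auto
  let ?w = "prod_coeff (K * n) p v"
  let ?L = "K + K * n"
  have cv: "continuous_on UNIV (mass (K * n) v)" by (intro mass_continuous is_sumD(1)[OF v])
  have "open {x. \<kappa> * mass (K * n) v x < mass ?L ?w x}"
    by (intro open_Collect_less continuous_intros cv mass_continuous is_sumD(1)[OF is_sum_mult[OF T(2) v]])
  \<comment> \<open>\<open>H b z'\<close> lies in the translate of \<open>Y\<close> by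
    \<open>n'\<close> iff \<open>H (b - n') z'\<close> lies in \<open>Y\<close>; hence the radius
    \<open>N + K * n\<close>.\<close>
  then obtain z' where z': "\<kappa> * mass (K * n) v z' < mass ?L ?w z'"
    and avoid: "\<And>j. \<bar>j\<bar> \<le> int (N + K * n) \<Longrightarrow> H j z' \<notin> Y"
    using avoid_translates[of "{x. \<kappa> * mass (K * n) v x < mass ?L ?w x}" z "N + K * n"] z by auto
  define P where "P = (\<lambda>b. H b z') ` {- int (K * n)..int (K * n)}"
  show ?thesis
  proof (rule that[of P])
    show "finite P" by (simp add: P_def)
    fix n' assume n': "\<bar>n'\<bar> \<le> int N"
    have "H b z' \<notin> H n' ` Y" if "b \<in> {- int (K * n)..int (K * n)}" for b
    proof -
      have "\<bar>- n' + b\<bar> \<le> int (N + K * n)" using n' that by auto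
      from avoid[OF this] show ?thesis by (simp only: mem_H_image H_add) simp
    qed
    then show "P \<inter> H n' ` Y = {}" unfolding P_def by blast
  next
    fix g assume g: "continuous_on UNIV g" "\<And>y. y \<in> P \<Longrightarrow> g y = (0::real)"
      and g01: "\<And>y. 0 \<le> g y" "\<And>y. g y \<le> 1"
    let ?g = "\<lambda>x. complex_of_real (1 - g x)"
    have cg: "cont ?g" by (intro continuous_intros g)
    have ig: "1 - \<iota>r g = \<iota> ?g" using \<iota>r_diff[of "\<lambda>_. 1" g] g by (simp add: \<iota>_one)
    have sg: "star (1 - \<iota>r g) = 1 - \<iota>r g" using g by simp
    let ?d = "prod_coeff (K * n) (\<lambda>m. if m = 0 then ?g else (\<lambda>_. 0)) v"
    have d: "is_sum (K * n) ?d ((1 - \<iota>r g) * T ^ n)"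
      using is_sum_mult[OF is_sum_\<iota>[OF cg] v] by (simp add: ig)
    have dz: "?d m z' = v m z'" if m: "m \<in> {- int (K * n)..int (K * n)}" for m
    proof -
      have "?d m z' = (\<Sum>b\<in>{- int (K * n)..int (K * n)}. if b = m then ?g (H m z') * v m z' else 0)"
        unfolding prod_coeff_def by (rule sum.cong) auto
      also have "\<dots> = ?g (H m z') * v m z'" using m by (simp add: sum.delta)
      also have "g (H m z') = 0" using m by (intro g(2)) (auto simp: P_def)
      finally show ?thesis by simp
    qed
    let ?c = "prod_coeff (K * n) p ?d"
    have c: "is_sum ?L ?c (T * ((1 - \<iota>r g) * T ^ n))" by (rule is_sum_mult[OF T(2) d])
    \<comment> \<open>Agreement is available at \<open>z'\<close>, not in a neighbourhood, so the
      open set for the bump is formed anew from \<open>?c\<close>.\<close>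
    have "?c m z' = ?w m z'" for m
      unfolding prod_coeff_def[of "K * n" p] by (rule sum.cong) (simp_all add: dz)
    then have mz: "mass ?L ?c z' = mass ?L ?w z'" by (simp add: mass_def)
    have cc: "continuous_on UNIV (mass ?L ?c)" by (intro mass_continuous is_sumD(1)[OF c])
    let ?V = "{x. \<kappa> * mass (K * n) v x < mass ?L ?c x}"
    have V: "open ?V" by (intro open_Collect_less continuous_intros cv cc)
    have zV: "z' \<in> ?V" using z' mz by simp
    obtain e :: "'x \<Rightarrow> real" where e: "continuous_on UNIV e" "\<And>x. x \<notin> ?V \<Longrightarrow> e x = 0" "e z' = 1"
      and sep: "\<And>j x. j \<noteq> 0 \<Longrightarrow> \<bar>j\<bar> \<le> int (2 * ?L) \<Longrightarrow> e x = 0 \<or> e (H j x) = 0"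
      by (rule bump_at[OF V zV, of "2 * ?L"]) (rule that; assumption)
    define D where "D = T ^ n * \<iota>r e"
    let ?S = "T * (1 - \<iota>r g)"
    let ?\<phi> = "\<lambda>x. (e x)\<^sup>2 * mass ?L ?c x" and ?\<theta> = "\<lambda>x. (e x)\<^sup>2 * mass (K * n) v x"
    have c\<phi>: "continuous_on UNIV ?\<phi>" and c\<theta>: "continuous_on UNIV ?\<theta>"
      by (intro continuous_intros e cc cv)+
    have "star D * D = \<iota>r ?\<theta>"
      unfolding D_def by (rule is_sum_compress[OF v e(1)]) (rule sep, auto)
    then have nD: "(norm D)\<^sup>2 = norm (\<iota>r ?\<theta>)" by (metis cstar_identity)
    have "star (?S * D) * (?S * D) = \<iota>r ?\<phi>"
      using is_sum_compress[OF c e(1) sep] by (simp add: D_def mult.assoc)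
    then have nSD: "(norm (?S * D))\<^sup>2 = norm (\<iota>r ?\<phi>)" by (metis cstar_identity)
    \<comment> \<open>Since \<open>\<iota>\<close> preserves the supremum norm, the pointwise
      inequality passes to the norms of \<open>D\<close> and \<open>?S * D\<close>.\<close>
    have "norm (\<iota>r (\<lambda>x. \<kappa> * ?\<theta> x)) \<le> norm (\<iota>r ?\<phi>)"
    proof (rule \<iota>_contractive)
      show "cont (\<lambda>x. complex_of_real (\<kappa> * ?\<theta> x))"
        by (intro cont_of_real continuous_on_mult_left c\<theta>)
      fix x
      have "0 \<le> \<kappa> * ?\<theta> x" using \<kappa>(1) by (intro mult_nonneg_nonneg mass_nonneg) auto
      moreover have "\<kappa> * ?\<theta> x \<le> ?\<phi> x"
      proof (cases "x \<in> ?V")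
        case True
        then have "(e x)\<^sup>2 * (\<kappa> * mass (K * n) v x) \<le> (e x)\<^sup>2 * mass ?L ?c x"
          by (intro mult_left_mono) auto
        then show ?thesis by (simp add: algebra_simps)
      qed (simp add: e(2))
      moreover have "\<bar>?\<phi> x\<bar> \<le> norm (\<iota>r ?\<phi>)"
        using \<iota>_norm_ge[OF cont_of_real[OF c\<phi>], of x] by (simp only: norm_of_real)
      ultimately show "cmod (complex_of_real (\<kappa> * ?\<theta> x)) \<le> norm (\<iota>r ?\<phi>)"
        by (simp only: norm_of_real)
    qed
    then have le: "\<kappa> * (norm D)\<^sup>2 \<le> (norm (?S * D))\<^sup>2"
      using \<kappa>(1) unfolding nD nSD \<iota>r_scaleR[OF c\<theta>] by simp
    have "?\<phi> z' > 0"
    proof -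
      have "0 \<le> \<kappa> * mass (K * n) v z'" using \<kappa> by (simp add: mass_nonneg)
      then show ?thesis using z' mz e(3) by simp
    qed
    then have "norm (\<iota>r ?\<phi>) > 0"
      using \<iota>_norm_ge[OF cont_of_real[OF c\<phi>], of z'] by (simp only: norm_of_real)
    then have "D \<noteq> 0" using nSD by auto
    then have D0: "(norm D)\<^sup>2 > 0" by simp
    have "(norm (?S * D))\<^sup>2 \<le> (norm ?S)\<^sup>2 * (norm D)\<^sup>2"
      by (metis norm_mult_ineq norm_ge_zero power_mono power_mult_distrib)
    with le D0 have "\<kappa> \<le> (norm ?S)\<^sup>2" by (meson mult_le_cancel_right_pos order_trans)
    then have nS: "1 - \<rho> \<le> norm ?S" unfolding \<kappa>_def by (rule power2_le_imp_le) simp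
    have "norm (1 - \<iota>r g) \<le> 1"
      unfolding ig by (rule \<iota>_contractive[OF cg]) (use g01 in \<open>simp only: norm_of_real, simp\<close>)
    then have "norm (T - s) * norm (1 - \<iota>r g) \<le> \<rho> * 1" using T(3) \<rho>(1) by (intro mult_mono) auto
    moreover have "norm ((T - s) * (1 - \<iota>r g)) \<le> norm (T - s) * norm (1 - \<iota>r g)" by (rule norm_mult_ineq)
    moreover have "norm ?S \<le> norm ((T - s) * (1 - \<iota>r g)) + norm (s * (1 - \<iota>r g))"
      using norm_triangle_ineq[of "(T - s) * (1 - \<iota>r g)" "s * (1 - \<iota>r g)"] by (simp flip: distrib_right)
    ultimately have "1 - 2 * \<rho> \<le> norm (s * (1 - \<iota>r g))" using nS by linarith
    then have "(1 - 2 * \<rho>)\<^sup>2 \<le> (norm (s * (1 - \<iota>r g)))\<^sup>2" using \<rho> by (intro power_mono) auto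
    also have "\<dots> = norm ((1 - \<iota>r g) * x * (1 - \<iota>r g))"
      using cstar_identity[of "s * (1 - \<iota>r g)"] by (simp only: star_mult s(1) sg mult.assoc s(2)[symmetric])
    finally have "(1 - 2 * \<rho>)\<^sup>2 \<le> norm ((1 - \<iota>r g) * x * (1 - \<iota>r g))" .
    moreover have "(1 - 2 * \<rho>)\<^sup>2 = 1 - 4 * \<rho> + 4 * \<rho>\<^sup>2"
      by (simp add: power2_eq_square algebra_simps)
    ultimately show "1 - \<epsilon> < norm ((1 - \<iota>r g) * x * (1 - \<iota>r g))"
      using \<rho> \<epsilon> zero_le_power2[of \<rho>] by linarith
  qed
qed

end

section \<open>Density of the finite sums\<close>

lemma cstar_subalgebra_hull: "cstar_subalgebra (cstar_subalgebra hull (S::'a::unital_cstar_algebra set))"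
  by (rule hull_in) (auto simp: cstar_subalgebra_def intro!: closed_Inter)

lemma cstar_subalgebra_closure:
  fixes S :: "'a::unital_cstar_algebra set"
  assumes zero: "0 \<in> S" and add: "\<And>a b. a \<in> S \<Longrightarrow> b \<in> S \<Longrightarrow> a + b \<in> S"
    and scale: "\<And>c a. a \<in> S \<Longrightarrow> c *\<^sub>C a \<in> S"
    and mult: "\<And>a b. a \<in> S \<Longrightarrow> b \<in> S \<Longrightarrow> a * b \<in> S" and star: "\<And>a. a \<in> S \<Longrightarrow> star a \<in> S"
  shows "cstar_subalgebra (closure S)"
proof -
  have scaleC_lim: "(\<lambda>n. c *\<^sub>C f n) \<longlonglongrightarrow> c *\<^sub>C l" if "f \<longlonglongrightarrow> l" for c and f :: "nat \<Rightarrow> 'a" and l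
  proof -
    have "(\<lambda>n. (c *\<^sub>C 1) * f n) \<longlonglongrightarrow> (c *\<^sub>C 1) * l" by (intro tendsto_intros that)
    then show ?thesis by (simp add: mult_scaleC_left)
  qed
  have lim: "l \<in> closure S" if "\<And>n. f n \<in> S" "f \<longlonglongrightarrow> l" for f l
    unfolding closure_sequential using that by blast
  show ?thesis
    unfolding cstar_subalgebra_def
  proof (intro conjI ballI allI)
    show "0 \<in> closure S" using zero closure_subset by blast
    fix a assume "a \<in> closure S"
    then obtain f where f: "\<And>n. f n \<in> S" "f \<longlonglongrightarrow> a" unfolding closure_sequential by blast
    show "c *\<^sub>C a \<in> closure S" for c
      by (rule lim[OF _ scaleC_lim[OF f(2)]]) (intro scale f)
    show "star a \<in> closure S"
      by (rule lim[OF _ tendsto_star[OF f(2)]]) (intro star f)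
    fix b assume "b \<in> closure S"
    then obtain g where g: "\<And>n. g n \<in> S" "g \<longlonglongrightarrow> b" unfolding closure_sequential by blast
    show "a + b \<in> closure S"
      by (rule lim[OF _ tendsto_add[OF f(2) g(2)]]) (intro add f g)
    show "a * b \<in> closure S"
      by (rule lim[OF _ tendsto_mult[OF f(2) g(2)]]) (intro mult f g)
  qed simp
qed

context minimal_crossed_product
begin

lemma is_sum_from_finite:
  assumes F: "finite F" "\<And>m. m \<notin> F \<Longrightarrow> w m = (\<lambda>_. 0)" "\<And>m. cont (w m)"
  obtains K where "is_sum K w (\<Sum>m\<in>F. U m * \<iota> (w m))"
proof -
  define K where "K = nat (\<Sum>n\<in>F. \<bar>n\<bar>)"
  have K: "\<bar>n\<bar> \<le> int K" if "n \<in> F" for n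
    using member_le_sum[of n F abs] that F(1) by (simp add: K_def sum_nonneg)
  have "(\<Sum>m\<in>F. U m * \<iota> (w m)) = (\<Sum>m\<in>{- int K..int K}. U m * \<iota> (w m))"
    by (rule sum.mono_neutral_left) (use K F(2) in \<open>force simp: abs_le_iff\<close>)+
  moreover have "w m = (\<lambda>_. 0)" if "\<bar>m\<bar> > int K" for m using F(2)[of m] K[of m] that by fastforce
  ultimately have "is_sum K w (\<Sum>m\<in>F. U m * \<iota> (w m))" unfolding is_sum_def using F(3) by blast
  then show ?thesis by (rule that)
qed

lemma is_sum_integrated_form:
  assumes a: "a \<in> conv_algebra"
  shows "\<exists>K w. is_sum K w (integrated_form \<iota> u a)"
proof -
  let ?F = "{n. a n \<noteq> (\<lambda>_. 0)}"
  have c: "cont (a n)" for n using a by (auto simp: conv_algebra_def cont_functions_def)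
  have "finite ?F" using a by (simp add: conv_algebra_def)
  then obtain K where "is_sum K (\<lambda>m x. a m (H m x)) (\<Sum>m\<in>?F. U m * \<iota> (\<lambda>x. a m (H m x)))"
    by (rule is_sum_from_finite[of _ "\<lambda>m x. a m (H m x)"]) (auto intro: continuous_on_H c)
  also have "(\<Sum>m\<in>?F. U m * \<iota> (\<lambda>x. a m (H m x))) = integrated_form \<iota> u a"
    unfolding integrated_form_def by (simp add: \<iota>_U[OF c])
  finally show ?thesis by blast
qed

lemma approximable_UNIV: "approximable UNIV"
  unfolding approximable_def
proof (intro ballI allI impI)
  fix b :: 'a and e :: real assume "e > 0"
  moreover have "b \<in> closure (integrated_form \<iota> u ` conv_algebra)" by (simp add: dense_sums)
  ultimately obtain a where a: "a \<in> conv_algebra" "dist (integrated_form \<iota> u a) b < e"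
    unfolding closure_approachable by blast
  then show "\<exists>T\<in>UNIV. \<exists>K w. is_sum K w T \<and> norm (T - b) < e"
    using is_sum_integrated_form[OF a(1)] unfolding dist_norm by blast
qed

text \<open>The finite sums inside the hull form a *-algebra. Its closure is a C*-subalgebra
  containing \<open>S\<close>, hence contains the hull.\<close>

lemma approximable_hull:
  assumes S: "\<And>a. a \<in> S \<Longrightarrow> \<exists>K w. is_sum K w a"
  shows "approximable (cstar_subalgebra hull S)"
proof -
  let ?B = "cstar_subalgebra hull S"
  note B = cstar_subalgebraD[OF cstar_subalgebra_hull[of S]]
  define D where "D = {T \<in> ?B. \<exists>K w. is_sum K w T}"
  have "cstar_subalgebra (closure D)"
  proof (rule cstar_subalgebra_closure)
    show "0 \<in> D" unfolding D_def using B(1) is_sum_\<iota>[of "\<lambda>_. 0"] by auto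
    show "c *\<^sub>C a \<in> D" if "a \<in> D" for c a
      using that B(3) is_sum_scaleC unfolding D_def by blast
    show "star a \<in> D" if "a \<in> D" for a
      using that B(5) is_sum_star unfolding D_def by blast
    show "a * b \<in> D" if "a \<in> D" "b \<in> D" for a b
      using that B(4) is_sum_mult unfolding D_def by blast
    show "a + b \<in> D" if "a \<in> D" "b \<in> D" for a b
    proof -
      from that obtain K w L v where *: "is_sum K w a" "is_sum L v b" "a \<in> ?B" "b \<in> ?B"
        unfolding D_def by blast
      have "is_sum (max K L) w a" "is_sum (max K L) v b"
        using *(1,2) by (auto intro: is_sum_mono)
      from is_sum_add[OF this] show ?thesis using B(2) * unfolding D_def by blast
    qed
  qed
  moreover have "S \<subseteq> closure D"
    using S hull_subset[of S cstar_subalgebra] closure_subset[of D] unfolding D_def by blast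
  ultimately have sub: "?B \<subseteq> closure D" by (rule hull_minimal[rotated])
  show ?thesis
    unfolding approximable_def
  proof (intro ballI allI impI)
    fix b and e :: real assume "b \<in> ?B" "e > 0"
    then have "b \<in> closure D" using sub by blast
    then obtain T where "T \<in> D" "dist T b < e" using \<open>e > 0\<close> unfolding closure_approachable by blast
    then show "\<exists>T\<in>?B. \<exists>K w. is_sum K w T \<and> norm (T - b) < e"
      by (auto simp: D_def dist_norm)
  qed
qed

section \<open>Generation, simplicity and infinite dimension\<close>

lemma cstar_subalgebra_UNIV: "cstar_subalgebra (UNIV :: 'a set)"
  by (simp add: cstar_subalgebra_def)

lemma generated_by_range_and_u: "cstar_subalgebra hull (\<iota> ` Collect cont \<union> {u}) = UNIV"
proof -
  let ?B = "cstar_subalgebra hull (\<iota> ` Collect cont \<union> {u})"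
  note B = cstar_subalgebra_hull[of "\<iota> ` Collect cont \<union> {u}"]
  have S: "\<iota> ` Collect cont \<union> {u} \<subseteq> ?B" by (rule hull_subset)
  have \<iota>B: "\<iota> f \<in> ?B" if "cont f" for f using S that by blast
  have "1 \<in> ?B" using \<iota>B[of "\<lambda>_. 1"] by (simp add: \<iota>_one)
  moreover have "u \<in> ?B" using S by blast
  ultimately have pow: "u ^ k \<in> ?B" "star u ^ k \<in> ?B" for k
    using cstar_subalgebra_power[OF B] cstar_subalgebraD(5)[OF B] by blast+
  have U: "U n \<in> ?B" for n
    unfolding unitary_power_def using pow by (cases "n \<ge> 0") (simp_all only: if_True if_False)
  have "integrated_form \<iota> u a \<in> ?B" if "a \<in> conv_algebra" for a
    unfolding integrated_form_def
    by (intro cstar_subalgebra_sum[OF B] cstar_subalgebraD(4)[OF B] U \<iota>B)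
      (use that in \<open>auto simp: conv_algebra_def cont_functions_def\<close>)
  then have "closure (integrated_form \<iota> u ` conv_algebra) \<subseteq> ?B"
    by (intro closure_minimal cstar_subalgebraD(6)[OF B]) auto
  then show ?thesis using dense_sums by auto
qed

text \<open>Closed ideals are hereditary for Cuntz subequivalence, so a nonzero one contains a
  nonzero function; the functions it contains form an invariant ideal and therefore include
  1.\<close>

lemma simple: "simple_cstar_algebra TYPE('a)"
  unfolding simple_cstar_algebra_def
proof (intro allI impI)
  fix I :: "'a set" assume I: "closed_ideal I"
  then have cl: "closed I" and z: "0 \<in> I" and add: "\<And>a b. a \<in> I \<Longrightarrow> b \<in> I \<Longrightarrow> a + b \<in> I"
    and mult: "\<And>a b. a \<in> I \<Longrightarrow> a * b \<in> I" "\<And>a b. a \<in> I \<Longrightarrow> b * a \<in> I"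
    unfolding closed_ideal_def by auto
  show "I = {0} \<or> I = UNIV"
  proof (rule disjCI)
    assume "I \<noteq> UNIV"
    show "I = {0}"
    proof (rule ccontr)
      assume "I \<noteq> {0}"
      then obtain a where a: "a \<in> I" "a \<noteq> 0" using z by blast
      have ne: "star a * a \<noteq> 0" using a(2) cstar_identity[of a] by auto
      obtain f z where f: "continuous_on UNIV f" "\<And>y. f y \<ge> 0" "f z > 0"
        "cuntz_subeq UNIV (\<iota>r f) (star a * a)"
        by (rule function_cuntz_below[OF cstar_subalgebra_UNIV UNIV_I approximable_UNIV UNIV_I
          norm_positive_star_mult_self ne]) (rule that; assumption)
      from f(4) obtain v where v: "(\<lambda>n. v n * (star a * a) * star (v n)) \<longlonglongrightarrow> \<iota>r f"
        unfolding cuntz_subeq_def by blast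
      have "\<iota>r f \<in> I" by (rule closed_sequentially[OF cl _ v]) (intro mult a)
      have "(\<lambda>_. 1) \<in> {f. cont f \<and> \<iota> f \<in> I}"
      proof (rule invariant_ideal_contains_one[where f="\<lambda>x. complex_of_real (f x)" and z=z])
        show "(\<lambda>x. g (H n x)) \<in> {f. cont f \<and> \<iota> f \<in> I}" if "g \<in> {f. cont f \<and> \<iota> f \<in> I}" for g n
        proof -
          have "\<iota> (\<lambda>x. g (H n x)) = U (- n) * \<iota> g * U n" using that U_\<iota>_U[of g "- n"] by simp
          then show ?thesis using that by (auto intro: mult continuous_on_H)
        qed
      qed (use f \<open>\<iota>r f \<in> I\<close> in \<open>auto simp: \<iota>_add \<iota>_mult intro: mult add continuous_on_add continuous_on_mult cont_of_real\<close>)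
      then have "1 \<in> I" by (simp add: \<iota>_one)
      then have "b \<in> I" for b using mult(1)[of 1 b] by simp
      then show False using \<open>I \<noteq> UNIV\<close> by blast
    qed
  qed
qed

lemma scaleC_vector_space: "vector_space (\<lambda>c (a::'a). c *\<^sub>C a)"
  by unfold_locales (simp_all add: scaleC_add_right scaleC_add_left scaleC_scaleC)

text \<open>Translates of a bump along a free orbit have the identity matrix as values at the orbit
  points. One more of them than a supposed finite spanning set has elements is already
  independent.\<close>

lemma infinite_dim: "infinite_dimensional TYPE('a)"
  unfolding infinite_dimensional_def
proof
  assume "\<exists>F::'a set. finite F \<and> (\<forall>a. \<exists>c. a = (\<Sum>b\<in>F. c b *\<^sub>C b))"
  then obtain F :: "'a set" where F: "finite F" "\<And>a. \<exists>c. a = (\<Sum>b\<in>F. c b *\<^sub>C b)" by blast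
  interpret V: vector_space "\<lambda>c (a::'a). c *\<^sub>C a" by (rule scaleC_vector_space)
  have span: "V.span F = UNIV"
  proof -
    have "a \<in> V.span F" for a
    proof -
      obtain c where c: "a = (\<Sum>b\<in>F. c b *\<^sub>C b)" using F(2) by blast
      show ?thesis by (subst c) (intro V.span_sum V.span_scale V.span_base)
    qed
    then show ?thesis by blast
  qed
  define K where "K = card F + 1"
  obtain y where y: "y \<in> Y" using Y_nonempty by blast
  obtain e :: "'x \<Rightarrow> real" where e: "continuous_on UNIV e" "e y = 1"
    "\<And>n x. n \<noteq> 0 \<Longrightarrow> \<bar>n\<bar> \<le> int K \<Longrightarrow> e x = 0 \<or> e (H n x) = 0"
    by (rule bump_at[OF open_UNIV UNIV_I, of y K]) (rule that; assumption)
  define E where "E j = (\<lambda>x. complex_of_real (e (H (- int j) x)))" for j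
  have cE: "cont (E j)" for j unfolding E_def by (intro continuous_intros e)
  have EH: "E i (H (int j) y) = (if i = j then 1 else 0)" if "i < K" "j < K" for i j
  proof (cases "i = j")
    case False
    then have "e y = 0 \<or> e (H (int j - int i) y) = 0" using that by (intro e(3)) auto
    moreover have "H (int j - int i) y = H (- int i) (H (int j) y)" by (simp flip: H_add)
    ultimately show ?thesis using e(2) False by (simp add: E_def)
  qed (simp add: E_def e(2))
  have inj: "inj_on (\<lambda>j. \<iota> (E j)) {..<K}"
  proof (rule inj_onI)
    fix i j assume ij: "i \<in> {..<K}" "j \<in> {..<K}" "\<iota> (E i) = \<iota> (E j)"
    then have "\<iota> (\<lambda>x. E i x - E j x) = 0" by (simp add: \<iota>_diff cE)
    then have "(\<lambda>x. E i x - E j x) = (\<lambda>_. 0)" using \<iota>_eq_0_iff cE by (simp add: continuous_on_diff)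
    then have "E i (H (int i) y) = E j (H (int i) y)" by (metis eq_iff_diff_eq_0)
    then show "i = j" using EH[of i i] EH[of j i] ij by (auto split: if_splits)
  qed
  have "V.independent ((\<lambda>j. \<iota> (E j)) ` {..<K})"
  proof (rule V.independent_if_scalars_zero)
    fix c b assume sum0: "(\<Sum>b\<in>(\<lambda>j. \<iota> (E j)) ` {..<K}. c b *\<^sub>C b) = 0" and "b \<in> (\<lambda>j. \<iota> (E j)) ` {..<K}"
    then obtain i where i: "i < K" "b = \<iota> (E i)" by auto
    have "(\<Sum>j<K. c (\<iota> (E j)) *\<^sub>C \<iota> (E j)) = 0" using sum0 by (simp add: sum.reindex[OF inj])
    then have "\<iota> (\<lambda>x. \<Sum>j<K. c (\<iota> (E j)) * E j x) = 0"
      by (subst \<iota>_sum) (auto simp: \<iota>_scaleC cE intro: continuous_on_mult)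
    then have "(\<lambda>x. \<Sum>j<K. c (\<iota> (E j)) * E j x) = (\<lambda>_. 0)"
      by (subst (asm) \<iota>_eq_0_iff) (auto intro!: continuous_on_sum continuous_on_mult cE)
    then have "(\<Sum>j<K. c (\<iota> (E j)) * E j (H (int i) y)) = 0" by meson
    moreover have "(\<Sum>j<K. c (\<iota> (E j)) * E j (H (int i) y)) = (\<Sum>j<K. if j = i then c (\<iota> (E i)) else 0)"
      by (rule sum.cong) (use i in \<open>auto simp: EH\<close>)
    ultimately show "c b = 0" using i by (simp add: sum.delta)
  qed simp
  from V.independent_span_bound[OF F(1) this]
  have "card ((\<lambda>j. \<iota> (E j)) ` {..<K}) \<le> card F" using span by simp
  then show False using card_image[OF inj] by (simp add: K_def)
qed

end

section \<open>The orbit breaking subalgebra\<close>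

text \<open>Only 0 is critical: there the quotient is 0 by the convention for division by 0, and its
  modulus elsewhere is the root of \<open>cmod c\<close>.\<close>

lemma continuous_on_div_sqrt_norm: "continuous_on UNIV (\<lambda>c. c / complex_of_real (sqrt (cmod c)))"
proof (rule continuous_at_imp_continuous_on, rule ballI)
  fix c :: complex
  show "isCont (\<lambda>c. c / complex_of_real (sqrt (cmod c))) c"
  proof (cases "c = 0")
    case True
    have "((\<lambda>c. c / complex_of_real (sqrt (cmod c))) \<longlongrightarrow> 0) (at 0)"
    proof (rule tendsto_norm_zero_cancel)
      have "norm (c / complex_of_real (sqrt (cmod c))) = sqrt (cmod c)" for c
        by (simp add: norm_divide real_div_sqrt)
      moreover have "((\<lambda>c::complex. sqrt (cmod c)) \<longlongrightarrow> sqrt (cmod 0)) (at 0)"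
        by (intro tendsto_intros)
      ultimately show "((\<lambda>c. norm (c / complex_of_real (sqrt (cmod c)))) \<longlongrightarrow> 0) (at 0)" by simp
    qed
    then show ?thesis using True by (simp add: isCont_def)
  qed (auto intro!: continuous_intros)
qed

context minimal_crossed_product
begin

section \<open>Membership in the orbit breaking subalgebra\<close>

abbreviation "B \<equiv> orbit_breaking_subalgebra \<iota> u Y"

lemma B_subalgebra: "cstar_subalgebra B"
  unfolding orbit_breaking_subalgebra_def by (rule cstar_subalgebra_hull)

lemma \<iota>_B: "cont f \<Longrightarrow> \<iota> f \<in> B"
  unfolding orbit_breaking_subalgebra_def cont_functions_def
  by (rule subsetD[OF hull_subset]) blast

lemma \<iota>_u_B: "cont f \<Longrightarrow> (\<And>y. y \<in> Y \<Longrightarrow> f y = 0) \<Longrightarrow> \<iota> f * u \<in> B"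
  unfolding orbit_breaking_subalgebra_def cont_functions_def
  by (rule subsetD[OF hull_subset]) blast

lemma approximable_B: "approximable B"
  unfolding orbit_breaking_subalgebra_def
proof (rule approximable_hull)
  fix a assume "a \<in> \<iota> ` cont_functions \<union> {\<iota> f * u |f. f \<in> cont_functions \<and> (\<forall>y\<in>Y. f y = 0)}"
  then consider f where "cont f" "a = \<iota> f" | f where "cont f" "a = \<iota> f * u"
    by (auto simp: cont_functions_def)
  then show "\<exists>K w. is_sum K w a"
  proof cases
    case 1
    then show ?thesis using is_sum_\<iota> by blast
  next
    case 2
    let ?w = "\<lambda>m::int. if m = 1 then (\<lambda>x. f (H 1 x)) else (\<lambda>_. 0)"
    obtain K where "is_sum K ?w (\<Sum>m\<in>{1}. U m * \<iota> (?w m))"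
      by (rule is_sum_from_finite[of "{1}" ?w]) (auto intro: continuous_on_H[OF 2(1), of UNIV 1, simplified])
    moreover have "(\<Sum>m\<in>{1}. U m * \<iota> (?w m)) = a" using \<iota>_U[OF 2(1), of 1] 2(2) by simp
    ultimately show ?thesis by metis
  qed
qed

text \<open>
  An element \<open>f u\<^sup>n\<^sup>+\<^sup>1\<close> is split off one power of \<open>u\<close> at a time, writing \<open>f\<close> as the product of
  \<open>|f|\<^sup>1\<^sup>/\<^sup>2\<close> and \<open>f / |f|\<^sup>1\<^sup>/\<^sup>2\<close> (with the value \<open>0\<close> where \<open>f = 0\<close>).
\<close>

lemma \<iota>_U_nat_B:
  "cont f \<Longrightarrow> (\<And>i y. i < n \<Longrightarrow> y \<in> Y \<Longrightarrow> f (H (int i) y) = 0) \<Longrightarrow> \<iota> f * U (int n) \<in> B"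
proof (induction n arbitrary: f)
  case 0
  then show ?case by (simp add: \<iota>_B)
next
  case (Suc n)
  define a where "a x = complex_of_real (sqrt (cmod (f x)))" for x
  define b where "b x = f x / complex_of_real (sqrt (cmod (f x)))" for x
  have ca: "cont a" unfolding a_def by (intro continuous_intros Suc.prems(1))
  have cb: "cont b" unfolding b_def
    using continuous_on_compose2[OF continuous_on_div_sqrt_norm Suc.prems(1)] by simp
  have "f = (\<lambda>x. a x * b x)" by (auto simp: a_def b_def)
  then have "\<iota> f * U (int (Suc n)) = \<iota> a * (\<iota> b * U 1) * U (int n)"
    using \<iota>_mult[OF ca cb] U_succ[of "int n"] by (simp add: mult.assoc add.commute)
  also have "\<iota> b * U 1 = u * \<iota> (\<lambda>x. b (H 1 x))" by (subst \<iota>_U[OF cb]) simp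
  finally have "\<iota> f * U (int (Suc n)) = (\<iota> a * u) * (\<iota> (\<lambda>x. b (H 1 x)) * U (int n))"
    by (simp only: mult.assoc)
  \<comment> \<open>The condition at time 0 is spent on \<open>a\<close>; those at times 1 to n pass
    to \<open>b\<close>, read at \<open>H 1 x\<close>.\<close>
  moreover have "\<iota> a * u \<in> B"
    by (rule \<iota>_u_B[OF ca]) (use Suc.prems(2)[of 0] in \<open>simp add: a_def\<close>)
  moreover have "\<iota> (\<lambda>x. b (H 1 x)) * U (int n) \<in> B"
  proof (rule Suc.IH)
    show "cont (\<lambda>x. b (H 1 x))" by (rule continuous_on_H[OF cb])
    fix i y assume "i < n" "y \<in> Y"
    then have "f (H (1 + int i) y) = 0" using Suc.prems(2)[of "Suc i" y] by simp
    then show "b (H 1 (H (int i) y)) = 0" by (simp add: b_def H_add)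
  qed
  ultimately show ?case using cstar_subalgebraD(4)[OF B_subalgebra] by simp
qed

text \<open>Negative powers reduce to positive ones by taking adjoints: the coefficient is
  conjugated and composed with \<open>H n\<close>, which moves the times from 0 to -n - 1 onto n to
  -1.\<close>

lemma \<iota>_U_B:
  assumes f: "cont f" and pos: "\<And>i y. 0 \<le> i \<Longrightarrow> i < n \<Longrightarrow> y \<in> Y \<Longrightarrow> f (H i y) = 0"
    and neg: "\<And>i y. n \<le> i \<Longrightarrow> i < 0 \<Longrightarrow> y \<in> Y \<Longrightarrow> f (H i y) = 0"
  shows "\<iota> f * U n \<in> B"
proof (cases "n \<ge> 0")
  case True
  then show ?thesis using \<iota>_U_nat_B[OF f, of "nat n"] pos by simp
next
  case False
  let ?f = "\<lambda>x. cnj (f (H n x))"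
  have cf: "cont (\<lambda>x. cnj (f x))" using f by (rule continuous_on_cnj)
  have "\<iota> ?f * U (int (nat (- n))) \<in> B"
  proof (rule \<iota>_U_nat_B)
    show "cont ?f" by (intro continuous_on_cnj continuous_on_H f)
    fix i y assume "i < nat (- n)" "y \<in> Y"
    then have "f (H (n + int i) y) = 0" using False by (intro neg) auto
    then show "cnj (f (H n (H (int i) y))) = 0" by (simp add: H_add)
  qed
  then have "star (\<iota> ?f * U (- n)) \<in> B" using False by (intro cstar_subalgebraD(5)[OF B_subalgebra]) simp
  moreover have "\<iota> ?f * U (- n) = star (\<iota> f * U n)"
    using U_\<iota>[OF cf, of "- n"] by (simp add: star_mult \<iota>_star f)
  ultimately show ?thesis by (simp add: star_star)
qed

text \<open>The indices fill disjoint blocks of length \<open>L\<close>, upwards from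
  \<open>N\<close> for nonnegative \<open>n\<close> and downwards below \<open>- N\<close> for
  negative \<open>n\<close>. The sign tells the cases apart and division by \<open>L\<close>
  recovers the block.\<close>

lemma index_inject:
  fixes N L :: nat and n n' :: int
  assumes "i < L" "j < L"
    and "(if n \<ge> 0 then int N + n * int L + int i else n * int L - int N - int i) =
      (if n' \<ge> 0 then int N + n' * int L + int j else n' * int L - int N - int j)"
  shows "n = n' \<and> i = j"
proof -
  have neg: "m * int L - int N - int k < 0" if "m < 0" "k < L" for m k
  proof -
    have "m * int L < 0" using that by (intro mult_neg_pos) auto
    then show ?thesis by linarith
  qed
  have pos: "0 \<le> int N + m * int L + int k" if "m \<ge> 0" for m k using that by simp
  have dv: "(a * int L + int k) div int L = a" if "k < L" for a k using that by simp
  have "\<not> (n \<ge> 0 \<and> n' < 0)" using assms(3) neg[OF _ assms(2), of n'] pos[of n i] by fastforce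
  moreover have "\<not> (n < 0 \<and> n' \<ge> 0)" using assms(3) neg[OF _ assms(1), of n] pos[of n' j] by fastforce
  ultimately consider "n \<ge> 0" "n' \<ge> 0" | "n < 0" "n' < 0" by linarith
  then have "n = n'"
  proof cases
    case 1
    then have "n * int L + int i = n' * int L + int j" using assms(3) by simp
    then show ?thesis using dv assms(1,2) by metis
  next
    case 2
    then have "(- n) * int L + int i = (- n') * int L + int j" using assms(3) by simp
    then have "- n = - n'" using dv assms(1,2) by metis
    then show ?thesis by simp
  qed
  then show ?thesis using assms(3) by (auto split: if_splits)
qed

text \<open>
  A neighbourhood of \<open>H n ` Y\<close> is cut into pieces \<open>(n, i)\<close> with \<open>i < L\<close>, and the piece \<open>t = (n, i)\<close> is
  moved by \<open>H (\<mu> t - n)\<close> into the support of \<open>f\<close>, hence near \<open>H (\<mu> t) ` Y\<close>. Since \<open>\<mu>\<close> is injective,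
  different pieces land in disjoint translates of a neighbourhood of \<open>Y\<close>. The motion is forward for
  \<open>n \<ge> 0\<close> and backward for \<open>n < 0\<close>, so it never passes through \<open>Y\<close> and stays in \<open>B\<close>.
\<close>

lemma transport:
  fixes N :: nat
  assumes f: "continuous_on UNIV f" "\<And>x. f x \<ge> 0" "f z > 0"
  obtains r w where "continuous_on UNIV r" "\<And>x. 0 \<le> r x" "\<And>x. r x \<le> 1"
    "\<And>n y. \<bar>n\<bar> \<le> int N \<Longrightarrow> y \<in> Y \<Longrightarrow> r (H n y) = 1"
    "w \<in> B" "w * \<iota>r f * star w = \<iota>r r"
proof -
  \<comment> \<open>Cutting at half the value leaves a nonempty open set on which division by
    \<open>f\<close> is safe.\<close>
  define \<delta> where "\<delta> = f z / 2"
  have \<delta>: "\<delta> > 0" using f(3) by (simp add: \<delta>_def)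
  let ?V = "{x. \<delta> < f x}"
  have V: "open ?V" by (intro open_Collect_less continuous_intros f)
  have "z \<in> ?V" using f(3) by (simp add: \<delta>_def)
  then have "?V \<noteq> {}" by blast
  from V this obtain L where L: "L > 0" "\<And>x. \<exists>i<L. H (int i) x \<in> ?V" 
    by (rule uniform_return) (rule that; assumption)
  \<comment> \<open>The offset \<open>N\<close> dominates the index \<open>fst t\<close>, so
    \<open>k t = \<mu> t - fst t\<close> has the required sign.\<close>
  define \<mu> where "\<mu> t = (if fst t \<ge> 0 then int N + fst t * int L + int (snd t)
    else fst t * int L - int N - int (snd t))" for t :: "int \<times> nat"
  define k where "k t = \<mu> t - fst t" for t
  define I where "I = {- int N..int N} \<times> {..<L}"
  define M where "M = N + N * L + L"
  have inj: "t = t'" if "t \<in> I" "t' \<in> I" "\<mu> t = \<mu> t'" for t t'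
  proof -
    have "fst t = fst t' \<and> snd t = snd t'"
      by (rule index_inject[of "snd t" L "snd t'" "fst t" N "fst t'"])
        (use that in \<open>auto simp: I_def \<mu>_def\<close>)
    then show ?thesis by (simp add: prod_eq_iff)
  qed
  have \<mu>_bound: "\<bar>\<mu> t\<bar> \<le> int M" and k_pos: "fst t \<ge> 0 \<Longrightarrow> k t \<ge> 0" and k_neg: "fst t < 0 \<Longrightarrow> k t \<le> 0"
    if t: "t \<in> I" for t
  proof -
    have s: "\<bar>fst t\<bar> \<le> int N" "snd t < L" using t by (auto simp: I_def)
    have "fst t * int L \<le> int N * int L" "(- int N) * int L \<le> fst t * int L"
      using s(1) by (intro mult_right_mono; simp add: abs_le_iff)+
    then have *: "fst t * int L \<le> int N * int L" "- (int N * int L) \<le> fst t * int L" by simp_all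
    have M: "int M = int N + int N * int L + int L" by (simp add: M_def)
    show "\<bar>\<mu> t\<bar> \<le> int M"
    proof (cases "fst t \<ge> 0")
      case True
      then have "\<mu> t = int N + fst t * int L + int (snd t)" "fst t * int L \<ge> 0" by (simp_all add: \<mu>_def)
      then show ?thesis using * M s(2) by linarith
    next
      case False
      then have "\<mu> t = fst t * int L - int N - int (snd t)" "fst t * int L \<le> 0"
        by (simp_all add: \<mu>_def mult_nonpos_nonneg)
      then show ?thesis using * M s(2) by linarith
    qed
    show "k t \<ge> 0" if "fst t \<ge> 0"
    proof -
      have "\<mu> t = int N + fst t * int L + int (snd t)" "fst t * int L \<ge> 0" using that by (simp_all add: \<mu>_def)
      then show ?thesis using s(1) unfolding k_def by linarith
    qed
    show "k t \<le> 0" if "fst t < 0"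
    proof -
      have "\<mu> t = fst t * int L - int N - int (snd t)" "fst t * int L \<le> 0"
        using that by (simp_all add: \<mu>_def mult_nonpos_nonneg)
      then show ?thesis using s(1) unfolding k_def by linarith
    qed
  qed
  have visit: "\<exists>i<L. H (k (n, i)) x \<in> ?V" for n x
  proof (cases "n \<ge> 0")
    case True
    obtain i where "i < L" "H (int i) (H (int N + n * int L - n) x) \<in> ?V" using L(2) by blast
    moreover have "int i + (int N + n * int L - n) = k (n, i)" using True by (simp add: k_def \<mu>_def)
    ultimately show ?thesis by (metis H_add)
  next
    case False
    \<comment> \<open>For negative \<open>n\<close> the displacement decreases with the index, so
      offset \<open>i\<close> in the window belongs to the piece \<open>L - 1 - i\<close>.\<close>
    obtain i where i: "i < L" "H (int i) (H (n * int L - int N - int (L - 1) - n) x) \<in> ?V" using L(2) by blast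
    have "int i + (n * int L - int N - int (L - 1) - n) = k (n, L - 1 - i)"
      using False i(1) by (simp add: k_def \<mu>_def of_nat_diff)
    then have "H (k (n, L - 1 - i)) x \<in> ?V" using i(2) by (metis H_add)
    then show ?thesis using L(1) by (intro exI[of _ "L - 1 - i"]) auto
  qed
  \<comment> \<open>Two values of \<mu> differ by at most 2M, which is the range of times to be
    separated.\<close>
  obtain \<eta> :: "'x \<Rightarrow> real" where \<eta>: "continuous_on UNIV \<eta>" "\<And>x. 0 \<le> \<eta> x" "\<And>x. \<eta> x \<le> 1"
    "\<And>x. x \<notin> UNIV \<Longrightarrow> \<eta> x = 0" "\<And>x. x \<in> Y \<Longrightarrow> \<eta> x = 1"
    "\<And>n x. n \<noteq> 0 \<Longrightarrow> \<bar>n\<bar> \<le> int (2 * M) \<Longrightarrow> \<eta> x = 0 \<or> \<eta> (H n x) = 0"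
  proof (rule bump_disjoint_translates[OF closed_Y subset_UNIV open_UNIV, of "2 * M"])
    fix n :: int and x assume "n \<noteq> 0" "x \<in> Y"
    then show "H n x \<notin> Y" using H_Y_disjoint[of "- n" x 0] by auto
  qed (rule that; assumption)
  have \<eta>_sep: "\<eta> (H (- m) x) = 0 \<or> \<eta> (H (- m') x) = 0"
    if "m \<noteq> m'" "\<bar>m\<bar> \<le> int M" "\<bar>m'\<bar> \<le> int M" for m m' x
  proof -
    have "\<eta> (H (- m) x) = 0 \<or> \<eta> (H (m - m') (H (- m) x)) = 0" using that by (intro \<eta>(6)) auto
    then show ?thesis by (simp flip: H_add)
  qed
  have \<eta>_Y: "\<eta> (H n y) = 0" if "n \<noteq> 0" "\<bar>n\<bar> \<le> int (2 * M)" "y \<in> Y" for n y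
    using \<eta>(6)[OF that(1,2), of y] \<eta>(5)[OF that(3)] by simp
  \<comment> \<open>For fixed \<open>n\<close> the weights \<open>\<sigma> (n, i)\<close>,
    normalised by their sum \<open>S n\<close>, partition the bump at the translate \<open>n\<close>
    into pieces \<open>p (n, i)\<close>, each supported where \<open>f\<close> exceeds \<delta>
    after the displacement. The factor \<open>s t\<close> is made to satisfy s^2 f(H (k t) x) = p;
    on the support of \<open>p t\<close> the maximum in it is just \<open>f\<close>.\<close>
  define \<sigma> where "\<sigma> t x = max 0 (f (H (k t) x) - \<delta>)" for t x
  define S where "S n x = (\<Sum>i<L. \<sigma> (n, i) x)" for n x
  define p where "p t x = \<eta> (H (- fst t) x) * \<sigma> t x / S (fst t) x" for t x
  define s where "s t x = sqrt (p t x / max \<delta> (f (H (k t) x)))" for t x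
  have c\<sigma>: "continuous_on UNIV (\<sigma> t)" for t
    unfolding \<sigma>_def by (intro continuous_intros f)
  have \<sigma>0: "\<sigma> t x \<ge> 0" for t x by (simp add: \<sigma>_def)
  have S0: "S n x > 0" for n x
  proof -
    obtain i where i: "i < L" "H (k (n, i)) x \<in> ?V" using visit by blast
    then show ?thesis unfolding S_def
      by (intro sum_pos2[of _ i]) (auto simp: \<sigma>_def)
  qed
  have cS: "continuous_on UNIV (S n)" for n unfolding S_def by (intro continuous_on_sum c\<sigma>)
  have cp: "continuous_on UNIV (p t)" for t
    unfolding p_def by (intro continuous_on_divide continuous_on_mult continuous_on_H \<eta>(1) c\<sigma> cS)
      (use S0 in \<open>auto simp: less_le\<close>)
  have p0: "p t x \<ge> 0" for t x
    unfolding p_def using \<eta>(2) \<sigma>0 S0[of "fst t" x] by simp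
  have m0: "max \<delta> y > 0" for y using \<delta> by simp
  have cs: "continuous_on UNIV (s t)" for t
    unfolding s_def
    by (intro continuous_on_real_sqrt continuous_on_divide cp continuous_on_max continuous_on_const continuous_on_H f(1))
      (use m0 in \<open>auto simp: less_le\<close>)
  have s_zero: "s t x = 0" if "\<eta> (H (- fst t) x) = 0" for t x
    using that by (simp add: s_def p_def)
  have ssf: "s t x * f (H (k t) x) * s t x = p t x" for t x
  proof -
    have "s t x * s t x = p t x / max \<delta> (f (H (k t) x))"
      unfolding s_def using p0[of t x] m0[of "f (H (k t) x)"] by simp
    moreover have "p t x = 0 \<or> max \<delta> (f (H (k t) x)) = f (H (k t) x)"
      by (auto simp: p_def \<sigma>_def)
    moreover have "s t x * f (H (k t) x) * s t x = (s t x * s t x) * f (H (k t) x)" by simp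
    ultimately show ?thesis using m0[of "f (H (k t) x)"] by auto
  qed
  define w where "w = (\<Sum>t\<in>I. \<iota>r (s t) * U (- k t))"
  define r where "r x = (\<Sum>t\<in>I. p t x)" for x
  have finI: "finite I" by (simp add: I_def)
  have r_eq: "r x = (\<Sum>n\<in>{- int N..int N}. \<eta> (H (- n) x))" for x
  proof -
    have "(\<Sum>i<L. p (n, i) x) = \<eta> (H (- n) x)" for n
    proof -
      have "(\<Sum>i<L. p (n, i) x) = \<eta> (H (- n) x) * S n x / S n x"
        unfolding p_def S_def by (simp add: sum_distrib_left sum_divide_distrib)
      then show ?thesis using S0[of n x] by simp
    qed
    moreover have "r x = (\<Sum>n\<in>{- int N..int N}. \<Sum>i<L. p (n, i) x)"
      by (simp add: r_def I_def sum.cartesian_product)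
    ultimately show ?thesis by simp
  qed
  have NM: "int N \<le> int M" by (simp add: M_def)
  have r_val: "r x = \<eta> (H (- n) x)" if n: "n \<in> {- int N..int N}" and nz: "\<eta> (H (- n) x) \<noteq> 0" for n x
  proof -
    have "\<eta> (H (- m) x) = 0" if "m \<in> {- int N..int N} - {n}" for m
      using \<eta>_sep[of m n x] that n nz NM by auto
    then show ?thesis unfolding r_eq using n by (simp add: sum.remove[of _ n])
  qed
  have sB: "\<iota>r (s t) * U (- k t) \<in> B" if t: "t \<in> I" for t
  proof (rule \<iota>_U_B)
    have b: "\<bar>fst t\<bar> \<le> int M" "\<bar>\<mu> t\<bar> \<le> int M" using t NM \<mu>_bound[OF t] by (auto simp: I_def)
    show "cont (\<lambda>x. complex_of_real (s t x))" by (intro cont_of_real cs)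
    show "complex_of_real (s t (H i y)) = 0" if i: "0 \<le> i" "i < - k t" and y: "y \<in> Y" for i y
    proof -
      \<comment> \<open>\<open>i\<close> and \<open>- fst t\<close> do not cancel, so the argument
        of \<eta> is a nonzero translate of a point of \<open>Y\<close>, where \<eta> vanishes. The
        case of backward powers is symmetric.\<close>
      have "fst t < 0" using k_pos[OF t] i by force
      then have "\<eta> (H (- fst t + i) y) = 0"
        using i b by (intro \<eta>_Y y) (auto simp: k_def)
      then show ?thesis using s_zero[of t "H i y"] by (simp flip: H_add)
    qed
    show "complex_of_real (s t (H i y)) = 0" if i: "- k t \<le> i" "i < 0" and y: "y \<in> Y" for i y
    proof -
      have "fst t \<ge> 0" using k_neg[OF t] i by force
      then have "\<eta> (H (- fst t + i) y) = 0"
        using i b by (intro \<eta>_Y y) (auto simp: k_def)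
      then show ?thesis using s_zero[of t "H i y"] by (simp flip: H_add)
    qed
  qed
  have prod: "(\<iota>r (s t) * U (- k t)) * \<iota>r f * star (\<iota>r (s t') * U (- k t')) =
      (if t = t' then \<iota>r (p t) else 0)" if t: "t \<in> I" "t' \<in> I" for t t'
  proof -
    let ?q = "\<lambda>x. complex_of_real (s t x * f (H (k t) x) * s t' (H (k t - k t') x))"
    have "(\<iota>r (s t) * U (- k t)) * \<iota>r f * star (\<iota>r (s t') * U (- k t')) =
        \<iota>r (s t) * (U (- k t) * \<iota>r f) * (U (k t') * \<iota>r (s t'))"
      by (simp add: star_mult cs mult.assoc)
    also have "U (- k t) * \<iota>r f = \<iota>r (\<lambda>x. f (H (k t) x)) * U (- k t)"
      by (subst U_\<iota>) (simp_all add: cont_of_real f(1))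
    also have "\<iota>r (s t) * (\<iota>r (\<lambda>x. f (H (k t) x)) * U (- k t)) * (U (k t') * \<iota>r (s t')) =
        (\<iota>r (s t) * \<iota>r (\<lambda>x. f (H (k t) x))) * (U (k t' - k t) * \<iota>r (s t'))"
      using U_add[of "- k t" "k t'"] by (simp add: mult.assoc)
    also have "U (k t' - k t) * \<iota>r (s t') = \<iota>r (\<lambda>x. s t' (H (k t - k t') x)) * U (k t' - k t)"
      by (subst U_\<iota>) (simp_all add: cont_of_real cs)
    also have "(\<iota>r (s t) * \<iota>r (\<lambda>x. f (H (k t) x))) * (\<iota>r (\<lambda>x. s t' (H (k t - k t') x)) * U (k t' - k t)) =
        \<iota> ?q * U (k t' - k t)"
    proof -
      have cf: "continuous_on UNIV (\<lambda>x. f (H (k t) x))" and cs': "continuous_on UNIV (\<lambda>x. s t' (H (k t - k t') x))"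
        by (intro continuous_on_H f(1) cs)+
      show ?thesis
        unfolding \<iota>r_mult[OF continuous_on_mult[OF cs cf] cs'] \<iota>r_mult[OF cs cf] by (simp only: mult.assoc)
    qed
    also have "\<dots> = (if t = t' then \<iota>r (p t) else 0)"
    proof (cases "t = t'")
      case True
      then show ?thesis by (simp add: ssf)
    next
      case False
      \<comment> \<open>Seen from the landing point \<open>H (k t) x\<close>, the two factors
        involve \<eta> at the translates \<open>\<mu> t\<close> and \<open>\<mu> t'\<close>, which
        are distinct.\<close>
      have "s t x = 0 \<or> s t' (H (k t - k t') x) = 0" for x
      proof -
        let ?x = "H (k t) x"
        have "\<mu> t \<noteq> \<mu> t'" using inj t False by blast
        then have "\<eta> (H (- \<mu> t) ?x) = 0 \<or> \<eta> (H (- \<mu> t') ?x) = 0"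
          by (rule \<eta>_sep) (intro \<mu>_bound t)+
        moreover have "H (- \<mu> t) ?x = H (- fst t) x" by (simp add: k_def flip: H_add)
        moreover have "H (- \<mu> t') ?x = H (- fst t') (H (k t - k t') x)"
          by (simp add: k_def algebra_simps flip: H_add)
        ultimately show ?thesis using s_zero by metis
      qed
      then have "?q = (\<lambda>_. 0)" by (auto simp: fun_eq_iff)
      then show ?thesis using False by (simp only: \<iota>_zero) simp
    qed
    finally show ?thesis .
  qed
  show ?thesis
  proof (rule that[of r w])
    show "continuous_on UNIV r" unfolding r_def by (intro continuous_on_sum cp)
    show "0 \<le> r x" for x unfolding r_def by (intro sum_nonneg p0)
    show "r x \<le> 1" for x
    proof (cases "\<exists>n\<in>{- int N..int N}. \<eta> (H (- n) x) \<noteq> 0")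
      case True
      then show ?thesis using r_val \<eta>(3) by metis
    next
      case False
      then have "r x = 0" unfolding r_eq by (intro sum.neutral) blast
      then show ?thesis by simp
    qed
    show "r (H n y) = 1" if "\<bar>n\<bar> \<le> int N" "y \<in> Y" for n y
      using r_val[of n "H n y"] that \<eta>(5)[of y] by (simp add: abs_le_iff)
    show "w \<in> B" unfolding w_def by (intro cstar_subalgebra_sum[OF B_subalgebra] sB)
    have "w * \<iota>r f * star w = (\<Sum>t\<in>I. \<Sum>t'\<in>I. (\<iota>r (s t) * U (- k t)) * \<iota>r f * star (\<iota>r (s t') * U (- k t')))"
      unfolding w_def star_sum by (simp only: sum_distrib_right sum_distrib_left) (rule sum.swap)
    also have "\<dots> = (\<Sum>t\<in>I. \<Sum>t'\<in>I. if t = t' then \<iota>r (p t) else 0)"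
      by (intro sum.cong refl prod)
    also have "\<dots> = (\<Sum>t\<in>I. \<iota>r (p t))" using finI by (simp add: sum.delta)
    also have "\<dots> = \<iota> (\<lambda>x. \<Sum>t\<in>I. complex_of_real (p t x))"
      by (rule \<iota>_sum[symmetric]) (intro cont_of_real cp)
    finally show "w * \<iota>r f * star w = \<iota>r r" by (simp add: r_def)
  qed
qed

text \<open>\<open>1 - g\<close> vanishes on all translates of \<open>Y\<close> up to
  \<open>N\<close> in both directions, hence on those that block a power \<open>U m\<close> with |m|
  \<le> K from lying in \<open>B\<close>.\<close>

lemma cut_sum_in_B:
  assumes W: "is_sum K w W" and KN: "K \<le> N" and g: "continuous_on UNIV g"
    and g1: "\<And>n y. \<bar>n\<bar> \<le> int N \<Longrightarrow> y \<in> Y \<Longrightarrow> g (H n y) = (1::real)"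
  shows "(1 - \<iota>r g) * W \<in> B"
proof -
  let ?g = "\<lambda>x. complex_of_real (1 - g x)"
  have cg: "cont ?g" by (intro continuous_intros g)
  have ig: "1 - \<iota>r g = \<iota> ?g" using \<iota>r_diff[of "\<lambda>_. 1" g] g by (simp add: \<iota>_one)
  have "(1 - \<iota>r g) * W = (\<Sum>m\<in>{- int K..int K}. \<iota> ?g * (U m * \<iota> (w m)))"
    unfolding ig is_sumD(3)[OF W] by (rule sum_distrib_left)
  also have "\<dots> \<in> B"
  proof (rule cstar_subalgebra_sum[OF B_subalgebra])
    fix m assume m: "m \<in> {- int K..int K}"
    have cw: "cont (\<lambda>x. w m (H (- m) x))" by (rule continuous_on_H[OF is_sumD(1)[OF W]])
    have "\<iota> ?g * (U m * \<iota> (w m)) = \<iota> ?g * \<iota> (\<lambda>x. w m (H (- m) x)) * U m"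
      unfolding U_\<iota>[OF is_sumD(1)[OF W]] by (simp only: mult.assoc)
    also have "\<dots> = \<iota> (\<lambda>x. ?g x * w m (H (- m) x)) * U m" by (simp only: \<iota>_mult[OF cg cw])
    also have "\<dots> \<in> B"
    proof (rule \<iota>_U_B)
      show "cont (\<lambda>x. ?g x * w m (H (- m) x))" by (rule continuous_on_mult[OF cg cw])
    next
      fix i y assume "0 \<le> i" "i < m" "y \<in> Y"
      then have "g (H i y) = 1" using m KN by (intro g1) auto
      then show "?g (H i y) * w m (H (- m) (H i y)) = 0" by simp
    next
      fix i y assume "m \<le> i" "i < 0" "y \<in> Y"
      then have "g (H i y) = 1" using m KN by (intro g1) auto
      then show "?g (H i y) * w m (H (- m) (H i y)) = 0" by simp
    qed
    finally show "\<iota> ?g * (U m * \<iota> (w m)) \<in> B" .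
  qed
  finally show ?thesis .
qed

text \<open>A further nonnegative factor is absorbed by conjugating with its root. Thus one product
  of cut-offs can lie below several elements at once, each through its own factor.\<close>

lemma cuntz_subeq_cut:
  assumes D: "cstar_subalgebra D" "\<And>f. cont f \<Longrightarrow> \<iota> f \<in> D" and x: "cuntz_subeq D (\<iota>r f) x"
    and w: "w \<in> D" "w * \<iota>r f * star w = \<iota>r r"
    and r: "continuous_on UNIV r" and q: "continuous_on UNIV q" "\<And>x. q x \<ge> 0"
  shows "cuntz_subeq D (\<iota>r (\<lambda>x. r x * q x)) x"
proof -
  let ?s = "\<lambda>x. sqrt (q x)"
  have cs: "continuous_on UNIV ?s" by (intro continuous_intros q)
  have "(\<iota>r ?s * w) * \<iota>r f * star (\<iota>r ?s * w) = \<iota>r ?s * (w * \<iota>r f * star w) * \<iota>r ?s"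
    by (simp add: star_mult cs mult.assoc)
  also have "\<dots> = \<iota>r (\<lambda>x. ?s x * r x * ?s x)"
    unfolding w(2) using \<iota>r_mult[OF cs r] \<iota>r_mult[OF continuous_on_mult[OF cs r] cs] by simp
  also have "(\<lambda>x. ?s x * r x * ?s x) = (\<lambda>x. r x * q x)" using q(2) by (simp add: fun_eq_iff mult.commute mult.left_commute)
  finally have e: "(\<iota>r ?s * w) * \<iota>r f * star (\<iota>r ?s * w) = \<iota>r (\<lambda>x. r x * q x)" .
  have "\<iota>r ?s * w \<in> D" by (intro cstar_subalgebraD(4)[OF D(1)] D(2) cont_of_real cs w)
  from cuntz_subeq_conj_left[OF x D(1) this] show ?thesis unfolding e .
qed

text \<open>Each factor of \<open>g\<close> serves one requirement: \<open>r1\<close> puts it below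
  \<open>x\<close>, \<open>r2\<close> below \<open>y\<close> within \<open>B\<close>, and
  \<open>r3\<close> makes it vanish on \<open>P\<close> for the norm estimate. All three equal 1 on
  the translates of \<open>Y\<close> up to \<open>N\<close>, so \<open>1 - g\<close> cuts every
  \<open>c j\<close> into \<open>B\<close>.\<close>

lemma large_condition:
  fixes a :: "nat \<Rightarrow> 'a"
  assumes \<epsilon>: "\<epsilon> > 0" and x: "positive x" "norm x = 1" and y: "y \<in> B" "positive y" "y \<noteq> 0"
  shows "\<exists>(c::nat \<Rightarrow> 'a) g. g \<in> \<iota> ` Collect cont \<and> positive g \<and> positive (1 - g) \<and>
    (\<forall>j\<in>{1..m}. norm (c j - a j) < \<epsilon>) \<and> (\<forall>j\<in>{1..m}. (1 - g) * c j \<in> B) \<and>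
    cuntz_subeq B g y \<and> cuntz_subeq UNIV g x \<and> norm ((1 - g) * x * (1 - g)) > 1 - \<epsilon>"
proof -
  have "\<forall>j. \<exists>T K w. is_sum K w T \<and> norm (T - a j) < \<epsilon>"
    using approximable_UNIV \<epsilon> unfolding approximable_def by blast
  then obtain c K w where c: "\<And>j. is_sum (K j) (w j) (c j)" "\<And>j. norm (c j - a j) < \<epsilon>" by metis
  define N where "N = (\<Sum>j\<in>{1..m}. K j)"
  have KN: "K j \<le> N" if "j \<in> {1..m}" for j
    unfolding N_def by (rule member_le_sum) (use that in auto)
  have px: "norm_positive x" and py: "norm_positive y" using x y by (auto intro: norm_positive_if_positive)
  have "x \<noteq> 0" using x by auto
  obtain f1 z1 where f1: "continuous_on UNIV f1" "\<And>y. f1 y \<ge> 0" "f1 z1 > 0" "cuntz_subeq UNIV (\<iota>r f1) x"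
    by (rule function_cuntz_below[OF cstar_subalgebra_UNIV UNIV_I approximable_UNIV UNIV_I px \<open>x \<noteq> 0\<close>])
      (rule that; assumption)
  obtain f2 z2 where f2: "continuous_on UNIV f2" "\<And>y. f2 y \<ge> 0" "f2 z2 > 0" "cuntz_subeq B (\<iota>r f2) y"
    by (rule function_cuntz_below[OF B_subalgebra \<iota>_B approximable_B y(1) py y(3)])
      (assumption | rule that; assumption)+
  obtain r1 w1 where r1: "continuous_on UNIV r1" "\<And>x. 0 \<le> r1 x" "\<And>x. r1 x \<le> 1"
    "\<And>n y. \<bar>n\<bar> \<le> int N \<Longrightarrow> y \<in> Y \<Longrightarrow> r1 (H n y) = 1" "w1 \<in> B" "w1 * \<iota>r f1 * star w1 = \<iota>r r1"
    by (rule transport[OF f1(1-3), of N]) (rule that; assumption)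
  obtain r2 w2 where r2: "continuous_on UNIV r2" "\<And>x. 0 \<le> r2 x" "\<And>x. r2 x \<le> 1"
    "\<And>n y. \<bar>n\<bar> \<le> int N \<Longrightarrow> y \<in> Y \<Longrightarrow> r2 (H n y) = 1" "w2 \<in> B" "w2 * \<iota>r f2 * star w2 = \<iota>r r2"
    by (rule transport[OF f2(1-3), of N]) (rule that; assumption)
  obtain P where P: "finite P" "\<And>n. \<bar>n\<bar> \<le> int N \<Longrightarrow> P \<inter> H n ` Y = {}"
    and cut: "\<And>g. continuous_on UNIV g \<Longrightarrow> (\<And>y. 0 \<le> g y) \<Longrightarrow> (\<And>y. g y \<le> 1) \<Longrightarrow>
      (\<And>y. y \<in> P \<Longrightarrow> g y = 0) \<Longrightarrow> 1 - \<epsilon> < norm ((1 - \<iota>r g) * x * (1 - \<iota>r g))"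
    by (rule norm_cut[OF approximable_UNIV px x(2) \<epsilon>, of N]) (rule that; blast)
  let ?Z = "\<Union>n\<in>{- int N..int N}. H n ` Y"
  have "H n ` Y = H (- n) -` Y" for n by (auto simp: mem_H_image)
  then have "closed ?Z" by (auto intro!: closed_UN closed_H_vimage closed_Y)
  moreover have "P \<inter> H n ` Y = {}" if "n \<in> {- int N..int N}" for n
    using that by (intro P(2)) auto
  then have "P \<inter> ?Z = {}" by blast
  ultimately obtain r3 :: "'x \<Rightarrow> real" where r3: "continuous_on UNIV r3" "\<And>x. 0 \<le> r3 x" "\<And>x. r3 x \<le> 1"
    "\<And>x. x \<in> P \<Longrightarrow> r3 x = 0" "\<And>x. x \<in> ?Z \<Longrightarrow> r3 x = 1"
    using urysohn[of P ?Z] finite_imp_closed[OF P(1)] by blast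
  define g where "g x = r1 x * r2 x * r3 x" for x
  have cg: "continuous_on UNIV g" unfolding g_def by (intro continuous_on_mult r1 r2 r3)
  have g0: "0 \<le> g x" for x unfolding g_def using r1(2) r2(2) r3(2) by simp
  have g1: "g x \<le> 1" for x
    unfolding g_def using r1(2,3) r2(2,3) r3(2,3) by (simp add: mult_le_one)
  have gY: "g (H n y) = 1" if n: "\<bar>n\<bar> \<le> int N" and y: "y \<in> Y" for n y
  proof -
    have "H n y \<in> ?Z" using n y by (auto simp: abs_le_iff)
    then show ?thesis using r1(4)[OF n y] r2(4)[OF n y] r3(5) by (simp add: g_def)
  qed
  have "cuntz_subeq UNIV (\<iota>r (\<lambda>x. r1 x * (r2 x * r3 x))) x"
    by (rule cuntz_subeq_cut[OF cstar_subalgebra_UNIV UNIV_I f1(4) UNIV_I r1(6,1)])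
      (intro continuous_on_mult mult_nonneg_nonneg r2 r3)+
  then have gx: "cuntz_subeq UNIV (\<iota>r g) x" by (simp add: g_def mult.assoc)
  have "cuntz_subeq B (\<iota>r (\<lambda>x. r2 x * (r1 x * r3 x))) y"
    by (rule cuntz_subeq_cut[OF B_subalgebra \<iota>_B f2(4) r2(5,6,1)])
      (assumption | intro continuous_on_mult mult_nonneg_nonneg r1 r3)+
  then have gy: "cuntz_subeq B (\<iota>r g) y" by (simp add: g_def ac_simps)
  have "positive (1 - \<iota>r g)"
    using positive_\<iota>r[of "\<lambda>x. 1 - g x"] \<iota>r_diff[of "\<lambda>_. 1" g] cg g1
    by (simp add: \<iota>_one continuous_on_diff)
  moreover have "positive (\<iota>r g)" by (rule positive_\<iota>r[OF cg g0])
  moreover have "(1 - \<iota>r g) * c j \<in> B" if "j \<in> {1..m}" for j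
    by (rule cut_sum_in_B[OF c(1) KN[OF that] cg gY])
  moreover have "1 - \<epsilon> < norm ((1 - \<iota>r g) * x * (1 - \<iota>r g))"
    by (rule cut[OF cg g0 g1]) (simp add: g_def r3(4))
  moreover have "\<iota>r g \<in> \<iota> ` Collect cont" using cg by (auto intro: cont_of_real)
  ultimately show ?thesis using c(2) gx gy by blast
qed

lemma large_subalgebra: "large_subalgebra_crossed_product_type B"
proof -
  let ?C = "\<iota> ` Collect cont"
  have conj: "u * c * star u \<in> ?C" "star u * c * u \<in> ?C" if c: "c \<in> ?C" for c
  proof -
    from c obtain f where f: "cont f" "c = \<iota> f" by blast
    have "u * c * star u = \<iota> (\<lambda>x. f (H (- 1) x))" "star u * c * u = \<iota> (\<lambda>x. f (H 1 x))"
      using U_\<iota>_U[OF f(1), of 1] U_\<iota>_U[OF f(1), of "-1"] by (simp_all add: f(2))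
    moreover have "cont (\<lambda>x. f (H n x))" for n by (rule continuous_on_H[OF f(1)])
    ultimately show "u * c * star u \<in> ?C" "star u * c * u \<in> ?C" by blast+
  qed
  have one: "1 \<in> ?C" using \<iota>_one by (metis continuous_on_const image_eqI mem_Collect_eq)
  show ?thesis
    unfolding large_subalgebra_crossed_product_type_def
  proof (rule conjI[OF infinite_dim], rule conjI[OF simple], rule conjI[OF B_subalgebra],
      rule exI[of _ ?C], rule exI[of _ "{u}"], intro conjI allI impI)
    fix m :: nat and a :: "nat \<Rightarrow> 'a" and \<epsilon> :: real and x y :: 'a
    assume *: "m \<ge> 1 \<and> \<epsilon> > 0 \<and> positive x \<and> norm x = 1 \<and> y \<in> B \<and> positive y \<and> y \<noteq> 0"
    show "\<exists>(c::nat \<Rightarrow> 'a) g. g \<in> ?C \<and> positive g \<and> positive (1 - g) \<and>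
      (\<forall>j\<in>{1..m}. norm (c j - a j) < \<epsilon>) \<and> (\<forall>j\<in>{1..m}. (1 - g) * c j \<in> B) \<and>
      cuntz_subeq B g y \<and> cuntz_subeq UNIV g x \<and> norm ((1 - g) * x * (1 - g)) > 1 - \<epsilon>"
      by (rule large_condition) (use * in auto)
  qed (use cstar_subalgebra_range_\<iota> \<iota>_B unitary_u one
      generated_by_range_and_u conj in auto)
qed

end

theorem theorem7p10:
  fixes h :: "'x::t2_space \<Rightarrow> 'x"
    and Y :: "'x set"
    and \<iota> :: "('x \<Rightarrow> complex) \<Rightarrow> 'a::unital_cstar_algebra"
    and u :: 'a
  assumes "compact (UNIV :: 'x set)"
    and "minimal_homeomorphism h"
    and "compact Y"
    and "Y \<noteq> {}"
    and "\<And>n::int. n \<noteq> 0 \<Longrightarrow> int_funpow h n ` Y \<inter> Y = {}"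
    and "is_crossed_product h \<iota> u"
  shows "large_subalgebra_crossed_product_type (orbit_breaking_subalgebra \<iota> u Y)"
proof -
  interpret minimal_crossed_product h Y \<iota> u
    by unfold_locales (fact assms)+
  show ?thesis by (rule large_subalgebra)
qed

end
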